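(* Fix $K>\sigma>0$ and let $$\alpha=\frac{(\sigma^2+K^2)^2}{4(\sigma^4+K^4)}.$$ 1. (Lower bound) There exist a $K$-subgaussian distribution $\mathbb{P}$ on $\mathbb{R}$ and a sequence $\delta_n>0$ with $\delta_n\to0$ such that $$\limsup_{n\to\infty}\ n^{\alpha+\delta_n}\,\mathbb{E}\left[W_2\big(\mathbb{P}_n*\mathcal{N}(0,\sigma^2),\ \mathbb{P}*\mathcal{N}(0,\sigma^2)\big)\right]>0.$$ 2. (Upper bound) There exists a sequence $\delta_n>0$ with $\delta_n\to0$ such that for every $K$-subgaussian distribution $\mathbb{P}$ on $\mathbb{R}$ and every $n\ge2$, $$\mathbb{E}\left[W_2^2\big(\mathbb{P}*\mathcal{N}(0,\sigma^2),\ \mathbb{P}_n*\mathcal{N}(0,\sigma^2)\big)\right]\le n^{-2\alpha+\delta_n}.$$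
   Context: A probability distribution $\mathbb{P}$ on $\mathbb{R}$ is $K$-subgaussian if, for $X\sim\mathbb{P}$, $\mathbb{E}[e^{\lambda (X-\mathbb{E}[X])}]\le e^{\frac12K^2\lambda^2}$ for all $\lambda\in\mathbb{R}$. $\mathbb{P}_n=\frac1n\sum_{i=1}^n\delta_{X_i}$ is the empirical measure of i.i.d. samples $X_1,\dots,X_n\sim\mathbb{P}$; the outer expectation is over these samples. $*$ is convolution of measures. $W_2^2(\mu,\nu)=\inf \mathbb{E}|X-Y|^2$ over all couplings $(X,Y)$ of $\mu$ and $\nu$. *)

theory Defs
  imports "HOL-Probability.Probability"
begin

text \<open>Requiring the inequality between extended nonnegative integrals includes finiteness of the
  moment generating function.\<close>

definition subgaussian :: "real \<Rightarrow> real measure \<Rightarrow> bool" where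
  "subgaussian K P \<longleftrightarrow>
     real_distribution P \<and> integrable P (\<lambda>x. x) \<and>
     (\<forall>l::real. (\<integral>\<^sup>+x. ennreal (exp (l * (x - (\<integral>y. y \<partial>P)))) \<partial>P)
                 \<le> ennreal (exp (1 / 2 * K\<^sup>2 * l\<^sup>2)))"

text \<open>The second parameter of \<^const>\<open>normal_density\<close> is the standard deviation, so this is the
  centred normal law with variance \<open>\<sigma>\<^sup>2\<close>.\<close>

definition gaussian :: "real \<Rightarrow> real measure" where
  "gaussian \<sigma> = density lborel (\<lambda>x. ennreal (normal_density 0 \<sigma> x))"

definition empirical :: "nat \<Rightarrow> (nat \<Rightarrow> real) \<Rightarrow> real measure" where
  "empirical n X =
     measure_of UNIV (sets borel) (\<lambda>A. (\<Sum>i\<in>{1..n}. emeasure (return borel (X i)) A) / of_nat n)"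

definition couplings :: "real measure \<Rightarrow> real measure \<Rightarrow> (real \<times> real) measure set" where
  "couplings \<mu> \<nu> = {\<pi>. prob_space \<pi> \<and> sets \<pi> = sets (borel \<Otimes>\<^sub>M borel) \<and>
                       distr \<pi> borel fst = \<mu> \<and> distr \<pi> borel snd = \<nu>}"

definition W2_sq :: "real measure \<Rightarrow> real measure \<Rightarrow> ennreal" where
  "W2_sq \<mu> \<nu> = (INF \<pi>\<in>couplings \<mu> \<nu>. \<integral>\<^sup>+p. ennreal (\<bar>fst p - snd p\<bar>\<^sup>2) \<partial>\<pi>)"

definition W2 :: "real measure \<Rightarrow> real measure \<Rightarrow> ennreal" where
  "W2 \<mu> \<nu> = (if W2_sq \<mu> \<nu> = \<top> then \<top> else ennreal (sqrt (enn2real (W2_sq \<mu> \<nu>))))"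

text \<open>Expectation over i.i.d. samples \<open>X\<^sub>1, \<dots>, X\<^sub>n\<close> from \<open>P\<close>, realised as the coordinates of the
  \<open>n\<close>-fold product measure.\<close>

definition iid_expectation ::
    "nat \<Rightarrow> real measure \<Rightarrow> ((nat \<Rightarrow> real) \<Rightarrow> ennreal) \<Rightarrow> ennreal" where
  "iid_expectation n P F = (\<integral>\<^sup>+X. F X \<partial>(PiM {1..n} (\<lambda>_. P)))"

lemma W2_power2: "(W2 \<mu> \<nu>)\<^sup>2 = W2_sq \<mu> \<nu>"
  by (auto simp: W2_def power2_eq_square ennreal_mult_top less_top simp flip: ennreal_mult)

lemma space_empirical [simp]: "space (empirical n X) = UNIV"
  by (simp add: empirical_def space_measure_of_conv)

lemma sets_empirical [simp, measurable_cong]: "sets (empirical n X) = sets borel"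
proof -
  have "sigma_sets UNIV (sets (borel::real measure)) = sets borel"
    using sets.sigma_sets_eq[of "borel::real measure"] by simp
  then show ?thesis
    by (simp add: empirical_def sets_measure_of_conv)
qed

lemma emeasure_empirical:
  assumes "A \<in> sets borel"
  shows "emeasure (empirical n X) A = (\<Sum>i\<in>{1..n}. indicator A (X i)) / of_nat n"
proof -
  let ?f = "\<lambda>A. (\<Sum>i\<in>{1..n}. emeasure (return borel (X i)) A) / (of_nat n :: ennreal)"
  have "emeasure (empirical n X) A = ?f A"
  proof (rule emeasure_measure_of[OF empirical_def])
    show "countably_additive (sets (empirical n X)) ?f"
    proof (rule countably_additiveI)
      fix B :: "nat \<Rightarrow> real set"
      assume B: "range B \<subseteq> sets (empirical n X)" "disjoint_family B"
      have "(\<Sum>j. ?f (B j)) = (\<Sum>j. \<Sum>i\<in>{1..n}. emeasure (return borel (X i)) (B j)) / of_nat n"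
        by (simp add: divide_ennreal_def)
      also have "(\<Sum>j. \<Sum>i\<in>{1..n}. emeasure (return borel (X i)) (B j)) =
                 (\<Sum>i\<in>{1..n}. \<Sum>j. emeasure (return borel (X i)) (B j))"
        by (rule suminf_sum) simp
      also have "\<dots> = (\<Sum>i\<in>{1..n}. emeasure (return borel (X i)) (\<Union>j. B j))"
        using B by (intro sum.cong refl suminf_emeasure) auto
      finally show "(\<Sum>j. ?f (B j)) = ?f (\<Union>j. B j)" .
    qed
  qed (use assms in \<open>auto simp: positive_def\<close>)
  also have "\<dots> = (\<Sum>i\<in>{1..n}. indicator A (X i)) / of_nat n"
    using assms by simp
  finally show ?thesis .
qed

lemma real_distribution_empirical:
  assumes "n \<ge> 1"
  shows "real_distribution (empirical n X)"
proof -
  have "emeasure (empirical n X) UNIV = 1"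
    using assms ennreal_divide_self[of "of_nat n"]
    by (simp add: emeasure_empirical ennreal_of_nat_eq_real_of_nat)
  then show ?thesis
    by (auto simp: real_distribution_def real_distribution_axioms_def intro!: prob_spaceI)
qed

end

theory Submission
  imports Defs
begin

text \<open>
  Write \<open>F\<close> and \<open>F\<^sub>n\<close> for the distribution functions of the smoothed population law and of the
  smoothed empirical law, \<open>\<Phi>\<close> for that of the noise, \<open>f\<close> for the density of the smoothed population law,
  and \<open>V z\<close> for the variance of \<open>\<Phi> (z - X)\<close>, so that \<open>F z - F\<^sub>n z\<close> has variance \<open>V z / n\<close>.

  On the line the quantile coupling bounds \<open>W\<^sub>2\<^sup>2\<close> by twice the integral over \<open>z < z'\<close> of
  \<open>(F z - F\<^sub>n z')\<^sup>+ + (F\<^sub>n z - F z')\<^sup>+\<close> (lemma \<open>W2_sq_le_cdf_integral\<close>). The first summand is the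
  positive part of the fluctuation \<open>F z' - F\<^sub>n z'\<close> minus the mass \<open>q = F z' - F z\<close>, and the second one
  has the same form at \<open>z\<close>; hence the expectation of each is at most \<open>sqrt (V / n)\<close> and at most
  \<open>V / (4 n q)\<close>.

  Upper bound. The key inequality is \<open>V z \<le> C * f y powr \<gamma>\<close> for \<open>\<bar>y - z\<bar> \<le> 1\<close>, with
  \<open>\<gamma> = 4 K\<^sup>2 \<sigma>\<^sup>2 / (K\<^sup>2 + \<sigma>\<^sup>2)\<^sup>2\<close> (lemma \<open>V_le_density_powr\<close>). Mass of the population law between \<open>y\<close> and
  a threshold \<open>T\<close> shows up in \<open>f y\<close> with a factor of at least about \<open>exp (- (T - y)\<^sup>2 / (2 \<sigma>\<^sup>2))\<close>, and
  mass beyond \<open>T\<close> is at most \<open>exp (- T\<^sup>2 / (2 K\<^sup>2))\<close>; the exponent \<open>\<gamma>\<close> is what the best \<open>T\<close> gives, using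
  that Jensen's inequality keeps \<open>f y\<close> above a multiple of \<open>exp (- y\<^sup>2 / (2 \<sigma>\<^sup>2))\<close>. As \<open>q\<close> is at least
  \<open>min 1 (z' - z)\<close> times such values of \<open>f\<close>, the weighted geometric mean of the two bounds above with
  weights \<open>1 - \<kappa>\<close> and \<open>\<kappa> = 2 K\<^sup>2 \<sigma>\<^sup>2 / (K ^ 4 + \<sigma> ^ 4)\<close> makes \<open>V\<close> and \<open>f\<close> cancel. What remains is
  \<open>n powr (- (1 + \<kappa>) / 2) = n powr (- 2 \<alpha>)\<close> times the integrable singularity \<open>(z' - z) powr (- \<kappa>)\<close>
  (lemma \<open>excess_bound\<close>). A further interpolation of weight \<open>\<theta>\<close> with the Gaussian tails of \<open>F\<close> makes
  this integrable over the plane at the cost of a factor \<open>n powr (2 \<alpha> \<theta>)\<close>, and \<open>\<theta>\<close> is arbitrary.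

  Lower bound. The law \<open>spike_law K\<close> has atoms at the very sparse points \<open>h\<^sub>k = k!\<close>, of nearly the
  largest masses \<open>p\<^sub>k\<close> that \<open>K\<close>-subgaussianity permits. The number of samples at or beyond
  \<open>h\<^sub>k\<close> exceeds its mean by \<open>sqrt (n p\<^sub>k) / 3\<close> with probability bounded below (lemma
  \<open>count_upward_deviation\<close>), and the surplus mass \<open>sqrt (p\<^sub>k / n)\<close> has to be moved over a distance one
  across any unit window between the bulk near \<open>0\<close> and \<open>h\<^sub>k\<close> in which the smoothed population law has less
  mass than that. The density is lowest near \<open>b = (K\<^sup>2 + \<sigma>\<^sup>2) / (2 K\<^sup>2) * h\<^sub>k\<close>, where the contributions of
  the atom \<open>h\<^sub>k\<close> and of the bulk balance. Choosing \<open>n\<close> as large as this allows gives \<open>W\<^sub>2\<^sup>2\<close> of order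
  \<open>sqrt (p\<^sub>k / n) = n powr (- 2 \<alpha> - o(1))\<close> (lemma \<open>spike_rate\<close>).
\<close>

section \<open>Gaussian noise and smoothed distribution functions\<close>

lemma real_distribution_gaussian:
  assumes "0 < \<sigma>" shows "real_distribution (gaussian \<sigma>)"
  using prob_space_normal_density[OF assms, of 0]
  by (auto simp: gaussian_def real_distribution_def real_distribution_axioms_def)

lemma emeasure_gaussian:
  "A \<in> sets borel \<Longrightarrow> emeasure (gaussian \<sigma>) A = (\<integral>\<^sup>+y. ennreal (normal_density 0 \<sigma> y) * indicator A y \<partial>lborel)"
  by (simp add: gaussian_def emeasure_density)

lemma gaussian_cdf_increment:
  assumes "0 < \<sigma>" "z \<le> z'"
  shows "ennreal (cdf (gaussian \<sigma>) z' - cdf (gaussian \<sigma>) z) =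
         (\<integral>\<^sup>+y. ennreal (normal_density 0 \<sigma> y) * indicator {z<..z'} y \<partial>lborel)"
proof -
  interpret G: real_distribution "gaussian \<sigma>" by (rule real_distribution_gaussian[OF assms(1)])
  have "cdf (gaussian \<sigma>) z' - cdf (gaussian \<sigma>) z = measure (gaussian \<sigma>) {z<..z'}"
    using assms G.cdf_diff_eq[of z z'] by (cases "z = z'") auto
  then show ?thesis using emeasure_gaussian[of "{z<..z'}" \<sigma>]
    by (simp add: G.emeasure_eq_measure)
qed

lemma one_minus_gaussian_cdf:
  assumes "0 < \<sigma>"
  shows "ennreal (1 - cdf (gaussian \<sigma>) u) =
         (\<integral>\<^sup>+y. ennreal (normal_density 0 \<sigma> y) * indicator {u<..} y \<partial>lborel)"
proof -
  interpret G: real_distribution "gaussian \<sigma>" by (rule real_distribution_gaussian[OF assms(1)])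
  have "measure (gaussian \<sigma>) {u<..} = 1 - cdf (gaussian \<sigma>) u"
    using G.prob_compl[of "{..u}"] by (simp add: cdf_def Compl_eq_Diff_UNIV[symmetric])
  then show ?thesis using emeasure_gaussian[of "{u<..}" \<sigma>]
    by (simp add: G.emeasure_eq_measure)
qed

lemma gaussian_cdf_minus:
  assumes "0 < \<sigma>"
  shows "cdf (gaussian \<sigma>) (- u) = 1 - cdf (gaussian \<sigma>) u"
proof -
  interpret G: real_distribution "gaussian \<sigma>" by (rule real_distribution_gaussian[OF assms(1)])
  have "ennreal (1 - cdf (gaussian \<sigma>) u) =
      (\<integral>\<^sup>+y. ennreal (normal_density 0 \<sigma> y) * indicator {u<..} y \<partial>lborel)"
    by (rule one_minus_gaussian_cdf[OF assms])
  also have "\<dots> = (\<integral>\<^sup>+y. ennreal (normal_density 0 \<sigma> (-y)) * indicator {u<..} (-y) \<partial>lborel)"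
    by (subst nn_integral_real_affine[of _ "-1" 0]) auto
  also have "\<dots> = (\<integral>\<^sup>+y. ennreal (normal_density 0 \<sigma> y) * indicator {..<-u} y \<partial>lborel)"
    by (intro nn_integral_cong) (auto simp: normal_density_def split: split_indicator)
  also have "\<dots> = (\<integral>\<^sup>+y. ennreal (normal_density 0 \<sigma> y) * indicator {..-u} y \<partial>lborel)"
  proof (intro nn_integral_cong_AE)
    show "AE y in lborel. ennreal (normal_density 0 \<sigma> y) * indicator {..<-u} y
      = ennreal (normal_density 0 \<sigma> y) * indicator {..-u} y"
      using AE_lborel_singleton[of "-u"] by eventually_elim (auto split: split_indicator)
  qed
  also have "\<dots> = ennreal (cdf (gaussian \<sigma>) (-u))"
    by (subst emeasure_gaussian[symmetric]) (auto simp: cdf_def G.emeasure_eq_measure)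
  finally show ?thesis
    using G.cdf_bounded_prob[of u] G.cdf_nonneg[of "-u"] by (simp add: ennreal_inj)
qed

text \<open>The free parameter \<open>l\<close> is kept because the same \<open>l\<close> has to serve for the noise and for a subgaussian
  variable when their sum is estimated. Exponential tilting turns the centred density into a shifted one.\<close>

lemma gaussian_tail_Chernoff:
  assumes "0 < \<sigma>" "0 \<le> l"
  shows "1 - cdf (gaussian \<sigma>) u \<le> exp (l\<^sup>2 * \<sigma>\<^sup>2 / 2 - l * u)"
proof -
  have tilt: "exp (l * y) * normal_density 0 \<sigma> y = exp (l\<^sup>2 * \<sigma>\<^sup>2 / 2) * normal_density (l * \<sigma>\<^sup>2) \<sigma> y" for y
  proof -
    have "l * y - y\<^sup>2 / (2 * \<sigma>\<^sup>2) = l\<^sup>2 * \<sigma>\<^sup>2 / 2 - (y - l * \<sigma>\<^sup>2)\<^sup>2 / (2 * \<sigma>\<^sup>2)"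
      using assms by (simp add: field_simps power2_eq_square)
    then have "exp (l * y) * exp (- y\<^sup>2 / (2 * \<sigma>\<^sup>2)) = exp (l\<^sup>2 * \<sigma>\<^sup>2 / 2) * exp (- (y - l * \<sigma>\<^sup>2)\<^sup>2 / (2 * \<sigma>\<^sup>2))"
      by (simp add: exp_add[symmetric])
    then show ?thesis by (simp add: normal_density_def)
  qed
  have "ennreal (1 - cdf (gaussian \<sigma>) u) =
      (\<integral>\<^sup>+y. ennreal (normal_density 0 \<sigma> y) * indicator {u<..} y \<partial>lborel)"
    by (rule one_minus_gaussian_cdf[OF assms(1)])
  also have "\<dots> \<le> (\<integral>\<^sup>+y. ennreal (exp (- l * u)) * ennreal (exp (l * y) * normal_density 0 \<sigma> y) \<partial>lborel)"
  proof (intro nn_integral_mono)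
    fix y show "ennreal (normal_density 0 \<sigma> y) * indicator {u<..} y
      \<le> ennreal (exp (- l * u)) * ennreal (exp (l * y) * normal_density 0 \<sigma> y)"
    proof (cases "u < y")
      case True
      then have "1 \<le> exp (- l * u) * exp (l * y)" using assms by (simp add: exp_add[symmetric] mult_left_mono)
      from mult_right_mono[OF this, of "normal_density 0 \<sigma> y"] show ?thesis
        using True by (simp add: ennreal_mult[symmetric] ennreal_leI mult.assoc)
    qed simp
  qed
  also have "\<dots> = ennreal (exp (- l * u)) * (ennreal (exp (l\<^sup>2 * \<sigma>\<^sup>2 / 2)) * (\<integral>\<^sup>+y. normal_density (l * \<sigma>\<^sup>2) \<sigma> y \<partial>lborel))"
    by (simp add: tilt nn_integral_cmult ennreal_mult)
  also have "(\<integral>\<^sup>+y. normal_density (l * \<sigma>\<^sup>2) \<sigma> y \<partial>lborel) = 1"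
    using assms(1) by (subst nn_integral_eq_integral) auto
  also have "ennreal (exp (- l * u)) * (ennreal (exp (l\<^sup>2 * \<sigma>\<^sup>2 / 2)) * 1) = ennreal (exp (l\<^sup>2 * \<sigma>\<^sup>2 / 2 - l * u))"
    by (simp add: ennreal_mult[symmetric] exp_add[symmetric] algebra_simps)
  finally show ?thesis by (simp add: ennreal_le_iff)
qed

lemma gaussian_tail:
  assumes "0 < \<sigma>" "0 \<le> u"
  shows "1 - cdf (gaussian \<sigma>) u \<le> exp (- u\<^sup>2 / (2 * \<sigma>\<^sup>2))"
  using gaussian_tail_Chernoff[OF assms(1), of "u / \<sigma>\<^sup>2" u] assms
  by (simp add: power2_eq_square field_simps)

lemma cdf_gaussian_measurable [measurable]:
  assumes "0 < \<sigma>" shows "cdf (gaussian \<sigma>) \<in> borel_measurable borel"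
proof -
  interpret G: real_distribution "gaussian \<sigma>" by (rule real_distribution_gaussian[OF assms(1)])
  show ?thesis by (intro borel_measurable_mono monoI G.cdf_nondecreasing)
qed

lemma real_distribution_convolution:
  assumes "real_distribution M" "real_distribution N"
  shows "real_distribution (M \<star> N)"
proof -
  interpret M: real_distribution M by fact
  interpret N: real_distribution N by fact
  interpret MN: pair_prob_space M N ..
  have "(\<lambda>(x, y). x + y) \<in> measurable (M \<Otimes>\<^sub>M N) (borel :: real measure)" by measurable
  then show ?thesis unfolding convolution_def
    by (rule MN.real_distribution_distr)
qed

lemma cdf_convolution_gaussian:
  assumes "0 < \<sigma>" "real_distribution M"
  shows "cdf (M \<star> gaussian \<sigma>) z = (\<integral>x. cdf (gaussian \<sigma>) (z - x) \<partial>M)"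
proof -
  interpret G: real_distribution "gaussian \<sigma>" by (rule real_distribution_gaussian[OF assms(1)])
  interpret M: real_distribution M by fact
  interpret MN: real_distribution "M \<star> gaussian \<sigma>"
    by (intro real_distribution_convolution assms real_distribution_gaussian)
  note [measurable] = cdf_gaussian_measurable[OF assms(1)]
  have "emeasure (M \<star> gaussian \<sigma>) {..z} = (\<integral>\<^sup>+x. emeasure (gaussian \<sigma>) {a. a + x \<in> {..z}} \<partial>M)"
    by (rule convolution_emeasure) (auto simp: M.finite_measure_axioms G.finite_measure_axioms)
  also have "\<dots> = (\<integral>\<^sup>+x. ennreal (cdf (gaussian \<sigma>) (z - x)) \<partial>M)"
  proof (intro nn_integral_cong)
    fix x
    have "{a. a + x \<in> {..z}} = {..z - x}" by auto
    then show "emeasure (gaussian \<sigma>) {a. a + x \<in> {..z}} = ennreal (cdf (gaussian \<sigma>) (z - x))"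
      by (simp add: G.emeasure_eq_measure cdf_def)
  qed
  also have "\<dots> = ennreal (\<integral>x. cdf (gaussian \<sigma>) (z - x) \<partial>M)"
    by (intro nn_integral_eq_integral M.integrable_const_bound[where B=1] AE_I2)
       (auto simp: G.cdf_nonneg G.cdf_bounded_prob)
  finally show ?thesis
    by (simp add: MN.emeasure_eq_measure cdf_def integral_nonneg_AE measure_nonneg)
qed

text \<open>Presenting the empirical measure as an image of a uniform law makes integrals over it available as
  finite averages.\<close>

lemma empirical_eq_distr_pmf:
  assumes "n \<ge> 1"
  shows "empirical n X = distr (measure_pmf (pmf_of_set {1..n})) borel X"
proof (rule measure_eqI)
  fix A assume "A \<in> sets (empirical n X)"
  then have A: "A \<in> sets borel" by simp
  have "emeasure (empirical n X) A = (\<Sum>i\<in>{1..n}. indicator A (X i)) / of_nat n"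
    by (rule emeasure_empirical[OF A])
  also have "(\<Sum>i\<in>{1..n}. indicator A (X i)) = (of_nat (card ({1..n} \<inter> X -` A)) :: ennreal)"
    by (simp add: indicator_def sum.If_cases vimage_def Int_def)
  finally show "emeasure (empirical n X) A = emeasure (distr (measure_pmf (pmf_of_set {1..n})) borel X) A"
    using assms A by (simp add: emeasure_distr emeasure_pmf_of_set ennreal_of_nat_eq_real_of_nat divide_ennreal)
qed simp

lemma integral_empirical:
  fixes f :: "real \<Rightarrow> real"
  assumes "n \<ge> 1" "f \<in> borel_measurable borel"
  shows "(\<integral>x. f x \<partial>empirical n X) = (\<Sum>i\<in>{1..n}. f (X i)) / real n"
  using assms by (simp add: empirical_eq_distr_pmf integral_distr integral_pmf_of_set)

section \<open>Variance of the smoothed indicator against the smoothed density\<close>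

text \<open>With \<open>a = K\<^sup>2\<close> and \<open>b = \<sigma>\<^sup>2\<close>, this and the next identity say that the threshold
  \<open>T = 2 K\<^sup>2 w / (K\<^sup>2 + \<sigma>\<^sup>2)\<close> equalises the mass beyond \<open>T\<close> and the loss in reading off mass below \<open>T\<close>
  from the density: both become \<open>exp (- w\<^sup>2 / (2 \<sigma>\<^sup>2)) powr \<gamma>\<close>.\<close>

lemma balanced_threshold:
  fixes a b S w :: real
  assumes "a \<noteq> 0" "b \<noteq> 0" "S \<noteq> 0"
  shows "(2 * a * w / S)\<^sup>2 / (2 * a) = 4 * a * b / S\<^sup>2 * (w\<^sup>2 / (2 * b))"
  using assms by (simp add: field_simps power2_eq_square)

lemma balanced_exponent:
  fixes a b :: real
  assumes "a + b \<noteq> 0"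
  shows "1 - ((a - b) / (a + b))\<^sup>2 = 4 * a * b / (a + b)\<^sup>2"
proof -
  have "(a + b)\<^sup>2 - (a - b)\<^sup>2 = 4 * a * b" by (simp add: power2_eq_square algebra_simps)
  moreover have "1 - ((a - b) / (a + b))\<^sup>2 = ((a + b)\<^sup>2 - (a - b)\<^sup>2) / (a + b)\<^sup>2"
    using assms unfolding power_divide by (simp add: diff_divide_distrib)
  ultimately show ?thesis by simp
qed

text \<open>The constants below depend on \<open>K\<close> and \<open>\<sigma>\<close> only; the rate must be uniform over all \<open>K\<close>-subgaussian
  laws, so they are fixed before any law is mentioned.\<close>

locale noise_below_subgaussian =
  fixes K \<sigma> :: real
  assumes \<sigma>: "0 < \<sigma>" and \<sigma>K: "\<sigma> < K"
begin

definition second_moment_const :: real where "second_moment_const = 4 * exp (K\<^sup>2 / 2)"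

definition density_floor :: real where "density_floor = exp (- second_moment_const / (2 * \<sigma>\<^sup>2)) / sqrt (2 * pi * \<sigma>\<^sup>2)"

definition comparison_const :: real where "comparison_const = exp (1 / \<sigma>\<^sup>2) * sqrt (2 * pi * \<sigma>\<^sup>2)"

definition \<gamma> :: real where "\<gamma> = 4 * K\<^sup>2 * \<sigma>\<^sup>2 / (K\<^sup>2 + \<sigma>\<^sup>2)\<^sup>2"

definition variance_const :: real where "variance_const = 1 + comparison_const * density_floor"

lemma density_floor_pos: "0 < density_floor"
  using \<sigma> by (simp add: density_floor_def)

end

text \<open>The variable \<open>Y\<close> will be both \<open>X - E X\<close> and \<open>E X - X\<close>, so that estimates to the right of the mean
  also give those to the left of it.\<close>

locale centred_smoothing = noise_below_subgaussian K \<sigma> + prob_space M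
  for K \<sigma> :: real and M :: "'a measure" +
  fixes Y :: "'a \<Rightarrow> real"
  assumes rv [measurable]: "Y \<in> borel_measurable M"
    and int_Y: "integrable M Y" and mean_zero: "expectation Y = 0"
    and mgf: "(\<integral>\<^sup>+x. ennreal (exp (l * Y x)) \<partial>M) \<le> ennreal (exp (K\<^sup>2 * l\<^sup>2 / 2))"
begin

definition smoothed_density :: "real \<Rightarrow> real" where
  "smoothed_density y = expectation (\<lambda>x. normal_density 0 \<sigma> (y - Y x))"

lemma integrable_exp: "integrable M (\<lambda>x. exp (l * Y x))"
proof (rule integrableI_nn_integral_finite)
  show "(\<integral>\<^sup>+x. ennreal (exp (l * Y x)) \<partial>M) = ennreal (enn2real (\<integral>\<^sup>+x. ennreal (exp (l * Y x)) \<partial>M))"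
    using mgf[of l] by (intro ennreal_enn2real[symmetric]) (auto intro: le_less_trans)
qed auto

lemma expectation_exp_le: "expectation (\<lambda>x. exp (l * Y x)) \<le> exp (K\<^sup>2 * l\<^sup>2 / 2)"
  using mgf[of l] nn_integral_eq_integral[OF integrable_exp[of l]] by (simp add: ennreal_le_iff)

lemma Chernoff:
  assumes "0 \<le> T" shows "prob {x\<in>space M. T < Y x} \<le> exp (- T\<^sup>2 / (2 * K\<^sup>2))"
proof -
  define l where "l = T / K\<^sup>2"
  have l: "0 \<le> l" unfolding l_def using assms by simp
  have "prob {x\<in>space M. T < Y x} = expectation (indicator {x\<in>space M. T < Y x})"
    by simp
  also have "\<dots> \<le> expectation (\<lambda>x. exp (- (l * T)) * exp (l * Y x))"
  proof (rule integral_mono)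
    show "integrable M (\<lambda>x. exp (- (l * T)) * exp (l * Y x))" using integrable_exp[of l] by simp
    fix x show "indicator {x\<in>space M. T < Y x} x \<le> exp (- (l * T)) * exp (l * Y x)"
      using l by (auto split: split_indicator simp: exp_add[symmetric] intro!: mult_left_mono)
  qed (simp add: integrable_real_indicator emeasure_eq_measure)
  also have "\<dots> \<le> exp (- (l * T)) * exp (K\<^sup>2 * l\<^sup>2 / 2)"
    using expectation_exp_le[of l] by simp
  also have "\<dots> = exp (- T\<^sup>2 / (2 * K\<^sup>2))"
    using \<sigma> \<sigma>K by (simp add: exp_add[symmetric] l_def power2_eq_square field_simps)
  finally show ?thesis .
qed

text \<open>A crude bound suffices: the second moment enters only through the constant in the lower bound for the
  density, and \<open>t\<^sup>2 \<le> 2 (exp t + exp (- t))\<close> gives one directly from the exponential moments.\<close>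

lemma second_moment: "integrable M (\<lambda>x. (Y x)\<^sup>2)" "expectation (\<lambda>x. (Y x)\<^sup>2) \<le> second_moment_const"
proof -
  have sq: "t\<^sup>2 \<le> 2 * (exp (1 * t) + exp ((-1) * t))" for t :: real
  proof -
    have "u\<^sup>2 / 2 \<le> exp u" if "0 \<le> u" for u :: real
      using exp_lower_Taylor_quadratic[OF that] that by linarith
    from this[of "\<bar>t\<bar>"] have "t\<^sup>2 / 2 \<le> exp \<bar>t\<bar>" by simp
    also have "\<dots> \<le> exp t + exp (- t)" by (cases "0 \<le> t") auto
    finally show ?thesis by simp
  qed
  have i: "integrable M (\<lambda>x. 2 * (exp (1 * Y x) + exp ((-1) * Y x)))"
    by (intro integrable_mult_right Bochner_Integration.integrable_add integrable_exp)
  show i2: "integrable M (\<lambda>x. (Y x)\<^sup>2)"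
  proof (rule Bochner_Integration.integrable_bound[OF i])
    show "AE x in M. norm ((Y x)\<^sup>2) \<le> norm (2 * (exp (1 * Y x) + exp ((-1) * Y x)))"
      using sq by (intro AE_I2) (simp add: abs_of_nonneg add_nonneg_nonneg)
  qed simp
  have "expectation (\<lambda>x. (Y x)\<^sup>2) \<le> expectation (\<lambda>x. 2 * (exp (1 * Y x) + exp ((-1) * Y x)))"
    using i2 i sq by (rule integral_mono)
  also have "\<dots> = 2 * (expectation (\<lambda>x. exp (1 * Y x)) + expectation (\<lambda>x. exp ((-1) * Y x)))"
    using integrable_exp[of 1] integrable_exp[of "-1"] by simp
  also have "\<dots> \<le> second_moment_const"
    using expectation_exp_le[of 1] expectation_exp_le[of "-1"] by (simp add: second_moment_const_def)
  finally show "expectation (\<lambda>x. (Y x)\<^sup>2) \<le> second_moment_const" .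
qed

lemma integrable_density: "integrable M (\<lambda>x. normal_density 0 \<sigma> (y - Y x))"
proof (rule integrable_const_bound[where B="1 / sqrt (2 * pi * \<sigma>\<^sup>2)"])
  show "AE x in M. norm (normal_density 0 \<sigma> (y - Y x)) \<le> 1 / sqrt (2 * pi * \<sigma>\<^sup>2)"
    using \<sigma> by (intro AE_I2) (simp add: normal_density_def divide_right_mono)
qed simp

text \<open>Jensen's inequality for \<open>exp\<close>. The exponent is exactly that of the noise itself; estimating by the mass of
  a ball around the mean instead would lose a factor exponential in \<open>y\<close>, and the key inequality would hold only
  up to such factors.\<close>

lemma smoothed_density_ge: "density_floor * exp (- y\<^sup>2 / (2 * \<sigma>\<^sup>2)) \<le> smoothed_density y"
proof -
  define g where "g x = - (y - Y x)\<^sup>2 / (2 * \<sigma>\<^sup>2)" for x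
  have g: "g x = (- (1 / (2 * \<sigma>\<^sup>2))) * (Y x)\<^sup>2 + (y / \<sigma>\<^sup>2) * Y x + (- y\<^sup>2 / (2 * \<sigma>\<^sup>2))" for x
    using \<sigma> by (simp add: g_def power2_diff field_simps power2_eq_square)
  have ig: "integrable M g" unfolding g
    using second_moment(1) int_Y by (intro Bochner_Integration.integrable_add integrable_mult_right) auto
  have "expectation g = - (1 / (2 * \<sigma>\<^sup>2)) * expectation (\<lambda>x. (Y x)\<^sup>2) - y\<^sup>2 / (2 * \<sigma>\<^sup>2)"
    unfolding g using second_moment(1) int_Y mean_zero prob_space by simp
  also have "\<dots> \<ge> - (1 / (2 * \<sigma>\<^sup>2)) * second_moment_const - y\<^sup>2 / (2 * \<sigma>\<^sup>2)"
    using second_moment(2) \<sigma> by (simp add: divide_right_mono)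
  finally have "exp (- (1 / (2 * \<sigma>\<^sup>2)) * second_moment_const - y\<^sup>2 / (2 * \<sigma>\<^sup>2)) \<le> exp (expectation g)" by simp
  also have "\<dots> \<le> expectation (\<lambda>x. exp (g x))"
  proof (rule jensens_inequality[where I=UNIV])
    show "integrable M (\<lambda>x. exp (g x))"
    proof (rule integrable_const_bound[where B=1])
      show "AE x in M. norm (exp (g x)) \<le> 1" by (intro AE_I2) (simp add: g_def)
    qed (use ig in simp)
  qed (auto simp: ig exp_convex)
  finally have "exp (- (1 / (2 * \<sigma>\<^sup>2)) * second_moment_const - y\<^sup>2 / (2 * \<sigma>\<^sup>2)) / sqrt (2 * pi * \<sigma>\<^sup>2)
     \<le> expectation (\<lambda>x. exp (g x)) / sqrt (2 * pi * \<sigma>\<^sup>2)"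
    by (simp add: divide_right_mono)
  moreover have "exp (- (1 / (2 * \<sigma>\<^sup>2)) * second_moment_const - y\<^sup>2 / (2 * \<sigma>\<^sup>2))
     = exp (- second_moment_const / (2 * \<sigma>\<^sup>2)) * exp (- y\<^sup>2 / (2 * \<sigma>\<^sup>2))"
    by (simp add: exp_add[symmetric])
  ultimately show ?thesis
    by (simp add: smoothed_density_def normal_density_def g_def density_floor_def)
qed

text \<open>A point \<open>x < z\<close> contributes the square of a Gaussian tail, which is far smaller than the density at
  distance \<open>\<bar>y - x\<bar> \<le> z - x + 1\<close>; the square is what pays for replacing \<open>z\<close> by a point \<open>y\<close> at distance one.
  A point between \<open>z\<close> and \<open>T\<close> contributes at most one and is visible in the density at \<open>y\<close>, while points
  beyond \<open>T\<close> are given up.\<close>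

lemma tail_square_le:
  assumes "\<bar>y - z\<bar> \<le> 1"
  shows "(1 - cdf (gaussian \<sigma>) (z - x))\<^sup>2
    \<le> indicator {T<..} x + comparison_const * exp ((max 0 (T - y))\<^sup>2 / (2 * \<sigma>\<^sup>2)) * normal_density 0 \<sigma> (y - x)"
proof -
  interpret G: real_distribution "gaussian \<sigma>" by (rule real_distribution_gaussian[OF \<sigma>])
  have nn: "0 \<le> 1 - cdf (gaussian \<sigma>) (z - x)" using G.cdf_bounded_prob by simp
  have le1: "(1 - cdf (gaussian \<sigma>) (z - x))\<^sup>2 \<le> 1"
    using nn G.cdf_nonneg[of "z - x"] by (intro power_le_one) auto
  let ?m = "(max 0 (T - y))\<^sup>2"
  have eq: "comparison_const * exp (?m / (2 * \<sigma>\<^sup>2)) * normal_density 0 \<sigma> (y - x)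
     = exp ((2 + ?m - (y - x)\<^sup>2) / (2 * \<sigma>\<^sup>2))"
  proof -
    have "(2 + ?m - (y - x)\<^sup>2) / (2 * \<sigma>\<^sup>2) = 1 / \<sigma>\<^sup>2 + ?m / (2 * \<sigma>\<^sup>2) + (- (y - x)\<^sup>2 / (2 * \<sigma>\<^sup>2))"
      using \<sigma> by (simp add: field_simps)
    then show ?thesis using \<sigma>
      by (simp only: exp_add comparison_const_def normal_density_def) simp
  qed
  have pos: "0 \<le> comparison_const * exp (?m / (2 * \<sigma>\<^sup>2)) * normal_density 0 \<sigma> (y - x)"
    unfolding eq by simp
  consider "T < x" | "x \<le> T" "z \<le> x" | "x < z" by linarith
  then show ?thesis
  proof cases
    case 1
    then show ?thesis using le1 pos by simp
  next
    case 2
    have "(y - x)\<^sup>2 \<le> 2 + ?m"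
    proof (cases "x \<le> y")
      case True
      then have "\<bar>y - x\<bar> \<le> 1" using 2 assms by linarith
      then have "(y - x)\<^sup>2 \<le> 1" by (simp add: abs_square_le_1)
      then show ?thesis using zero_le_power2[of "max 0 (T - y)"] by linarith
    next
      case False
      then have "\<bar>y - x\<bar> \<le> \<bar>max 0 (T - y)\<bar>" using 2 by auto
      then show ?thesis unfolding abs_le_square_iff by linarith
    qed
    then have "1 \<le> exp ((2 + ?m - (y - x)\<^sup>2) / (2 * \<sigma>\<^sup>2))" using \<sigma> by simp
    moreover have "0 \<le> (indicator {T<..} x :: real)" by simp
    ultimately show ?thesis unfolding eq using le1 by linarith
  next
    case 3
    define u where "u = z - x"
    have "0 < u" using 3 by (simp add: u_def)
    have "\<bar>y - x\<bar> \<le> \<bar>u + 1\<bar>" using assms 3 by (auto simp: u_def)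
    then have "(y - x)\<^sup>2 \<le> (u + 1)\<^sup>2" by (simp add: abs_le_square_iff)
    moreover have "(u + 1)\<^sup>2 \<le> 2 + 2 * u\<^sup>2" using zero_le_power2[of "u - 1"] by (simp add: power2_eq_square algebra_simps)
    ultimately have a: "- (2 * u\<^sup>2) \<le> 2 + ?m - (y - x)\<^sup>2" using zero_le_power2[of "max 0 (T - y)"] by linarith
    have "(1 - cdf (gaussian \<sigma>) u)\<^sup>2 \<le> (exp (- u\<^sup>2 / (2 * \<sigma>\<^sup>2)))\<^sup>2"
      using gaussian_tail[OF \<sigma>, of u] \<open>0 < u\<close> nn by (intro power_mono) (auto simp: u_def)
    also have "\<dots> = exp (- (2 * u\<^sup>2) / (2 * \<sigma>\<^sup>2))"
      by (simp add: power2_eq_square[of "exp _"] exp_add[symmetric])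
    also have "\<dots> \<le> exp ((2 + ?m - (y - x)\<^sup>2) / (2 * \<sigma>\<^sup>2))"
      using divide_right_mono[OF a, of "2 * \<sigma>\<^sup>2"] by simp
    finally show ?thesis unfolding eq u_def by (simp add: add_increasing)
  qed
qed

text \<open>Writing the density relative to its floor as \<open>exp (- w\<^sup>2 / (2 \<sigma>\<^sup>2))\<close>, the lower bound for the density says
  \<open>w \<le> y\<close>. So \<open>T - y \<le> T - w\<close>, and the balanced threshold for \<open>w\<close> bounds both terms of the
  preceding lemma by the same power of the density.\<close>

lemma tail_variance_le_density_powr:
  assumes "0 \<le> y" "\<bar>y - z\<bar> \<le> 1"
  shows "expectation (\<lambda>x. (1 - cdf (gaussian \<sigma>) (z - Y x))\<^sup>2) \<le> variance_const * (smoothed_density y / density_floor) powr \<gamma>"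
proof -
  interpret G: real_distribution "gaussian \<sigma>" by (rule real_distribution_gaussian[OF \<sigma>])
  note [measurable] = cdf_gaussian_measurable[OF \<sigma>]
  have kd: "0 \<le> comparison_const * density_floor" using density_floor_pos \<sigma> by (simp add: comparison_const_def)
  have \<gamma>0: "0 < \<gamma>" unfolding \<gamma>_def using \<sigma> \<sigma>K by simp
  define r where "r = smoothed_density y / density_floor"
  have r_ge: "exp (- y\<^sup>2 / (2 * \<sigma>\<^sup>2)) \<le> r"
    using smoothed_density_ge[of y] density_floor_pos by (simp add: r_def field_simps)
  have r0: "0 < r" by (rule less_le_trans[OF _ r_ge]) simp
  let ?V = "expectation (\<lambda>x. (1 - cdf (gaussian \<sigma>) (z - Y x))\<^sup>2)"
  have bnd: "0 \<le> (1 - cdf (gaussian \<sigma>) u)\<^sup>2" "(1 - cdf (gaussian \<sigma>) u)\<^sup>2 \<le> 1" for u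
    using G.cdf_bounded_prob[of u] G.cdf_nonneg[of u] by (auto intro!: power_le_one)
  have iV: "integrable M (\<lambda>x. (1 - cdf (gaussian \<sigma>) (z - Y x))\<^sup>2)"
    by (rule integrable_const_bound[where B=1]) (use bnd in auto)
  show ?thesis
  proof (cases "1 \<le> r")
    case True
    have "?V \<le> 1" using iV bnd by (intro integral_le_const) auto
    also have "1 \<le> variance_const * r powr \<gamma>"
      using mult_mono[of 1 variance_const 1 "r powr \<gamma>"] True \<gamma>0 kd by (simp add: variance_const_def ge_one_powr_ge_zero)
    finally show ?thesis by (simp add: r_def)
  next
    case False
    \<comment> \<open>\<open>w\<close> is the distance at which the noise density has decayed by the factor \<open>r\<close>\<close>
    define w where "w = sqrt (- 2 * \<sigma>\<^sup>2 * ln r)"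
    have lnr: "ln r \<le> 0" using False r0 by simp
    have w0: "0 \<le> w" by (simp add: w_def lnr mult_nonneg_nonpos)
    have w2: "w\<^sup>2 = - 2 * \<sigma>\<^sup>2 * ln r"
      unfolding w_def using lnr by (intro real_sqrt_pow2) (simp add: mult_nonneg_nonpos)
    have lr: "ln r = - w\<^sup>2 / (2 * \<sigma>\<^sup>2)" using w2 \<sigma> by simp
    have r_w: "r = exp (- w\<^sup>2 / (2 * \<sigma>\<^sup>2))" unfolding lr[symmetric] using r0 by simp
    have "- y\<^sup>2 / (2 * \<sigma>\<^sup>2) \<le> - w\<^sup>2 / (2 * \<sigma>\<^sup>2)" using r_ge unfolding r_w by (rule exp_le_cancel_iff[THEN iffD1])
    then have "w\<^sup>2 \<le> y\<^sup>2" using \<sigma> by (simp add: divide_le_cancel)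
    then have wy: "w \<le> y" using assms(1) by (rule power2_le_imp_le)
    define T where "T = 2 * K\<^sup>2 * w / (K\<^sup>2 + \<sigma>\<^sup>2)"
    define \<rho> where "\<rho> = (K\<^sup>2 - \<sigma>\<^sup>2) / (K\<^sup>2 + \<sigma>\<^sup>2)"
    have K2: "\<sigma>\<^sup>2 < K\<^sup>2" using \<sigma> \<sigma>K by (intro power_strict_mono) auto
    have pos: "0 < K\<^sup>2 + \<sigma>\<^sup>2" using \<sigma> by (simp add: add_nonneg_pos)
    have T0: "0 \<le> T" unfolding T_def using w0 pos by simp
    have Tw: "T - w = \<rho> * w"
    proof -
      have "(T - w) * (K\<^sup>2 + \<sigma>\<^sup>2) = 2 * K\<^sup>2 * w - w * (K\<^sup>2 + \<sigma>\<^sup>2)"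
        unfolding T_def left_diff_distrib using pos by simp
      also have "\<dots> = (K\<^sup>2 - \<sigma>\<^sup>2) * w" by (simp add: algebra_simps)
      also have "\<dots> = (\<rho> * w) * (K\<^sup>2 + \<sigma>\<^sup>2)" unfolding \<rho>_def using pos by simp
      finally show ?thesis using pos mult_right_cancel[of "K\<^sup>2 + \<sigma>\<^sup>2" "T - w" "\<rho> * w"] by linarith
    qed
    have "0 \<le> \<rho>" unfolding \<rho>_def using K2 pos by simp
    then have "max 0 (T - y) \<le> \<rho> * w"
      using wy Tw w0 by simp
    then have m: "(max 0 (T - y))\<^sup>2 \<le> (\<rho> * w)\<^sup>2" by (intro power_mono) auto
    have tail: "prob {x\<in>space M. T < Y x} \<le> r powr \<gamma>"
    proof -
      have "T\<^sup>2 / (2 * K\<^sup>2) = \<gamma> * (w\<^sup>2 / (2 * \<sigma>\<^sup>2))"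
        unfolding T_def \<gamma>_def using pos \<sigma> \<sigma>K by (intro balanced_threshold) auto
      then have "exp (- T\<^sup>2 / (2 * K\<^sup>2)) = r powr \<gamma>"
        using r0 lr by (simp add: powr_def)
      then show ?thesis using Chernoff[OF T0] by simp
    qed
    have "exp ((max 0 (T - y))\<^sup>2 / (2 * \<sigma>\<^sup>2)) * r \<le> exp ((\<rho> * w)\<^sup>2 / (2 * \<sigma>\<^sup>2)) * r"
      using m \<sigma> r0 by (simp add: divide_right_mono)
    also have "\<dots> = r powr \<gamma>"
    proof -
      have "1 - \<rho>\<^sup>2 = \<gamma>"
        unfolding \<rho>_def \<gamma>_def using pos by (intro balanced_exponent) auto
      then have \<gamma>: "\<gamma> = 1 - \<rho>\<^sup>2" by simp
      define W where "W = w\<^sup>2 / (2 * \<sigma>\<^sup>2)"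
      have "r powr \<gamma> = exp (\<gamma> * ln r)" using r0 by (simp add: powr_def)
      also have "\<gamma> * ln r = \<rho>\<^sup>2 * W + ln r"
        unfolding \<gamma> lr by (simp add: W_def algebra_simps diff_divide_distrib)
      also have "exp (\<rho>\<^sup>2 * W + ln r) = exp (\<rho>\<^sup>2 * W) * r" using r0 by (simp add: exp_add)
      also have "\<rho>\<^sup>2 * W = (\<rho> * w)\<^sup>2 / (2 * \<sigma>\<^sup>2)" by (simp add: W_def power_mult_distrib)
      finally show ?thesis by simp
    qed
    finally have e: "exp ((max 0 (T - y))\<^sup>2 / (2 * \<sigma>\<^sup>2)) * r \<le> r powr \<gamma>" .
    let ?c = "comparison_const * exp ((max 0 (T - y))\<^sup>2 / (2 * \<sigma>\<^sup>2))"
    have iT: "integrable M (\<lambda>x. indicator {T<..} (Y x) :: real)"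
      by (rule integrable_const_bound[where B=1]) auto
    have "?V \<le> expectation (\<lambda>x. indicator {T<..} (Y x) + ?c * normal_density 0 \<sigma> (y - Y x))"
      by (rule integral_mono[OF iV]
        Bochner_Integration.integrable_add iT integrable_mult_right integrable_density tail_square_le[OF assms(2)])+
    also have "\<dots> = expectation (\<lambda>x. indicator {T<..} (Y x)) + ?c * smoothed_density y"
      using iT integrable_density by (simp add: smoothed_density_def)
    also have "expectation (\<lambda>x. indicator {T<..} (Y x)) = prob {x\<in>space M. T < Y x}"
    proof -
      have "expectation (\<lambda>x. indicator {T<..} (Y x)) = expectation (indicator {x\<in>space M. T < Y x} :: 'a \<Rightarrow> real)"
        by (intro Bochner_Integration.integral_cong) (auto split: split_indicator)
      then show ?thesis by simp
    qed
    also have "?c * smoothed_density y = comparison_const * density_floor * (exp ((max 0 (T - y))\<^sup>2 / (2 * \<sigma>\<^sup>2)) * r)"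
      unfolding r_def using density_floor_pos by simp
    also have "prob {x\<in>space M. T < Y x} + \<dots> \<le> r powr \<gamma> + comparison_const * density_floor * r powr \<gamma>"
      using tail mult_left_mono[OF e kd] by linarith
    also have "\<dots> = variance_const * r powr \<gamma>" by (simp add: variance_const_def algebra_simps)
    finally show ?thesis unfolding r_def .
  qed
qed

text \<open>Chernoff's bound for the sum of \<open>Y\<close> and the noise, whose exponents \<open>K\<^sup>2\<close> and \<open>\<sigma>\<^sup>2\<close> add.\<close>

lemma smoothed_tail:
  assumes "0 \<le> u"
  shows "expectation (\<lambda>x. 1 - cdf (gaussian \<sigma>) (u - Y x)) \<le> exp (- u\<^sup>2 / (2 * (K\<^sup>2 + \<sigma>\<^sup>2)))"
proof -
  interpret G: real_distribution "gaussian \<sigma>" by (rule real_distribution_gaussian[OF \<sigma>])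
  note [measurable] = cdf_gaussian_measurable[OF \<sigma>]
  have pos: "0 < K\<^sup>2 + \<sigma>\<^sup>2" using \<sigma> by (simp add: add_nonneg_pos)
  define l where "l = u / (K\<^sup>2 + \<sigma>\<^sup>2)"
  have l: "0 \<le> l" unfolding l_def using assms pos by simp
  have "expectation (\<lambda>x. 1 - cdf (gaussian \<sigma>) (u - Y x)) \<le> expectation (\<lambda>x. exp (l\<^sup>2 * \<sigma>\<^sup>2 / 2 - l * u) * exp (l * Y x))"
  proof (rule integral_mono)
    show "integrable M (\<lambda>x. 1 - cdf (gaussian \<sigma>) (u - Y x))"
      by (rule integrable_const_bound[where B=1]) (auto simp: G.cdf_bounded_prob G.cdf_nonneg)
    show "integrable M (\<lambda>x. exp (l\<^sup>2 * \<sigma>\<^sup>2 / 2 - l * u) * exp (l * Y x))" using integrable_exp[of l] by simp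
    fix x show "1 - cdf (gaussian \<sigma>) (u - Y x) \<le> exp (l\<^sup>2 * \<sigma>\<^sup>2 / 2 - l * u) * exp (l * Y x)"
      using gaussian_tail_Chernoff[OF \<sigma> l, of "u - Y x"] by (simp add: exp_add[symmetric] algebra_simps)
  qed
  also have "\<dots> \<le> exp (l\<^sup>2 * \<sigma>\<^sup>2 / 2 - l * u) * exp (K\<^sup>2 * l\<^sup>2 / 2)"
    using expectation_exp_le[of l] by simp
  also have "\<dots> = exp (l\<^sup>2 * (K\<^sup>2 + \<sigma>\<^sup>2) / 2 - l * u)"
    by (simp add: exp_add[symmetric] algebra_simps add_divide_distrib)
  also have "l\<^sup>2 * (K\<^sup>2 + \<sigma>\<^sup>2) = l * u" unfolding l_def using pos by (simp add: power2_eq_square)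
  also have "l * u / 2 - l * u = - (l * u / 2)" by simp
  also have "l * u / 2 = u\<^sup>2 / (2 * (K\<^sup>2 + \<sigma>\<^sup>2))" unfolding l_def by (simp add: power2_eq_square)
  finally show ?thesis by simp
qed

end

section \<open>The quantile coupling\<close>

text \<open>The square is twice the area of the triangle \<open>x \<le> z < z' < y\<close>. Written as an integral of indicators of
  events about quantiles, it can be averaged over the level of the quantile.\<close>

lemma square_dist_eq_triangle_integral:
  fixes x y :: real
  assumes "x \<le> y"
  shows "ennreal ((y - x)\<^sup>2) =
    2 * (\<integral>\<^sup>+z. \<integral>\<^sup>+z'. indicator {z<..} z' * (indicator {x..} z * indicator {..<y} z') \<partial>lborel \<partial>lborel)"
proof -
  have inner: "(\<integral>\<^sup>+z'. indicator {z<..} z' * (indicator {x..} z * indicator {..<y} z') \<partial>lborel)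
      = ennreal (y - z) * indicator {x..y} z" for z :: real
  proof -
    have "(\<integral>\<^sup>+z'. indicator {z<..} z' * (indicator {x..} z * indicator {..<y} z') \<partial>lborel)
        = (\<integral>\<^sup>+z'. indicator {x..} z * indicator {z<..<y} z' \<partial>lborel)"
      by (intro nn_integral_cong) (auto split: split_indicator)
    also have "\<dots> = indicator {x..} z * emeasure lborel {z<..<y}"
      by (simp add: nn_integral_cmult)
    also have "\<dots> = ennreal (y - z) * indicator {x..y} z"
      by (cases "z \<le> y") (auto split: split_indicator)
    finally show ?thesis .
  qed
  have "(\<integral>\<^sup>+z. ennreal (y - z) * indicator {x..y} z \<partial>lborel) = (- (y - y)\<^sup>2 / 2) - (- (y - x)\<^sup>2 / 2)"
    using assms
    by (intro nn_integral_FTC_Icc[where F="\<lambda>z. - (y - z)\<^sup>2 / 2"])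
       (auto intro!: derivative_eq_intros simp: has_real_derivative_iff_has_vector_derivative[symmetric] field_simps)
  then show ?thesis
    unfolding inner by (simp add: ennreal_mult[symmetric] flip: ennreal_numeral)
qed

lemma square_dist_eq_integral:
  fixes x y :: real
  shows "ennreal (\<bar>x - y\<bar>\<^sup>2) =
    2 * (\<integral>\<^sup>+z. \<integral>\<^sup>+z'. indicator {z<..} z' *
       (indicator {x..} z * indicator {..<y} z' + indicator {y..} z * indicator {..<x} z') \<partial>lborel \<partial>lborel)"
proof -
  have *: "ennreal ((b - a)\<^sup>2) =
    2 * (\<integral>\<^sup>+z. \<integral>\<^sup>+z'. indicator {z<..} z' *
       (indicator {a..} z * indicator {..<b} z' + indicator {b..} z * indicator {..<a} z') \<partial>lborel \<partial>lborel)"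
    if "a \<le> b" for a b :: real
    unfolding square_dist_eq_triangle_integral[OF that]
    by (intro arg_cong[where f="(*) 2"] nn_integral_cong) (use that in \<open>auto split: split_indicator\<close>)
  show ?thesis
  proof (cases "x \<le> y")
    case True
    from *[OF this] show ?thesis by (simp add: power2_commute)
  next
    case False
    then have "y \<le> x" by simp
    from *[OF this] show ?thesis by (simp add: add.commute)
  qed
qed

text \<open>For the coupling of the quantiles \<open>I\<^sub>\<mu> u \<le> z\<close> holds iff \<open>u \<le> cdf \<mu> z\<close>, and likewise for \<open>\<nu>\<close>; hence the set of levels
  \<open>u\<close> with \<open>I\<^sub>\<mu> u \<le> z\<close> and \<open>z' < I\<^sub>\<nu> u\<close> is an interval of length \<open>(cdf \<mu> z - cdf \<nu> z')\<^sup>+\<close>.\<close>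

lemma W2_sq_le_cdf_integral:
  assumes "real_distribution \<mu>" "real_distribution \<nu>"
  shows "W2_sq \<mu> \<nu> \<le> 2 * (\<integral>\<^sup>+z. \<integral>\<^sup>+z'. indicator {z<..} z' *
       (ennreal (cdf \<mu> z - cdf \<nu> z') + ennreal (cdf \<nu> z - cdf \<mu> z')) \<partial>lborel \<partial>lborel)"
proof -
  interpret \<mu>: cdf_distribution \<mu> unfolding cdf_distribution_def by (rule assms)
  interpret \<nu>: cdf_distribution \<nu> unfolding cdf_distribution_def by (rule assms)
  define \<Omega> where "\<Omega> = (restrict_space lborel {0<..<1} :: real measure)"
  interpret \<Omega>: prob_space \<Omega>
    by (auto simp: \<Omega>_def space_restrict_space emeasure_restrict_space intro!: prob_spaceI)
  have sp: "space \<Omega> = {0<..<1}" by (simp add: \<Omega>_def space_restrict_space)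
  have m1 [measurable]: "\<mu>.I \<in> measurable \<Omega> borel" and m2 [measurable]: "\<nu>.I \<in> measurable \<Omega> borel"
    using \<mu>.measurable_CI \<nu>.measurable_CI
      measurable_cong_sets[OF sets_restrict_space_cong[OF sets_lborel] refl, of "{0<..<1}" borel]
    by (simp_all add: \<Omega>_def)
  define g :: "real \<Rightarrow> real \<Rightarrow> real \<Rightarrow> ennreal" where "g u z z' =
    (if z < z' \<and> \<mu>.I u \<le> z \<and> z' < \<nu>.I u then 1 else 0) + (if z < z' \<and> \<nu>.I u \<le> z \<and> z' < \<mu>.I u then 1 else 0)" for u z z'
  have g: "indicator {z<..} z' *
       (indicator {\<mu>.I u..} z * indicator {..<\<nu>.I u} z' + indicator {\<nu>.I u..} z * indicator {..<\<mu>.I u} z') = g u z z'" for u z z'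
    by (auto simp: g_def split: split_indicator)
  define \<pi> where "\<pi> = distr \<Omega> (borel \<Otimes>\<^sub>M borel) (\<lambda>u. (\<mu>.I u, \<nu>.I u))"
  have "\<pi> \<in> couplings \<mu> \<nu>"
    unfolding couplings_def mem_Collect_eq
  proof (intro conjI)
    show "prob_space \<pi>" unfolding \<pi>_def by (rule \<Omega>.prob_space_distr) measurable
    show "sets \<pi> = sets (borel \<Otimes>\<^sub>M borel)" by (simp add: \<pi>_def)
    have "distr \<pi> borel fst = distr \<Omega> borel (fst \<circ> (\<lambda>u. (\<mu>.I u, \<nu>.I u)))"
      unfolding \<pi>_def by (rule distr_distr) measurable
    then show "distr \<pi> borel fst = \<mu>" using \<mu>.distr_I_eq_M by (simp add: o_def \<Omega>_def)
    have "distr \<pi> borel snd = distr \<Omega> borel (snd \<circ> (\<lambda>u. (\<mu>.I u, \<nu>.I u)))"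
      unfolding \<pi>_def by (rule distr_distr) measurable
    then show "distr \<pi> borel snd = \<nu>" using \<nu>.distr_I_eq_M by (simp add: o_def \<Omega>_def)
  qed
  then have "W2_sq \<mu> \<nu> \<le> (\<integral>\<^sup>+p. ennreal (\<bar>fst p - snd p\<bar>\<^sup>2) \<partial>\<pi>)"
    unfolding W2_sq_def by (rule INF_lower)
  also have "\<dots> = (\<integral>\<^sup>+u. ennreal (\<bar>\<mu>.I u - \<nu>.I u\<bar>\<^sup>2) \<partial>\<Omega>)"
    unfolding \<pi>_def by (subst nn_integral_distr) auto
  also have "\<dots> = (\<integral>\<^sup>+u. 2 * (\<integral>\<^sup>+z. \<integral>\<^sup>+z'. g u z z' \<partial>lborel \<partial>lborel) \<partial>\<Omega>)"
    by (subst square_dist_eq_integral) (simp add: g)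
  also have "\<dots> = 2 * (\<integral>\<^sup>+z. \<integral>\<^sup>+z'. \<integral>\<^sup>+u. g u z z' \<partial>\<Omega> \<partial>lborel \<partial>lborel)"
  proof -
    interpret L: pair_sigma_finite lborel \<Omega> ..
    have "(\<integral>\<^sup>+u. 2 * (\<integral>\<^sup>+z. \<integral>\<^sup>+z'. g u z z' \<partial>lborel \<partial>lborel) \<partial>\<Omega>)
      = 2 * (\<integral>\<^sup>+u. (\<integral>\<^sup>+z. \<integral>\<^sup>+z'. g u z z' \<partial>lborel \<partial>lborel) \<partial>\<Omega>)"
      by (rule nn_integral_cmult) (simp add: g_def)
    also have "(\<integral>\<^sup>+u. (\<integral>\<^sup>+z. \<integral>\<^sup>+z'. g u z z' \<partial>lborel \<partial>lborel) \<partial>\<Omega>)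
      = (\<integral>\<^sup>+z. \<integral>\<^sup>+u. (\<integral>\<^sup>+z'. g u z z' \<partial>lborel) \<partial>\<Omega> \<partial>lborel)"
      by (rule L.Fubini') (simp add: g_def split_beta')
    also have "\<dots> = (\<integral>\<^sup>+z. \<integral>\<^sup>+z'. \<integral>\<^sup>+u. g u z z' \<partial>\<Omega> \<partial>lborel \<partial>lborel)"
      by (intro nn_integral_cong L.Fubini') (simp add: g_def split_beta')
    finally show ?thesis .
  qed
  also have "\<dots> \<le> 2 * (\<integral>\<^sup>+z. \<integral>\<^sup>+z'. indicator {z<..} z' *
       (ennreal (cdf \<mu> z - cdf \<nu> z') + ennreal (cdf \<nu> z - cdf \<mu> z')) \<partial>lborel \<partial>lborel)"
  proof (intro mult_left_mono nn_integral_mono)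
    fix z z' :: real
    have meas: "(\<integral>\<^sup>+u. indicator {A..B} u \<partial>\<Omega>) \<le> ennreal (B - A)" for A B :: real
    proof -
      have "(\<integral>\<^sup>+u. indicator {A..B} u \<partial>\<Omega>) = (\<integral>\<^sup>+u. indicator {A..B} u * indicator {0<..<1} u \<partial>lborel)"
        unfolding \<Omega>_def by (subst nn_integral_restrict_space) auto
      also have "\<dots> \<le> (\<integral>\<^sup>+u. indicator {A..B} u \<partial>lborel)"
        by (intro nn_integral_mono) (auto split: split_indicator)
      also have "\<dots> \<le> ennreal (B - A)"
        by (cases "A \<le> B") auto
      finally show ?thesis .
    qed
    have "(\<integral>\<^sup>+u. g u z z' \<partial>\<Omega>)
      \<le> (\<integral>\<^sup>+u. indicator {z<..} z' * (indicator {cdf \<nu> z'..cdf \<mu> z} u + indicator {cdf \<mu> z'..cdf \<nu> z} u) \<partial>\<Omega>)"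
    proof (rule nn_integral_mono)
      fix u assume "u \<in> space \<Omega>"
      then have u: "0 < u" "u < 1" by (auto simp: sp)
      have "(indicator {\<mu>.I u..} z * indicator {..<\<nu>.I u} z' :: ennreal) \<le> indicator {cdf \<nu> z'..cdf \<mu> z} u"
        using \<mu>.pseudoinverse[OF u, of z] \<nu>.pseudoinverse[OF u, of z']
        by (auto split: split_indicator)
      moreover have "(indicator {\<nu>.I u..} z * indicator {..<\<mu>.I u} z' :: ennreal) \<le> indicator {cdf \<mu> z'..cdf \<nu> z} u"
        using \<nu>.pseudoinverse[OF u, of z] \<mu>.pseudoinverse[OF u, of z']
        by (auto split: split_indicator)
      ultimately show "g u z z' \<le> indicator {z<..} z' * (indicator {cdf \<nu> z'..cdf \<mu> z} u + indicator {cdf \<mu> z'..cdf \<nu> z} u)"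
        unfolding g[symmetric]
        by (intro mult_left_mono add_mono) auto
    qed
    also have "\<dots> = indicator {z<..} z' * ((\<integral>\<^sup>+u. indicator {cdf \<nu> z'..cdf \<mu> z} u \<partial>\<Omega>) + (\<integral>\<^sup>+u. indicator {cdf \<mu> z'..cdf \<nu> z} u \<partial>\<Omega>))"
    proof -
      have im: "indicator {A..B} \<in> borel_measurable \<Omega>" for A B :: real
        unfolding \<Omega>_def by (intro measurable_restrict_space1) simp
      show ?thesis
        by (subst nn_integral_cmult) (intro borel_measurable_add im, subst nn_integral_add, intro im, intro im, simp)
    qed
    also have "\<dots> \<le> indicator {z<..} z' * (ennreal (cdf \<mu> z - cdf \<nu> z') + ennreal (cdf \<nu> z - cdf \<mu> z'))"
      by (intro mult_left_mono add_mono meas) auto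
    finally show "(\<integral>\<^sup>+u. g u z z' \<partial>\<Omega>)
       \<le> indicator {z<..} z' * (ennreal (cdf \<mu> z - cdf \<nu> z') + ennreal (cdf \<nu> z - cdf \<mu> z'))" .
  qed simp
  finally show ?thesis .
qed

section \<open>Moments of empirical means\<close>

lemma second_moment_empirical_mean:
  fixes \<xi> :: "real \<Rightarrow> real"
  assumes "real_distribution P" "n \<ge> 1"
    and [measurable]: "\<xi> \<in> borel_measurable borel" and bd: "\<And>x. \<bar>\<xi> x\<bar> \<le> 1"
  shows "(\<integral>\<^sup>+X. ennreal (((\<Sum>i\<in>{1..n}. \<xi> (X i)) / real n - (\<integral>x. \<xi> x \<partial>P))\<^sup>2) \<partial>PiM {1..n} (\<lambda>_. P))
     = ennreal ((\<integral>x. (\<xi> x - (\<integral>x. \<xi> x \<partial>P))\<^sup>2 \<partial>P) / real n)"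
proof -
  let ?Q = "PiM {1..n} (\<lambda>_. P)"
  interpret P: real_distribution P by fact
  interpret PP: product_prob_space "\<lambda>_::nat. P" "{1..n}" ..
  interpret PP: prob_space "PiM {1..n} (\<lambda>_. P)" by (rule PP.P.prob_space_axioms)
  have [measurable_cong]: "sets P = sets borel" by simp
  define m where "m = (\<integral>x. \<xi> x \<partial>P)"
  define \<eta> where "\<eta> x = \<xi> x - m" for x
  have [measurable]: "\<eta> \<in> borel_measurable borel" unfolding \<eta>_def by measurable
  have int\<xi>: "integrable P \<xi>" by (rule P.integrable_const_bound[where B=1]) (use bd in auto)
  have "\<bar>m\<bar> \<le> 1" unfolding m_def
    using P.integral_ge_const[OF int\<xi>, of "-1"] P.integral_le_const[OF int\<xi>, of 1] bd by (auto simp: abs_le_iff minus_le_iff)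
  then have \<eta>2: "\<bar>\<eta> x\<bar> \<le> 2" for x using bd[of x] unfolding \<eta>_def by linarith
  have \<eta>0: "(\<integral>x. \<eta> x \<partial>P) = 0" unfolding \<eta>_def using int\<xi> using P.prob_space by (simp add: m_def)
  have int\<eta>: "integrable P \<eta>" unfolding \<eta>_def using int\<xi> by simp
  have bound: "\<bar>\<eta> x * \<eta> y\<bar> \<le> 4" for x y
    using mult_mono[OF \<eta>2[of x] \<eta>2[of y]] by (simp add: abs_mult)
  have intp: "integrable ?Q (\<lambda>X. \<eta> (X i) * \<eta> (X j))" if "i \<in> {1..n}" "j \<in> {1..n}" for i j
    by (rule PP.integrable_const_bound[where B=4]) (use bound that in auto)
  have cross: "(\<integral>X. \<eta> (X i) * \<eta> (X j) \<partial>?Q) = (if i = j then (\<integral>x. (\<eta> x)\<^sup>2 \<partial>P) else 0)"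
    if ij: "i \<in> {1..n}" "j \<in> {1..n}" for i j
  proof (cases "i = j")
    case True
    have "(\<integral>X. \<eta> (X i) * \<eta> (X i) \<partial>?Q)
       = (\<integral>x. \<eta> x * \<eta> x \<partial>distr ?Q P (\<lambda>\<omega>. \<omega> i))"
      using ij by (subst integral_distr) auto
    also have "distr ?Q P (\<lambda>\<omega>. \<omega> i) = P"
      by (rule distr_PiM_component) (use ij in \<open>auto simp: P.prob_space_axioms\<close>)
    finally show ?thesis using True by (simp add: power2_eq_square)
  next
    case False
    \<comment> \<open>the mixed term is an integral of a product over all coordinates, with constant factors away from \<open>i\<close> and \<open>j\<close>\<close>
    define f where "f k = (if k = i \<or> k = j then \<eta> else (\<lambda>_. 1))" for k
    have "(\<integral>X. (\<Prod>k\<in>{1..n}. f k (X k)) \<partial>?Q) = (\<Prod>k\<in>{1..n}. \<integral>x. f k x \<partial>P)"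
      by (rule PP.product_integral_prod) (auto simp: f_def int\<eta>)
    also have "\<dots> = 0" using ij \<eta>0 by (auto simp: f_def)
    also have "(\<lambda>X. (\<Prod>k\<in>{1..n}. f k (X k))) = (\<lambda>X. \<eta> (X i) * \<eta> (X j))"
    proof
      fix X
      have "(\<Prod>k\<in>{1..n}. f k (X k)) = (\<Prod>k\<in>{i,j}. f k (X k))"
        by (rule prod.mono_neutral_right) (use ij in \<open>auto simp: f_def\<close>)
      then show "(\<Prod>k\<in>{1..n}. f k (X k)) = \<eta> (X i) * \<eta> (X j)"
        using False by (simp add: f_def)
    qed
    finally show ?thesis using False by simp
  qed
  have eq: "((\<Sum>i\<in>{1..n}. \<xi> (X i)) / real n - m)\<^sup>2 = (\<Sum>i\<in>{1..n}. \<Sum>j\<in>{1..n}. \<eta> (X i) * \<eta> (X j)) / (real n)\<^sup>2" for X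
  proof -
    have "(\<Sum>i\<in>{1..n}. \<xi> (X i)) / real n - m = (\<Sum>i\<in>{1..n}. \<eta> (X i)) / real n"
      using assms(2) by (simp add: \<eta>_def sum_subtractf field_simps)
    then show ?thesis by (simp add: power_divide power2_eq_square sum_product)
  qed
  have ii: "integrable ?Q (\<lambda>X. (\<Sum>i\<in>{1..n}. \<Sum>j\<in>{1..n}. \<eta> (X i) * \<eta> (X j)) / (real n)\<^sup>2)"
    by (intro integrable_divide Bochner_Integration.integrable_sum intp) auto
  have "(\<integral>\<^sup>+X. ennreal (((\<Sum>i\<in>{1..n}. \<xi> (X i)) / real n - m)\<^sup>2) \<partial>?Q)
    = ennreal (\<integral>X. ((\<Sum>i\<in>{1..n}. \<xi> (X i)) / real n - m)\<^sup>2 \<partial>?Q)"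
  proof (rule nn_integral_eq_integral)
    show "integrable ?Q (\<lambda>X. ((\<Sum>i\<in>{1..n}. \<xi> (X i)) / real n - m)\<^sup>2)"
      unfolding eq by (rule ii)
  qed simp
  also have "(\<integral>X. ((\<Sum>i\<in>{1..n}. \<xi> (X i)) / real n - m)\<^sup>2 \<partial>?Q)
     = (\<Sum>i\<in>{1..n}. \<Sum>j\<in>{1..n}. \<integral>X. \<eta> (X i) * \<eta> (X j) \<partial>?Q) / (real n)\<^sup>2"
  proof -
    have "(\<integral>X. (\<Sum>i\<in>{1..n}. \<Sum>j\<in>{1..n}. \<eta> (X i) * \<eta> (X j)) \<partial>?Q)
       = (\<Sum>i\<in>{1..n}. \<integral>X. (\<Sum>j\<in>{1..n}. \<eta> (X i) * \<eta> (X j)) \<partial>?Q)"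
      by (rule Bochner_Integration.integral_sum) (intro Bochner_Integration.integrable_sum intp)
    also have "\<dots> = (\<Sum>i\<in>{1..n}. \<Sum>j\<in>{1..n}. \<integral>X. \<eta> (X i) * \<eta> (X j) \<partial>?Q)"
      by (intro sum.cong refl Bochner_Integration.integral_sum intp)
    finally show ?thesis unfolding eq by simp
  qed
  also have "\<dots> = (\<Sum>i\<in>{1..n}. \<Sum>j\<in>{1..n}. if i = j then (\<integral>x. (\<eta> x)\<^sup>2 \<partial>P) else 0) / (real n)\<^sup>2"
    using cross by (intro arg_cong2[where f="(/)"] sum.cong refl) auto
  also have "\<dots> = (\<integral>x. (\<eta> x)\<^sup>2 \<partial>P) / real n"
    using assms(2) by (simp add: power2_eq_square)
  finally show ?thesis by (simp add: m_def \<eta>_def)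
qed

text \<open>The centres used later are \<open>c = 1\<close> to the right of the mean and \<open>c = 0\<close> to the left of it, where the
  smoothed indicator is close to these values.\<close>

lemma (in prob_space) variance_le_second_moment:
  fixes f :: "'a \<Rightarrow> real"
  assumes "integrable M f" "integrable M (\<lambda>x. (f x)\<^sup>2)"
  shows "variance f \<le> expectation (\<lambda>x. (f x - c)\<^sup>2)"
proof -
  have "expectation (\<lambda>x. (f x - c)\<^sup>2) = expectation (\<lambda>x. (f x)\<^sup>2) - 2 * c * expectation f + c\<^sup>2"
    using assms by (simp add: power2_diff prob_space algebra_simps)
  also have "\<dots> = variance f + (expectation f - c)\<^sup>2"
    using assms using prob_space by (simp add: variance_eq power2_diff algebra_simps power2_eq_square)
  finally show ?thesis by simp
qed

lemma (in product_prob_space) nn_integral_component: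
  assumes "i \<in> I" and [measurable]: "f \<in> borel_measurable (M i)"
  shows "(\<integral>\<^sup>+X. f (X i) \<partial>PiM I M) = (\<integral>\<^sup>+x. f x \<partial>M i)"
proof -
  have "(\<integral>\<^sup>+X. f (X i) \<partial>PiM I M) = (\<integral>\<^sup>+x. f x \<partial>distr (PiM I M) (M i) (\<lambda>\<omega>. \<omega> i))"
    using assms by (subst nn_integral_distr) auto
  also have "distr (PiM I M) (M i) (\<lambda>\<omega>. \<omega> i) = M i"
    by (rule distr_PiM_component) (use assms in \<open>auto simp: prob_space_axioms M.prob_space_axioms\<close>)
  finally show ?thesis .
qed

lemma expectation_empirical_mean:
  fixes \<xi> :: "real \<Rightarrow> real"
  assumes "real_distribution P" "n \<ge> 1"
    and [measurable]: "\<xi> \<in> borel_measurable borel" and nn: "\<And>x. 0 \<le> \<xi> x"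
  shows "(\<integral>\<^sup>+X. ennreal ((\<Sum>i\<in>{1..n}. \<xi> (X i)) / real n) \<partial>PiM {1..n} (\<lambda>_. P)) = (\<integral>\<^sup>+x. ennreal (\<xi> x) \<partial>P)"
proof -
  let ?Q = "PiM {1..n} (\<lambda>_. P)"
  interpret P: real_distribution P by fact
  interpret PP: product_prob_space "\<lambda>_::nat. P" "{1..n}" ..
  have [measurable_cong]: "sets P = sets borel" by simp
  have eq: "ennreal ((\<Sum>i\<in>{1..n}. \<xi> (X i)) / real n) = (\<Sum>i\<in>{1..n}. ennreal (\<xi> (X i))) * ennreal (1 / real n)" for X
    using nn assms(2) by (simp add: sum_ennreal ennreal_mult[symmetric] sum_nonneg)
  have "(\<integral>\<^sup>+X. ennreal ((\<Sum>i\<in>{1..n}. \<xi> (X i)) / real n) \<partial>?Q)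
     = (\<integral>\<^sup>+X. (\<Sum>i\<in>{1..n}. ennreal (\<xi> (X i))) \<partial>?Q) * ennreal (1 / real n)"
    unfolding eq by (intro nn_integral_multc borel_measurable_sum) measurable
  also have "(\<integral>\<^sup>+X. (\<Sum>i\<in>{1..n}. ennreal (\<xi> (X i))) \<partial>?Q)
     = (\<Sum>i\<in>{1..n}. \<integral>\<^sup>+X. ennreal (\<xi> (X i)) \<partial>?Q)"
    by (intro nn_integral_sum) measurable
  also have "\<dots> = (\<Sum>i\<in>{1..n}. \<integral>\<^sup>+x. ennreal (\<xi> x) \<partial>P)"
    by (intro sum.cong refl PP.nn_integral_component) auto
  also have "\<dots> = of_nat n * (\<integral>\<^sup>+x. ennreal (\<xi> x) \<partial>P)" by simp
  also have "\<dots> * ennreal (1 / real n) = (\<integral>\<^sup>+x. ennreal (\<xi> x) \<partial>P)"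
  proof -
    have "of_nat n * ennreal (1 / real n) = 1" using assms(2)
      by (simp add: ennreal_of_nat_eq_real_of_nat ennreal_mult[symmetric])
    then show ?thesis by (metis mult.assoc mult.commute mult_1)
  qed
  finally show ?thesis .
qed

lemma min_le_weighted_geometric_mean:
  fixes u v :: real
  assumes "0 < u" "0 < v" "0 \<le> t" "t \<le> 1"
  shows "min u v \<le> u powr t * v powr (1 - t)"
proof -
  have "min u v = min u v powr t * min u v powr (1 - t)"
    using assms by (simp add: powr_add[symmetric] min_def)
  also have "\<dots> \<le> u powr t * v powr (1 - t)"
    using assms by (intro mult_mono powr_mono2) auto
  finally show ?thesis .
qed

lemma cdf_empirical_convolution:
  assumes "0 < \<sigma>" "n \<ge> 1"
  shows "cdf (empirical n X \<star> gaussian \<sigma>) z = (\<Sum>i\<in>{1..n}. cdf (gaussian \<sigma>) (z - X i)) / real n"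
proof -
  note [measurable] = cdf_gaussian_measurable[OF assms(1)]
  show ?thesis using assms
    by (simp add: cdf_convolution_gaussian real_distribution_empirical integral_empirical)
qed

section \<open>Expected excess at a pair of points\<close>

context noise_below_subgaussian
begin

text \<open>In terms of the exponent \<open>\<alpha>\<close> of the rate, \<open>\<kappa> = 4 \<alpha> - 1\<close>.\<close>

definition \<kappa> :: real where "\<kappa> = 2 * K\<^sup>2 * \<sigma>\<^sup>2 / (K ^ 4 + \<sigma> ^ 4)"

definition rate_const :: real where
  "rate_const = variance_const powr ((1 + \<kappa>) / 2) * density_floor powr (- \<kappa>)"

lemma K_pos: "0 < K" using \<sigma> \<sigma>K by simp

lemma \<gamma>_pos: "0 < \<gamma>"
  unfolding \<gamma>_def using \<sigma> K_pos by (simp add: add_pos_pos)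

lemma variance_const_pos: "0 < variance_const"
  using \<sigma> by (simp add: variance_const_def comparison_const_def density_floor_def add_pos_nonneg)

lemma rate_const_pos: "0 < rate_const"
  using variance_const_pos \<sigma> by (simp add: rate_const_def density_floor_def)

lemma \<kappa>_plus_1: "1 + \<kappa> = (K\<^sup>2 + \<sigma>\<^sup>2)\<^sup>2 / (K ^ 4 + \<sigma> ^ 4)"
proof -
  have "0 < K ^ 4 + \<sigma> ^ 4" using \<sigma> K_pos by (simp add: add_pos_pos)
  moreover have "(K\<^sup>2 + \<sigma>\<^sup>2)\<^sup>2 = (K ^ 4 + \<sigma> ^ 4) + 2 * K\<^sup>2 * \<sigma>\<^sup>2" by (simp add: power2_eq_square power4_eq_xxxx algebra_simps)
  ultimately show ?thesis unfolding \<kappa>_def by (simp add: add_divide_distrib)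
qed

text \<open>This is the relation that makes the variance and the density cancel in the geometric mean of the two
  bounds for the excess.\<close>

lemma \<kappa>_eq: "\<kappa> = \<gamma> * ((1 + \<kappa>) / 2)"
proof -
  have "K\<^sup>2 + \<sigma>\<^sup>2 \<noteq> 0" using \<sigma> by (simp add: add_nonneg_eq_0_iff)
  then have "(K\<^sup>2 + \<sigma>\<^sup>2)\<^sup>2 \<noteq> 0" by simp
  moreover have "4 * a / S * (S / E / 2) = 2 * a / E" if "S \<noteq> 0" for a S E :: real
    using that by simp
  ultimately have "4 * (K\<^sup>2 * \<sigma>\<^sup>2) / (K\<^sup>2 + \<sigma>\<^sup>2)\<^sup>2 * ((K\<^sup>2 + \<sigma>\<^sup>2)\<^sup>2 / (K ^ 4 + \<sigma> ^ 4) / 2)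
      = 2 * (K\<^sup>2 * \<sigma>\<^sup>2) / (K ^ 4 + \<sigma> ^ 4)" by blast
  then show ?thesis unfolding \<kappa>_plus_1 \<gamma>_def by (simp only: \<kappa>_def mult.assoc)
qed

text \<open>Strictness of \<open>\<kappa> < 1\<close> comes from \<open>\<sigma> < K\<close>, and it makes \<open>(z' - z) powr (- \<kappa>)\<close> integrable near the
  diagonal.\<close>

lemma \<kappa>_bounds: "0 < \<kappa>" "\<kappa> < 1"
proof -
  have pos: "0 < K ^ 4 + \<sigma> ^ 4" using \<sigma> K_pos by (simp add: add_pos_pos)
  show "0 < \<kappa>" unfolding \<kappa>_def using \<sigma> K_pos pos by simp
  have "\<sigma>\<^sup>2 < K\<^sup>2" using \<sigma> \<sigma>K by (intro power_strict_mono) auto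
  then have "0 < (K\<^sup>2 - \<sigma>\<^sup>2)\<^sup>2" by simp
  also have "(K\<^sup>2 - \<sigma>\<^sup>2)\<^sup>2 = (K ^ 4 + \<sigma> ^ 4) - 2 * K\<^sup>2 * \<sigma>\<^sup>2" by (simp add: power2_eq_square power4_eq_xxxx algebra_simps)
  finally show "\<kappa> < 1" unfolding \<kappa>_def using pos by simp
qed

end

locale subgaussian_sample = noise_below_subgaussian K \<sigma> for K \<sigma> :: real +
  fixes P :: "real measure"
  assumes sub: "subgaussian K P"
begin

sublocale P: real_distribution P
  using sub by (simp add: subgaussian_def)

sublocale G: real_distribution "gaussian \<sigma>"
  by (rule real_distribution_gaussian[OF \<sigma>])

lemmas [measurable] = cdf_gaussian_measurable[OF \<sigma>]

abbreviation m :: real where "m \<equiv> (\<integral>x. x \<partial>P)"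

lemma int_id: "integrable P (\<lambda>x. x)"
  using sub by (simp add: subgaussian_def)

lemma mgf_centred: "(\<integral>\<^sup>+x. ennreal (exp (l * (x - m))) \<partial>P) \<le> ennreal (exp (K\<^sup>2 * l\<^sup>2 / 2))"
  using sub by (simp add: subgaussian_def)

sublocale up: centred_smoothing K \<sigma> P "\<lambda>x. x - m"
proof
  show "P.expectation (\<lambda>x. x - m) = 0" using int_id P.prob_space by simp
  show "integrable P (\<lambda>x. x - m)" using int_id by simp
  show "(\<integral>\<^sup>+x. ennreal (exp (l * (x - m))) \<partial>P) \<le> ennreal (exp (K\<^sup>2 * l\<^sup>2 / 2))" for l
    by (rule mgf_centred)
qed simp

sublocale down: centred_smoothing K \<sigma> P "\<lambda>x. m - x"
proof
  show "P.expectation (\<lambda>x. m - x) = 0" using int_id P.prob_space by simp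
  show "integrable P (\<lambda>x. m - x)" using int_id by simp
  fix l :: real
  have "(\<lambda>x. ennreal (exp (l * (m - x)))) = (\<lambda>x. ennreal (exp ((- l) * (x - m))))"
    by (simp add: algebra_simps)
  then show "(\<integral>\<^sup>+x. ennreal (exp (l * (m - x))) \<partial>P) \<le> ennreal (exp (K\<^sup>2 * l\<^sup>2 / 2))"
    using mgf_centred[of "- l"] by (simp only: power2_minus)
qed simp

text \<open>\<open>F\<close> and \<open>f\<close> are the distribution function and the density of \<open>P \<star> gaussian \<sigma>\<close>, and \<open>Fn n X\<close> below is the
  distribution function of \<open>empirical n X \<star> gaussian \<sigma>\<close>.\<close>

definition F :: "real \<Rightarrow> real" where "F z = (\<integral>x. cdf (gaussian \<sigma>) (z - x) \<partial>P)"

definition V :: "real \<Rightarrow> real" where "V z = (\<integral>x. (cdf (gaussian \<sigma>) (z - x) - F z)\<^sup>2 \<partial>P)"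

definition f :: "real \<Rightarrow> real" where "f y = (\<integral>x. normal_density 0 \<sigma> (y - x) \<partial>P)"

lemma cdf_bounds: "0 \<le> cdf (gaussian \<sigma>) u" "cdf (gaussian \<sigma>) u \<le> 1"
  using G.cdf_nonneg G.cdf_bounded_prob by auto

lemma integrable_cdf: "integrable P (\<lambda>x. cdf (gaussian \<sigma>) (z - x))"
  by (rule P.integrable_const_bound[where B=1]) (use cdf_bounds in auto)

lemma integrable_cdf_square: "integrable P (\<lambda>x. (cdf (gaussian \<sigma>) (z - x))\<^sup>2)"
  by (rule P.integrable_const_bound[where B=1]) (use cdf_bounds in \<open>auto intro!: power_le_one\<close>)

lemma cdf_reflected_at_mean: "1 - cdf (gaussian \<sigma>) (m - z - (m - x)) = cdf (gaussian \<sigma>) (z - x)"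
  using gaussian_cdf_minus[OF \<sigma>, of "z - x"] by (simp add: algebra_simps)

text \<open>The one-sided estimate is applied to \<open>X - E X\<close> when \<open>y\<close> is to the right of the mean, and to the reflected
  variable otherwise.\<close>

lemma V_le_density_powr:
  assumes "\<bar>y - z\<bar> \<le> 1"
  shows "V z \<le> variance_const * (f y / density_floor) powr \<gamma>"
proof (cases "m \<le> y")
  case True
  have "V z \<le> (\<integral>x. (cdf (gaussian \<sigma>) (z - x) - 1)\<^sup>2 \<partial>P)"
    unfolding V_def F_def by (rule P.variance_le_second_moment[OF integrable_cdf integrable_cdf_square])
  also have "\<dots> = (\<integral>x. (1 - cdf (gaussian \<sigma>) (z - m - (x - m)))\<^sup>2 \<partial>P)"
    by (simp add: power2_commute)
  also have "\<dots> \<le> variance_const * (up.smoothed_density (y - m) / density_floor) powr \<gamma>"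
    using True assms by (intro up.tail_variance_le_density_powr) auto
  also have "up.smoothed_density (y - m) = f y"
    by (simp add: up.smoothed_density_def f_def)
  finally show ?thesis .
next
  case False
  have "V z \<le> (\<integral>x. (cdf (gaussian \<sigma>) (z - x) - 0)\<^sup>2 \<partial>P)"
    unfolding V_def F_def by (rule P.variance_le_second_moment[OF integrable_cdf integrable_cdf_square])
  also have "\<dots> = (\<integral>x. (1 - cdf (gaussian \<sigma>) (m - z - (m - x)))\<^sup>2 \<partial>P)"
    by (simp only: cdf_reflected_at_mean) simp
  also have "\<dots> \<le> variance_const * (down.smoothed_density (m - y) / density_floor) powr \<gamma>"
    using False assms by (intro down.tail_variance_le_density_powr) auto
  also have "down.smoothed_density (m - y) = f y"
    by (simp add: down.smoothed_density_def f_def normal_density_def power2_commute)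
  finally show ?thesis .
qed

lemma V_nonneg: "0 \<le> V z"
  unfolding V_def by simp

lemma F_mono: "z \<le> z' \<Longrightarrow> F z \<le> F z'"
  unfolding F_def by (intro integral_mono integrable_cdf G.cdf_nondecreasing) auto

lemma F_increment_ge:
  assumes "z \<le> z'" "0 \<le> B" and ge: "\<And>y. z \<le> y \<Longrightarrow> y \<le> z' \<Longrightarrow> B \<le> f y"
  shows "(z' - z) * B \<le> F z' - F z"
proof -
  interpret LP: pair_sigma_finite lborel P ..
  have "ennreal ((z' - z) * B) = (\<integral>\<^sup>+y. ennreal B * indicator {z<..z'} y \<partial>lborel)"
    using assms by (simp add: nn_integral_cmult ennreal_mult mult.commute)
  also have "\<dots> \<le> (\<integral>\<^sup>+y. (\<integral>\<^sup>+x. ennreal (normal_density 0 \<sigma> (y - x)) * indicator {z<..z'} y \<partial>P) \<partial>lborel)"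
  proof (rule nn_integral_mono)
    fix y :: real
    have "integrable P (\<lambda>x. normal_density 0 \<sigma> (y - x))"
      using up.integrable_density[of "y - m"] by simp
    then have "(\<integral>\<^sup>+x. ennreal (normal_density 0 \<sigma> (y - x)) \<partial>P) = ennreal (f y)"
      unfolding f_def by (intro nn_integral_eq_integral) auto
    then show "ennreal B * indicator {z<..z'} y
        \<le> (\<integral>\<^sup>+x. ennreal (normal_density 0 \<sigma> (y - x)) * indicator {z<..z'} y \<partial>P)"
      using ge[of y] by (auto split: split_indicator intro: ennreal_leI)
  qed
  also have "\<dots> = (\<integral>\<^sup>+x. (\<integral>\<^sup>+y. ennreal (normal_density 0 \<sigma> (y - x)) * indicator {z<..z'} y \<partial>lborel) \<partial>P)"
    by (rule LP.Fubini'[symmetric]) measurable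
  also have "\<dots> = (\<integral>\<^sup>+x. ennreal (cdf (gaussian \<sigma>) (z' - x) - cdf (gaussian \<sigma>) (z - x)) \<partial>P)"
  proof (rule nn_integral_cong)
    fix x :: real
    have "(\<integral>\<^sup>+y. ennreal (normal_density 0 \<sigma> (y - x)) * indicator {z<..z'} y \<partial>lborel)
       = (\<integral>\<^sup>+y. ennreal (normal_density 0 \<sigma> (x + 1 * y - x)) * indicator {z<..z'} (x + 1 * y) \<partial>lborel)"
      by (subst nn_integral_real_affine[of _ 1 x]) auto
    also have "\<dots> = (\<integral>\<^sup>+y. ennreal (normal_density 0 \<sigma> y) * indicator {z - x<..z' - x} y \<partial>lborel)"
      by (intro nn_integral_cong) (auto split: split_indicator)
    also have "\<dots> = ennreal (cdf (gaussian \<sigma>) (z' - x) - cdf (gaussian \<sigma>) (z - x))"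
      by (rule gaussian_cdf_increment[symmetric]) (use \<sigma> assms in auto)
    finally show "(\<integral>\<^sup>+y. ennreal (normal_density 0 \<sigma> (y - x)) * indicator {z<..z'} y \<partial>lborel)
       = ennreal (cdf (gaussian \<sigma>) (z' - x) - cdf (gaussian \<sigma>) (z - x))" .
  qed
  also have "\<dots> = ennreal (\<integral>x. cdf (gaussian \<sigma>) (z' - x) - cdf (gaussian \<sigma>) (z - x) \<partial>P)"
    using assms integrable_cdf by (intro nn_integral_eq_integral) (auto intro!: G.cdf_nondecreasing)
  also have "(\<integral>x. cdf (gaussian \<sigma>) (z' - x) - cdf (gaussian \<sigma>) (z - x) \<partial>P) = F z' - F z"
    unfolding F_def using integrable_cdf by simp
  finally show ?thesis
    using F_mono[OF assms(1)] by (simp add: ennreal_le_iff)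
qed

lemma F_tail_upper: "m \<le> z \<Longrightarrow> 1 - F z \<le> exp (- (z - m)\<^sup>2 / (2 * (K\<^sup>2 + \<sigma>\<^sup>2)))"
  using up.smoothed_tail[of "z - m"] integrable_cdf[of z] P.prob_space by (simp add: F_def)

lemma F_tail_lower: "z \<le> m \<Longrightarrow> F z \<le> exp (- (z - m)\<^sup>2 / (2 * (K\<^sup>2 + \<sigma>\<^sup>2)))"
  using down.smoothed_tail[of "m - z"]
  by (simp only: F_def cdf_reflected_at_mean power2_commute[of z m] diff_ge_0_iff_ge)

lemma F_bounds: "0 \<le> F z" "F z \<le> 1"
  unfolding F_def using integrable_cdf[of z] cdf_bounds
  by (auto intro!: integral_nonneg_AE P.integral_le_const)

definition Fn :: "nat \<Rightarrow> (nat \<Rightarrow> real) \<Rightarrow> real \<Rightarrow> real" where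
  "Fn n X z = (\<Sum>i\<in>{1..n}. cdf (gaussian \<sigma>) (z - X i)) / real n"

abbreviation sample :: "nat \<Rightarrow> (nat \<Rightarrow> real) measure" where
  "sample n \<equiv> PiM {1..n} (\<lambda>_. P)"

lemma prob_space_sample: "prob_space (sample n)"
  by (rule prob_space_PiM) (rule P.prob_space_axioms)

lemma measurable_Fn [measurable]: "(\<lambda>X. Fn n X z) \<in> borel_measurable (sample n)"
  unfolding Fn_def by measurable

lemma Fn_bounds: "0 \<le> Fn n X z" "Fn n X z \<le> 1"
proof -
  have "(\<Sum>i\<in>{1..n}. cdf (gaussian \<sigma>) (z - X i)) \<le> (\<Sum>i\<in>{1..n}. 1)"
    by (intro sum_mono cdf_bounds)
  then show "Fn n X z \<le> 1" by (cases "n = 0") (simp_all add: Fn_def divide_le_eq)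
  show "0 \<le> Fn n X z" by (simp add: Fn_def sum_nonneg cdf_bounds)
qed

lemma fluctuation_second_moment:
  assumes "n \<ge> 1"
  shows "(\<integral>\<^sup>+X. ennreal ((Fn n X z - F z)\<^sup>2) \<partial>sample n) = ennreal (V z / real n)"
  unfolding Fn_def F_def V_def
  by (rule second_moment_empirical_mean) (use assms P.real_distribution_axioms cdf_bounds in \<open>auto simp: abs_le_iff\<close>)

text \<open>From \<open>D - q \<le> D\<^sup>2 / (4 (q + t)) + t\<close>. The slack \<open>t\<close> lets one statement yield both bounds for the excess:
  \<open>t = sqrt (V / n) / 2\<close> gives \<open>sqrt (V / n)\<close>, and \<open>t\<close> tending to \<open>0\<close> gives \<open>V / (4 n q)\<close>.\<close>

lemma excess_le_quadratic:
  assumes "n \<ge> 1" "0 < t" "0 \<le> q" "s = 1 \<or> s = -1"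
  shows "(\<integral>\<^sup>+X. ennreal (s * (F w - Fn n X w) - q) \<partial>sample n) \<le> ennreal (V w / (4 * real n * (q + t)) + t)"
proof -
  interpret S: prob_space "sample n" by (rule prob_space_sample)
  have pos: "0 < q + t" using assms by simp
  have *: "ennreal (s * (F w - Fn n X w) - q) \<le> ennreal (1 / (4 * (q + t))) * ennreal ((Fn n X w - F w)\<^sup>2) + ennreal t" for X
  proof -
    define D where "D = s * (F w - Fn n X w)"
    have D2: "D\<^sup>2 = (Fn n X w - F w)\<^sup>2" using assms(4) by (auto simp: D_def power2_commute)
    have "D * (4 * (q + t)) \<le> D\<^sup>2 + (q + t) * (4 * (q + t))"
      using zero_le_power2[of "D - 2 * (q + t)"] by (simp add: power2_eq_square algebra_simps)
    then have "D \<le> (D\<^sup>2 + (q + t) * (4 * (q + t))) / (4 * (q + t))"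
      using pos by (simp add: pos_le_divide_eq)
    also have "\<dots> = D\<^sup>2 / (4 * (q + t)) + (q + t)" using pos by (simp add: add_divide_distrib)
    finally have "D - q \<le> 1 / (4 * (q + t)) * (Fn n X w - F w)\<^sup>2 + t" unfolding D2 by simp
    then have "ennreal (D - q) \<le> ennreal (1 / (4 * (q + t)) * (Fn n X w - F w)\<^sup>2 + t)" by (rule ennreal_leI)
    also have "\<dots> = ennreal (1 / (4 * (q + t))) * ennreal ((Fn n X w - F w)\<^sup>2) + ennreal t"
      using pos assms by (simp add: ennreal_mult[symmetric] flip: ennreal_plus)
    finally show ?thesis unfolding D_def .
  qed
  have "(\<integral>\<^sup>+X. ennreal (s * (F w - Fn n X w) - q) \<partial>sample n)
     \<le> (\<integral>\<^sup>+X. ennreal (1 / (4 * (q + t))) * ennreal ((Fn n X w - F w)\<^sup>2) + ennreal t \<partial>sample n)"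
    by (rule nn_integral_mono) (rule *)
  also have "\<dots> = ennreal (1 / (4 * (q + t))) * ennreal (V w / real n) + ennreal t"
  proof -
    have m: "(\<lambda>X. ennreal ((Fn n X w - F w)\<^sup>2)) \<in> borel_measurable (sample n)" by measurable
    show ?thesis
      by (simp only: nn_integral_add[OF borel_measurable_times_ennreal[OF borel_measurable_const m] borel_measurable_const]
        nn_integral_cmult[OF m] fluctuation_second_moment[OF assms(1)] nn_integral_const S.emeasure_space_1 mult_1_right)
  qed
  also have "\<dots> = ennreal (V w / (4 * real n * (q + t)) + t)"
    using pos assms V_nonneg[of w] by (simp add: ennreal_mult[symmetric] mult.commute mult.left_commute flip: ennreal_plus)
  finally show ?thesis .
qed

text \<open>The sign \<open>s\<close> and the point \<open>w\<close> cover both summands of the coupling bound. Solving the key inequality for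
  the density gives the constant lower bound \<open>B\<close> for \<open>f\<close> near \<open>w\<close>, hence \<open>q \<ge> l * B\<close>; then the two bounds
  \<open>u\<close> and \<open>v\<close> for the excess are combined with weights \<open>1 - \<kappa>\<close> and \<open>\<kappa>\<close>.\<close>

lemma excess_bound:
  assumes n: "n \<ge> 1" and zz: "z < z'" and w: "w = z \<or> w = z'" and s: "s = 1 \<or> s = -1"
  shows "(\<integral>\<^sup>+X. ennreal (s * (F w - Fn n X w) - (F z' - F z)) \<partial>sample n)
    \<le> ennreal (rate_const * real n powr (- (1 + \<kappa>) / 2) * min 1 (z' - z) powr (- \<kappa>))" (is "?S \<le> ennreal ?R")
proof -
  define q where "q = F z' - F z"
  have q0: "0 \<le> q" using F_mono[of z z'] zz by (simp add: q_def)
  define l where "l = min 1 (z' - z)"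
  have l: "0 < l" "l \<le> 1" "l \<le> z' - z" using zz by (auto simp: l_def)
  have R0: "0 < ?R" using n l rate_const_pos by (simp add: l_def[symmetric])
  have n0: "0 < real n" using n by simp
  show ?thesis
  proof (cases "V w = 0")
    case True
    then show ?thesis using excess_le_quadratic[OF n R0 q0 s, of w] by (simp add: q_def)
  next
    case False
    then have V0: "0 < V w" using V_nonneg[of w] by simp
    define B where "B = density_floor * (V w / variance_const) powr (1 / \<gamma>)"
    have B0: "0 < B" unfolding B_def using V0 density_floor_pos variance_const_pos by simp
    have fB: "B \<le> f y" if "\<bar>y - w\<bar> \<le> 1" for y
    proof -
      have "V w \<le> variance_const * (f y / density_floor) powr \<gamma>" by (rule V_le_density_powr[OF that])
      then have a: "V w / variance_const \<le> (f y / density_floor) powr \<gamma>" using variance_const_pos by (simp add: field_simps)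
      have fy: "0 \<le> f y" unfolding f_def by simp
      have "(V w / variance_const) powr (1 / \<gamma>) \<le> ((f y / density_floor) powr \<gamma>) powr (1 / \<gamma>)"
        using a V0 variance_const_pos \<gamma>_pos by (intro powr_mono2) auto
      also have "\<dots> = f y / density_floor" using \<gamma>_pos fy density_floor_pos by (simp add: powr_powr)
      finally show ?thesis using density_floor_pos by (simp add: B_def field_simps)
    qed
    have ql: "l * B \<le> q"
    proof (cases "w = z'")
      case True
      have "(z' - (z' - l)) * B \<le> F z' - F (z' - l)"
        using True l B0 by (intro F_increment_ge fB) auto
      also have "\<dots> \<le> q" unfolding q_def using F_mono[of z "z' - l"] l by simp
      finally show ?thesis by simp
    next
      case False
      then have "w = z" using w by simp
      have "((z + l) - z) * B \<le> F (z + l) - F z"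
        using \<open>w = z\<close> l B0 by (intro F_increment_ge fB) auto
      also have "\<dots> \<le> q" unfolding q_def using F_mono[of "z + l" "z'"] l by simp
      finally show ?thesis by simp
    qed
    have lB: "0 < l * B" using l B0 by simp
    define u where "u = sqrt (V w / n)"
    define v where "v = V w / n / (l * B)"
    have u0: "0 < u" using V0 n0 by (simp add: u_def)
    have v0: "0 < v" using V0 n0 lB by (simp add: v_def)
    have "?S \<le> ennreal (V w / (4 * real n * (q + u / 2)) + u / 2)"
      unfolding q_def[symmetric] using u0 by (intro excess_le_quadratic n q0 s) auto
    also have "\<dots> \<le> ennreal u"
    proof (rule ennreal_leI)
      have "V w / (4 * real n * (q + u / 2)) \<le> V w / (4 * real n * (u / 2))"
        using V0 n0 q0 u0 by (intro divide_left_mono mult_left_mono mult_pos_pos) auto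
      also have "V w / (4 * real n * (u / 2)) = u\<^sup>2 / (2 * u)"
        using V0 n0 by (simp add: u_def)
      also have "\<dots> = u / 2" using u0 by (simp add: power2_eq_square)
      finally show "V w / (4 * real n * (q + u / 2)) + u / 2 \<le> u" by linarith
    qed
    finally have Su: "?S \<le> ennreal u" .
    have "?S \<le> ennreal (v / 4) + ennreal t" if "0 < t" for t
    proof -
      have "?S \<le> ennreal (V w / (4 * real n * (q + t)) + t)"
        unfolding q_def[symmetric] using that by (intro excess_le_quadratic n q0 s) auto
      also have "\<dots> \<le> ennreal (v / 4 + t)"
      proof (intro ennreal_leI add_right_mono)
        have "V w / (4 * real n * (q + t)) \<le> V w / (4 * real n * (l * B))"
          using V0 n0 l B0 lB ql q0 that add_nonneg_pos[OF q0 that] by (intro divide_left_mono mult_left_mono mult_pos_pos) auto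
        then show "V w / (4 * real n * (q + t)) \<le> v / 4" by (simp add: v_def)
      qed
      also have "\<dots> = ennreal (v / 4) + ennreal t" using v0 that by simp
      finally show ?thesis .
    qed
    \<comment> \<open>any positive slack will do; \<open>v / 4\<close> avoids a limit\<close>
    then have "?S \<le> ennreal (v / 4) + ennreal (v / 4)" using v0 by simp
    also have "\<dots> \<le> ennreal v" using v0 by (simp add: ennreal_leI flip: ennreal_plus)
    finally have Sv: "?S \<le> ennreal v" .
    have "?S \<le> ennreal (min u v)" using Su Sv by (simp add: min_def)
    also have "\<dots> \<le> ennreal (u powr (1 - \<kappa>) * v powr (1 - (1 - \<kappa>)))"
      using \<kappa>_bounds by (intro ennreal_leI min_le_weighted_geometric_mean u0 v0) auto
    also have "u powr (1 - \<kappa>) * v powr (1 - (1 - \<kappa>)) = ?R"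
    proof -
      have u: "ln u = (ln (V w) - ln n) / 2" using V0 n0 unfolding u_def by (simp add: ln_sqrt ln_div)
      have lnB: "ln B = ln density_floor + (ln (V w) - ln variance_const) / \<gamma>"
        unfolding B_def using V0 variance_const_pos density_floor_pos by (simp add: ln_mult ln_powr ln_div)
      have v: "ln v = ln (V w) - ln n - ln l - ln B"
        using V0 n0 l B0 unfolding v_def by (simp add: ln_mult ln_div)
      have "\<kappa> / \<gamma> = (1 + \<kappa>) / 2" using \<kappa>_eq \<gamma>_pos by (simp add: field_simps)
      then have "\<kappa> * ((ln (V w) - ln variance_const) / \<gamma>) = (1 + \<kappa>) / 2 * (ln (V w) - ln variance_const)"
        by (metis times_divide_eq_left times_divide_eq_right mult.commute)
      then have kB: "\<kappa> * ln B = \<kappa> * ln density_floor + (1 + \<kappa>) / 2 * (ln (V w) - ln variance_const)"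
        unfolding lnB by (simp add: distrib_left)
      have "ln (u powr (1 - \<kappa>) * v powr (1 - (1 - \<kappa>))) = (1 - \<kappa>) * ln u + \<kappa> * ln v"
        using u0 v0 by (simp add: ln_mult ln_powr)
      also have "\<dots> = (1 - \<kappa>) * ((ln (V w) - ln n) / 2) + \<kappa> * (ln (V w) - ln n - ln l) - \<kappa> * ln B"
        unfolding u v by (simp add: algebra_simps)
      also have "\<dots> = ((1 + \<kappa>) / 2 * ln variance_const - \<kappa> * ln density_floor) + (- (1 + \<kappa>) / 2) * ln n - \<kappa> * ln l"
        unfolding kB by (simp add: field_simps)
      also have "\<dots> = ln ?R"
        using n0 l density_floor_pos variance_const_pos unfolding l_def[symmetric] rate_const_def
        by (simp add: ln_mult ln_powr)
      finally show ?thesis using R0 u0 v0 by (simp add: ln_inj_iff[symmetric] del: ln_inj_iff)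
    qed
    finally show ?thesis .
  qed
qed

end

section \<open>Integration over all pairs of points\<close>

context subgaussian_sample
begin

lemma expectation_Fn:
  assumes "n \<ge> 1"
  shows "(\<integral>\<^sup>+X. ennreal (Fn n X z) \<partial>sample n) = ennreal (F z)"
    and "(\<integral>\<^sup>+X. ennreal (1 - Fn n X z) \<partial>sample n) = ennreal (1 - F z)"
proof -
  have "(\<integral>\<^sup>+X. ennreal (Fn n X z) \<partial>sample n) = (\<integral>\<^sup>+x. ennreal (cdf (gaussian \<sigma>) (z - x)) \<partial>P)"
    unfolding Fn_def
    by (rule expectation_empirical_mean) (use assms P.real_distribution_axioms cdf_bounds in auto)
  also have "\<dots> = ennreal (F z)"
    unfolding F_def using integrable_cdf cdf_bounds by (intro nn_integral_eq_integral) auto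
  finally show "(\<integral>\<^sup>+X. ennreal (Fn n X z) \<partial>sample n) = ennreal (F z)" .
  have "1 - Fn n X z = (\<Sum>i\<in>{1..n}. 1 - cdf (gaussian \<sigma>) (z - X i)) / real n" for X
    using assms by (simp add: Fn_def sum_subtractf diff_divide_distrib)
  then have "(\<integral>\<^sup>+X. ennreal (1 - Fn n X z) \<partial>sample n) = (\<integral>\<^sup>+x. ennreal (1 - cdf (gaussian \<sigma>) (z - x)) \<partial>P)"
    using expectation_empirical_mean[OF P.real_distribution_axioms assms, of "\<lambda>x. 1 - cdf (gaussian \<sigma>) (z - x)"]
    by (simp add: cdf_bounds)
  also have "\<dots> = ennreal (\<integral>x. 1 - cdf (gaussian \<sigma>) (z - x) \<partial>P)"
    using integrable_cdf cdf_bounds by (intro nn_integral_eq_integral) auto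
  also have "(\<integral>x. 1 - cdf (gaussian \<sigma>) (z - x) \<partial>P) = 1 - F z"
    unfolding F_def using integrable_cdf P.prob_space by simp
  finally show "(\<integral>\<^sup>+X. ennreal (1 - Fn n X z) \<partial>sample n) = ennreal (1 - F z)" .
qed

text \<open>Both excesses are at most the mass below \<open>z\<close> of one of the two laws and at most the mass above \<open>z'\<close> of
  the other, and the two laws agree in expectation.\<close>

lemma excess_le_tails:
  assumes n: "n \<ge> 1"
  shows "(\<integral>\<^sup>+X. ennreal (F z - Fn n X z') \<partial>sample n) \<le> ennreal (min (F z) (1 - F z'))"
    and "(\<integral>\<^sup>+X. ennreal (Fn n X z - F z') \<partial>sample n) \<le> ennreal (min (F z) (1 - F z'))"
proof -
  interpret S: prob_space "sample n" by (rule prob_space_sample)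
  have c: "(\<integral>\<^sup>+X. ennreal c \<partial>sample n) = ennreal c" for c
    by (simp only: nn_integral_const S.emeasure_space_1 mult_1_right)
  have "(\<integral>\<^sup>+X. ennreal (F z - Fn n X z') \<partial>sample n) \<le> (\<integral>\<^sup>+X. ennreal (F z) \<partial>sample n)"
    by (intro nn_integral_mono ennreal_leI) (use Fn_bounds in simp)
  moreover have "(\<integral>\<^sup>+X. ennreal (F z - Fn n X z') \<partial>sample n) \<le> (\<integral>\<^sup>+X. ennreal (1 - Fn n X z') \<partial>sample n)"
    by (intro nn_integral_mono ennreal_leI) (use F_bounds in simp)
  ultimately show "(\<integral>\<^sup>+X. ennreal (F z - Fn n X z') \<partial>sample n) \<le> ennreal (min (F z) (1 - F z'))"
    unfolding c expectation_Fn[OF n] by (simp add: min_def)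
  have "(\<integral>\<^sup>+X. ennreal (Fn n X z - F z') \<partial>sample n) \<le> (\<integral>\<^sup>+X. ennreal (1 - F z') \<partial>sample n)"
    by (intro nn_integral_mono ennreal_leI) (use Fn_bounds in simp)
  moreover have "(\<integral>\<^sup>+X. ennreal (Fn n X z - F z') \<partial>sample n) \<le> (\<integral>\<^sup>+X. ennreal (Fn n X z) \<partial>sample n)"
    by (intro nn_integral_mono ennreal_leI) (use F_bounds in simp)
  ultimately show "(\<integral>\<^sup>+X. ennreal (Fn n X z - F z') \<partial>sample n) \<le> ennreal (min (F z) (1 - F z'))"
    unfolding c expectation_Fn[OF n] by (simp add: min_def)
qed

text \<open>For \<open>z < z'\<close> the point further from the mean is either \<open>z\<close> on the left or \<open>z'\<close> on the right, so one of
  the two tails decays in \<open>max \<bar>z - m\<bar> \<bar>z' - m\<bar>\<close>, and thus jointly in both variables.\<close>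

lemma tails_le:
  assumes "z < z'"
  shows "min (F z) (1 - F z') \<le> exp (- (((z - m)\<^sup>2 + (z' - m)\<^sup>2) / (4 * (K\<^sup>2 + \<sigma>\<^sup>2))))"
proof -
  define v where "v = K\<^sup>2 + \<sigma>\<^sup>2"
  have v: "0 < v" using \<sigma> by (simp add: v_def add_nonneg_pos)
  have *: "exp (- a / (2 * v)) \<le> exp (- ((a + b) / (4 * v)))" if "b \<le> a" for a b :: real
  proof -
    have "(a + b) / (4 * v) \<le> (2 * a) / (4 * v)" using that v by (intro divide_right_mono) auto
    then show ?thesis by simp
  qed
  show ?thesis
  proof (cases "z' - m \<le> - (z - m)")
    case True
    then have "\<bar>z' - m\<bar> \<le> \<bar>z - m\<bar>" "z \<le> m" using assms by auto
    then have "(z' - m)\<^sup>2 \<le> (z - m)\<^sup>2" using abs_le_square_iff by blast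
    from order_trans[OF F_tail_lower[OF \<open>z \<le> m\<close>, folded v_def] *[OF this]] show ?thesis
      by (simp add: v_def min_le_iff_disj)
  next
    case False
    then have "\<bar>z - m\<bar> \<le> \<bar>z' - m\<bar>" "m \<le> z'" using assms by auto
    then have "(z - m)\<^sup>2 \<le> (z' - m)\<^sup>2" using abs_le_square_iff by blast
    from order_trans[OF F_tail_upper[OF \<open>m \<le> z'\<close>, folded v_def] *[OF this]] show ?thesis
      by (simp add: v_def min_le_iff_disj add.commute)
  qed
qed

text \<open>The rate comes from \<open>excess_bound\<close>, which does not decay in \<open>z\<close> and \<open>z'\<close>; the decay comes from the tails,
  which do not depend on \<open>n\<close>. A geometric mean with small weight \<open>\<theta>\<close> on the tails has both.\<close>

lemma excess_interpolated:
  assumes n: "n \<ge> 1" and zz: "z < z'" and \<theta>: "0 < \<theta>" "\<theta> < 1"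
    and S: "S = (\<integral>\<^sup>+X. ennreal (F z - Fn n X z') \<partial>sample n) \<or> S = (\<integral>\<^sup>+X. ennreal (Fn n X z - F z') \<partial>sample n)"
  shows "S \<le> ennreal (max 1 rate_const * real n powr (- (1 + \<kappa>) / 2 * (1 - \<theta>)) * (min 1 (z' - z) powr (- \<kappa>)
     * exp (- \<theta> * ((z - m)\<^sup>2 + (z' - m)\<^sup>2) / (4 * (K\<^sup>2 + \<sigma>\<^sup>2)))))"
proof -
  define l where "l = min 1 (z' - z)"
  have l: "0 < l" "l \<le> 1" using zz by (auto simp: l_def)
  define E where "E = ((z - m)\<^sup>2 + (z' - m)\<^sup>2) / (4 * (K\<^sup>2 + \<sigma>\<^sup>2))"
  define u where "u = rate_const * real n powr (- (1 + \<kappa>) / 2) * l powr (- \<kappa>)"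
  have u0: "0 < u" using n l rate_const_pos by (simp add: u_def)
  have "S \<le> ennreal u"
    using S excess_bound[OF n zz, of z' 1] excess_bound[OF n zz, of z "-1"]
    by (auto simp: u_def l_def)
  moreover have "S \<le> ennreal (exp (- E))"
  proof -
    have "S \<le> ennreal (min (F z) (1 - F z'))" using S excess_le_tails[OF n, of z z'] by auto
    also have "\<dots> \<le> ennreal (exp (- E))" using tails_le[OF zz] by (intro ennreal_leI) (simp add: E_def)
    finally show ?thesis .
  qed
  ultimately have "S \<le> ennreal (min (exp (- E)) u)" by (simp add: min_def)
  also have "\<dots> \<le> ennreal (exp (- E) powr \<theta> * u powr (1 - \<theta>))"
    using \<theta> by (intro ennreal_leI min_le_weighted_geometric_mean u0) auto
  also have "\<dots> \<le> ennreal (exp (- \<theta> * E) * (max 1 rate_const * real n powr (- (1 + \<kappa>) / 2 * (1 - \<theta>)) * l powr (- \<kappa>)))"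
  proof (intro ennreal_leI mult_mono)
    show "exp (- E) powr \<theta> \<le> exp (- \<theta> * E)" by (simp add: powr_def)
    have "u powr (1 - \<theta>) = rate_const powr (1 - \<theta>) * real n powr (- (1 + \<kappa>) / 2 * (1 - \<theta>)) * l powr (- \<kappa> * (1 - \<theta>))"
      using rate_const_pos n l by (simp add: u_def powr_mult powr_powr)
    also have "\<dots> \<le> max 1 rate_const * real n powr (- (1 + \<kappa>) / 2 * (1 - \<theta>)) * l powr (- \<kappa>)"
    proof (intro mult_mono)
      show "rate_const powr (1 - \<theta>) \<le> max 1 rate_const"
      proof (cases "1 \<le> rate_const")
        case True
        then have "rate_const powr (1 - \<theta>) \<le> rate_const powr 1" using \<theta> by (intro powr_mono) auto
        then show ?thesis using True by simp
      next
        case False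
        then have "rate_const powr (1 - \<theta>) \<le> 1 powr (1 - \<theta>)" using \<theta> rate_const_pos by (intro powr_mono2) auto
        then show ?thesis by simp
      qed
      have "\<kappa> * (1 - \<theta>) \<le> \<kappa>" using \<theta> \<kappa>_bounds by (simp add: mult_left_le)
      then show "l powr (- \<kappa> * (1 - \<theta>)) \<le> l powr (- \<kappa>)" using l by (intro powr_mono') auto
    qed auto
    finally show "u powr (1 - \<theta>) \<le> max 1 rate_const * real n powr (- (1 + \<kappa>) / 2 * (1 - \<theta>)) * l powr (- \<kappa>)" .
  qed auto
  finally show ?thesis by (simp add: l_def E_def mult_ac)
qed

end

lemma nn_integral_gaussian_kernel:
  fixes m c :: real
  assumes "0 < c"
  shows "(\<integral>\<^sup>+z. ennreal (exp (- c * (z - m)\<^sup>2)) \<partial>lborel) = ennreal (sqrt (pi / c))"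
proof -
  define s where "s = sqrt (1 / (2 * c))"
  have s0: "0 < s" using assms by (simp add: s_def)
  have s2: "s\<^sup>2 = 1 / (2 * c)" unfolding s_def using assms by simp
  have eq: "exp (- c * (z - m)\<^sup>2) = sqrt (pi / c) * normal_density m s z" for z
    using assms unfolding normal_density_def s2 by simp
  have "(\<integral>\<^sup>+z. ennreal (exp (- c * (z - m)\<^sup>2)) \<partial>lborel) = ennreal (sqrt (pi / c)) * (\<integral>\<^sup>+z. ennreal (normal_density m s z) \<partial>lborel)"
    unfolding eq using assms by (simp add: ennreal_mult nn_integral_cmult)
  also have "(\<integral>\<^sup>+z. ennreal (normal_density m s z) \<partial>lborel) = 1"
    using s0 by (subst nn_integral_eq_integral) auto
  finally show ?thesis by simp
qed

lemma nn_integral_powr_near: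
  fixes z \<kappa> :: real
  assumes "\<kappa> < 1"
  shows "(\<integral>\<^sup>+z'. ennreal ((z' - z) powr (- \<kappa>)) * indicator {z<..z + 1} z' \<partial>lborel) \<le> ennreal (1 / (1 - \<kappa>))"
proof -
  have "(\<integral>\<^sup>+z'. ennreal ((z' - z) powr (- \<kappa>)) * indicator {z<..z + 1} z' \<partial>lborel)
     = (\<integral>\<^sup>+t. ennreal ((z + 1 * t - z) powr (- \<kappa>)) * indicator {z<..z + 1} (z + 1 * t) \<partial>lborel)"
    by (subst nn_integral_real_affine[of _ 1 z]) auto
  also have "\<dots> \<le> (\<integral>\<^sup>+t. ennreal (t powr (- \<kappa>) * indicator {0..1} t) \<partial>lborel)"
    by (intro nn_integral_mono) (auto split: split_indicator)
  also have "\<dots> = ennreal (1 powr (- \<kappa> + 1) / (- \<kappa> + 1))"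
  proof (rule nn_integral_has_integral_lborel)
    have "((\<lambda>x. x powr (- \<kappa>)) has_integral 1 powr (- \<kappa> + 1) / (- \<kappa> + 1)) {0..1::real}"
      using assms by (intro has_integral_powr_from_0) auto
    then show "((\<lambda>x. x powr (- \<kappa>) * indicator {0..1} x) has_integral 1 powr (- \<kappa> + 1) / (- \<kappa> + 1)) (UNIV :: real set)"
    proof (subst (asm) has_integral_restrict_UNIV[symmetric])
      have "(\<lambda>x. x powr (- \<kappa>) * indicator {0..1} x) = (\<lambda>x. if x \<in> {0..1::real} then x powr (- \<kappa>) else 0)"
        by (auto simp: fun_eq_iff)
      moreover assume "((\<lambda>x. if x \<in> {0..1} then x powr (- \<kappa>) else 0) has_integral 1 powr (- \<kappa> + 1) / (- \<kappa> + 1)) (UNIV :: real set)"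
      ultimately show ?thesis by simp
    qed
  qed auto
  finally show ?thesis by simp
qed

lemma double_integral_bound:
  fixes m c \<kappa> :: real
  assumes c: "0 < c" and \<kappa>: "0 < \<kappa>" "\<kappa> < 1"
  shows "(\<integral>\<^sup>+z. \<integral>\<^sup>+z'. indicator {z<..} z' * ennreal (min 1 (z' - z) powr (- \<kappa>) * exp (- c * ((z - m)\<^sup>2 + (z' - m)\<^sup>2))) \<partial>lborel \<partial>lborel)
    \<le> ennreal (sqrt (pi / c) * (sqrt (pi / c) + 1 / (1 - \<kappa>)))"
proof -
  let ?k = "\<lambda>z z'. indicator {z<..} z' * ennreal (min 1 (z' - z) powr (- \<kappa>) * exp (- c * ((z - m)\<^sup>2 + (z' - m)\<^sup>2)))"
  have "(\<integral>\<^sup>+z. \<integral>\<^sup>+z'. ?k z z' \<partial>lborel \<partial>lborel)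
    \<le> (\<integral>\<^sup>+z. ennreal (exp (- c * (z - m)\<^sup>2)) * ennreal (sqrt (pi / c) + 1 / (1 - \<kappa>)) \<partial>lborel)"
  proof (rule nn_integral_mono)
    fix z :: real
    have "(\<integral>\<^sup>+z'. ?k z z' \<partial>lborel)
      \<le> (\<integral>\<^sup>+z'. ennreal (exp (- c * (z - m)\<^sup>2)) * (ennreal (exp (- c * (z' - m)\<^sup>2))
          + ennreal ((z' - z) powr (- \<kappa>)) * indicator {z<..z + 1} z') \<partial>lborel)"
    proof (rule nn_integral_mono)
      fix z' :: real
      define a where "a = exp (- c * (z - m)\<^sup>2)"
      define b where "b = exp (- c * (z' - m)\<^sup>2)"
      have ab: "exp (- c * ((z - m)\<^sup>2 + (z' - m)\<^sup>2)) = a * b" "0 < a" "0 < b" "b \<le> 1"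
        using c by (auto simp: a_def b_def exp_add[symmetric] algebra_simps)
      show "indicator {z<..} z' * ennreal (min 1 (z' - z) powr (- \<kappa>) * exp (- c * ((z - m)\<^sup>2 + (z' - m)\<^sup>2)))
        \<le> ennreal (exp (- c * (z - m)\<^sup>2)) * (ennreal (exp (- c * (z' - m)\<^sup>2))
          + ennreal ((z' - z) powr (- \<kappa>)) * indicator {z<..z + 1} z')"
        unfolding ab(1) a_def[symmetric] b_def[symmetric]
      proof (cases "z' \<le> z")
        case False
        show "indicator {z<..} z' * ennreal (min 1 (z' - z) powr (- \<kappa>) * (a * b))
          \<le> ennreal a * (ennreal b + ennreal ((z' - z) powr (- \<kappa>)) * indicator {z<..z + 1} z')"
        proof (cases "z' - z \<le> 1")
          case True
          have "(z' - z) powr (- \<kappa>) * (a * b) \<le> a * (z' - z) powr (- \<kappa>)"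
            using ab by (simp add: mult_left_le mult.left_commute)
          also have "\<dots> \<le> a * (b + (z' - z) powr (- \<kappa>))" using ab by simp
          finally show ?thesis using True False ab
            by (simp add: ennreal_mult[symmetric] ennreal_leI del: ennreal_plus flip: ennreal_plus)
        next
          case False
          then show ?thesis using ab by (simp add: ennreal_mult[symmetric])
        qed
      qed simp
    qed
    also have "\<dots> = ennreal (exp (- c * (z - m)\<^sup>2)) * ((\<integral>\<^sup>+z'. ennreal (exp (- c * (z' - m)\<^sup>2)) \<partial>lborel)
          + (\<integral>\<^sup>+z'. ennreal ((z' - z) powr (- \<kappa>)) * indicator {z<..z + 1} z' \<partial>lborel))"
      by (simp add: nn_integral_cmult nn_integral_add)
    also have "\<dots> \<le> ennreal (exp (- c * (z - m)\<^sup>2)) * (ennreal (sqrt (pi / c)) + ennreal (1 / (1 - \<kappa>)))"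
      unfolding nn_integral_gaussian_kernel[OF c]
      by (intro mult_left_mono add_left_mono nn_integral_powr_near \<kappa>) simp
    also have "ennreal (sqrt (pi / c)) + ennreal (1 / (1 - \<kappa>)) = ennreal (sqrt (pi / c) + 1 / (1 - \<kappa>))"
      using c \<kappa> by simp
    finally show "(\<integral>\<^sup>+z'. ?k z z' \<partial>lborel)
      \<le> ennreal (exp (- c * (z - m)\<^sup>2)) * ennreal (sqrt (pi / c) + 1 / (1 - \<kappa>))" .
  qed
  also have "\<dots> = ennreal (sqrt (pi / c)) * ennreal (sqrt (pi / c) + 1 / (1 - \<kappa>))"
    by (subst nn_integral_multc) (simp_all only: nn_integral_gaussian_kernel[OF c], measurable)
  also have "\<dots> = ennreal (sqrt (pi / c) * (sqrt (pi / c) + 1 / (1 - \<kappa>)))"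
    using c \<kappa> by (simp add: ennreal_mult)
  finally show ?thesis .
qed

context noise_below_subgaussian
begin

text \<open>It tends to infinity as \<open>\<theta>\<close> tends to \<open>0\<close>; therefore the upper bound has an error \<open>\<delta>\<close> in the exponent.\<close>

definition upper_const :: "real \<Rightarrow> real" where
  "upper_const \<theta> = (let A = sqrt (pi / (\<theta> / (4 * (K\<^sup>2 + \<sigma>\<^sup>2)))) in
     4 * max 1 rate_const * (A * (A + 1 / (1 - \<kappa>))))"

end

context subgaussian_sample
begin

theorem expected_W2_sq_le:
  assumes n: "n \<ge> 1" and \<theta>: "0 < \<theta>" "\<theta> < 1"
  shows "iid_expectation n P (\<lambda>X. W2_sq (P \<star> gaussian \<sigma>) (empirical n X \<star> gaussian \<sigma>))
    \<le> ennreal (upper_const \<theta> * real n powr (- (1 + \<kappa>) / 2 * (1 - \<theta>)))"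
proof -
  interpret S: prob_space "sample n" by (rule prob_space_sample)
  interpret LS: pair_sigma_finite lborel "sample n" ..
  define c where "c = \<theta> / (4 * (K\<^sup>2 + \<sigma>\<^sup>2))"
  have c0: "0 < c" unfolding c_def using \<theta> \<sigma> by (simp add: add_nonneg_pos)
  define A where "A = sqrt (pi / c)"
  define C where "C = max 1 rate_const * real n powr (- (1 + \<kappa>) / 2 * (1 - \<theta>))"
  have C0: "0 \<le> C" by (simp add: C_def)
  define g where "g X z z' = ennreal (F z - Fn n X z') + ennreal (Fn n X z - F z')" for X z z'
  define ker :: "real \<Rightarrow> real \<Rightarrow> ennreal" where "ker z z' = (if z < z' then 1 else 0) *
    ennreal (min 1 (z' - z) powr (- \<kappa>) * exp (- c * ((z - m)\<^sup>2 + (z' - m)\<^sup>2)))" for z z'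
  have ker: "indicator {z<..} z' * ennreal (min 1 (z' - z) powr (- \<kappa>) * exp (- c * ((z - m)\<^sup>2 + (z' - m)\<^sup>2))) = ker z z'" for z z'
    by (simp add: ker_def indicator_def)
  have F_meas [measurable]: "F \<in> borel_measurable borel"
    by (intro borel_measurable_mono monoI F_mono)
  have "iid_expectation n P (\<lambda>X. W2_sq (P \<star> gaussian \<sigma>) (empirical n X \<star> gaussian \<sigma>))
     \<le> (\<integral>\<^sup>+X. 2 * (\<integral>\<^sup>+z. \<integral>\<^sup>+z'. indicator {z<..} z' * g X z z' \<partial>lborel \<partial>lborel) \<partial>sample n)"
    unfolding iid_expectation_def
  proof (rule nn_integral_mono)
    fix X
    have e: "cdf (P \<star> gaussian \<sigma>) = F" "cdf (empirical n X \<star> gaussian \<sigma>) = Fn n X"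
      using \<sigma> n P.real_distribution_axioms
      by (auto simp: fun_eq_iff F_def Fn_def cdf_convolution_gaussian cdf_empirical_convolution simp del: One_nat_def)
    have "real_distribution (P \<star> gaussian \<sigma>)" "real_distribution (empirical n X \<star> gaussian \<sigma>)"
      using P.real_distribution_axioms G.real_distribution_axioms n
      by (auto intro!: real_distribution_convolution real_distribution_empirical)
    from W2_sq_le_cdf_integral[OF this]
    show "W2_sq (P \<star> gaussian \<sigma>) (empirical n X \<star> gaussian \<sigma>)
      \<le> 2 * (\<integral>\<^sup>+z. \<integral>\<^sup>+z'. indicator {z<..} z' * g X z z' \<partial>lborel \<partial>lborel)"
      unfolding e g_def .
  qed
  also have "\<dots> = 2 * (\<integral>\<^sup>+z. \<integral>\<^sup>+z'. indicator {z<..} z' * (\<integral>\<^sup>+X. g X z z' \<partial>sample n) \<partial>lborel \<partial>lborel)"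
  proof -
    define h :: "(nat \<Rightarrow> real) \<Rightarrow> real \<Rightarrow> real \<Rightarrow> ennreal" where "h X z z' = (if z < z' then g X z z' else 0)" for X z z'
    have gh: "indicator {z<..} z' * g X z z' = h X z z'" for X z z' by (simp add: h_def)
    have h3 [measurable]: "(\<lambda>p. h (fst (fst p)) (snd (fst p)) (snd p)) \<in> borel_measurable ((sample n \<Otimes>\<^sub>M lborel) \<Otimes>\<^sub>M lborel)"
      unfolding h_def g_def Fn_def by measurable
    have h2 [measurable]: "(\<lambda>p. h (snd p) z (fst p)) \<in> borel_measurable (lborel \<Otimes>\<^sub>M sample n)" for z
      unfolding h_def g_def Fn_def by measurable
    have h3' [measurable]: "(\<lambda>p. h (snd (fst p)) (fst (fst p)) (snd p)) \<in> borel_measurable ((lborel \<Otimes>\<^sub>M sample n) \<Otimes>\<^sub>M lborel)"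
      unfolding h_def g_def Fn_def by measurable
    have hh: "(\<lambda>p. \<integral>\<^sup>+z'. h (snd p) (fst p) z' \<partial>lborel) \<in> borel_measurable (lborel \<Otimes>\<^sub>M sample n)"
      using lborel.borel_measurable_nn_integral[of "\<lambda>p z'. h (snd p) (fst p) z'" "lborel \<Otimes>\<^sub>M sample n"] h3'
      by (simp add: split_beta')
    have hX: "(\<lambda>X. \<integral>\<^sup>+z. \<integral>\<^sup>+z'. h X z z' \<partial>lborel \<partial>lborel) \<in> borel_measurable (sample n)"
    proof -
      have "(\<lambda>p. \<integral>\<^sup>+z'. h (fst p) (snd p) z' \<partial>lborel) \<in> borel_measurable (sample n \<Otimes>\<^sub>M lborel)"
        using lborel.borel_measurable_nn_integral[of "\<lambda>p z'. h (fst p) (snd p) z'" "sample n \<Otimes>\<^sub>M lborel"] h3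
        by (simp add: split_beta')
      then show ?thesis
        using lborel.borel_measurable_nn_integral[of "\<lambda>X z. \<integral>\<^sup>+z'. h X z z' \<partial>lborel" "sample n"]
        by (simp add: split_beta')
    qed
    have "(\<integral>\<^sup>+X. 2 * (\<integral>\<^sup>+z. \<integral>\<^sup>+z'. h X z z' \<partial>lborel \<partial>lborel) \<partial>sample n)
      = 2 * (\<integral>\<^sup>+X. (\<integral>\<^sup>+z. \<integral>\<^sup>+z'. h X z z' \<partial>lborel \<partial>lborel) \<partial>sample n)"
      by (rule nn_integral_cmult[OF hX])
    also have "(\<integral>\<^sup>+X. (\<integral>\<^sup>+z. \<integral>\<^sup>+z'. h X z z' \<partial>lborel \<partial>lborel) \<partial>sample n)
      = (\<integral>\<^sup>+z. \<integral>\<^sup>+X. (\<integral>\<^sup>+z'. h X z z' \<partial>lborel) \<partial>sample n \<partial>lborel)"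
      by (rule LS.Fubini') (use hh in \<open>simp add: split_beta'\<close>)
    also have "\<dots> = (\<integral>\<^sup>+z. \<integral>\<^sup>+z'. \<integral>\<^sup>+X. h X z z' \<partial>sample n \<partial>lborel \<partial>lborel)"
      by (intro nn_integral_cong LS.Fubini') (use h2 in \<open>simp add: split_beta'\<close>)
    also have "(\<lambda>z z'. \<integral>\<^sup>+X. h X z z' \<partial>sample n) = (\<lambda>z z'. indicator {z<..} z' * (\<integral>\<^sup>+X. g X z z' \<partial>sample n))"
    proof (intro ext)
      fix z z' show "(\<integral>\<^sup>+X. h X z z' \<partial>sample n) = indicator {z<..} z' * (\<integral>\<^sup>+X. g X z z' \<partial>sample n)"
        by (cases "z < z'") (simp_all add: h_def)
    qed
    finally show ?thesis unfolding gh .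
  qed
  also have "\<dots> \<le> 2 * (\<integral>\<^sup>+z. \<integral>\<^sup>+z'. ennreal (2 * C) * ker z z' \<partial>lborel \<partial>lborel)"
  proof (intro mult_left_mono nn_integral_mono)
    fix z z' :: real
    show "indicator {z<..} z' * (\<integral>\<^sup>+X. g X z z' \<partial>sample n) \<le> ennreal (2 * C) * ker z z'"
    proof (cases "z < z'")
      case True
      define k where "k = min 1 (z' - z) powr (- \<kappa>) * exp (- c * ((z - m)\<^sup>2 + (z' - m)\<^sup>2))"
      have k0: "0 \<le> k" by (simp add: k_def)
      have ce: "- \<theta> * ((z - m)\<^sup>2 + (z' - m)\<^sup>2) / (4 * (K\<^sup>2 + \<sigma>\<^sup>2)) = - c * ((z - m)\<^sup>2 + (z' - m)\<^sup>2)"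
        by (simp add: c_def)
      have "(\<integral>\<^sup>+X. g X z z' \<partial>sample n) = (\<integral>\<^sup>+X. ennreal (F z - Fn n X z') \<partial>sample n) + (\<integral>\<^sup>+X. ennreal (Fn n X z - F z') \<partial>sample n)"
        unfolding g_def by (intro nn_integral_add) measurable
      also have "\<dots> \<le> ennreal (C * k) + ennreal (C * k)"
        using excess_interpolated[OF n True \<theta>] unfolding ce by (intro add_mono) (auto simp: C_def k_def)
      also have "\<dots> = ennreal (2 * C) * ennreal k"
        using C0 k0 by (simp add: ennreal_mult[symmetric] flip: ennreal_plus)
      finally show ?thesis using True by (simp add: k_def ker_def)
    qed (simp add: ker_def)
  qed simp
  also have "\<dots> = 2 * (ennreal (2 * C) * (\<integral>\<^sup>+z. \<integral>\<^sup>+z'. ker z z' \<partial>lborel \<partial>lborel))"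
  proof -
    have [measurable]: "ker z \<in> borel_measurable lborel" for z
      unfolding ker_def by measurable
    have "(\<lambda>(z, z'). ker z z') \<in> borel_measurable (lborel \<Otimes>\<^sub>M lborel)"
      unfolding ker_def by measurable
    from lborel.borel_measurable_nn_integral[OF this]
    have "(\<lambda>z. \<integral>\<^sup>+z'. ker z z' \<partial>lborel) \<in> borel_measurable lborel" .
    then show ?thesis by (simp add: nn_integral_cmult)
  qed
  also have "\<dots> \<le> 2 * (ennreal (2 * C) * ennreal (A * (A + 1 / (1 - \<kappa>))))"
    unfolding A_def ker[symmetric] by (intro mult_left_mono double_integral_bound c0 \<kappa>_bounds) auto
  also have "\<dots> = ennreal (4 * C * (A * (A + 1 / (1 - \<kappa>))))"
    using C0 c0 \<kappa>_bounds by (simp add: ennreal_mult[symmetric] A_def flip: ennreal_numeral)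
  also have "4 * C * (A * (A + 1 / (1 - \<kappa>))) = upper_const \<theta> * real n powr (- (1 + \<kappa>) / 2 * (1 - \<theta>))"
    by (simp add: C_def upper_const_def Let_def A_def c_def)
  finally show ?thesis .
qed

end

section \<open>Transport across an interval of unit length\<close>

text \<open>With \<open>(Y, Z)\<close> distributed according to a coupling of \<open>\<mu>\<close> and \<open>\<nu>\<close>, the right-hand side is at least the
  probability of \<open>Y > a + 1\<close> and \<open>Z \<le> a\<close>, on which \<open>\<bar>Y - Z\<bar> \<ge> 1\<close>; the union bound compares this probability
  with the gap.\<close>

lemma W2_sq_ge_cdf_gap:
  assumes "real_distribution \<mu>" "real_distribution \<nu>"
  shows "ennreal (cdf \<nu> a - cdf \<mu> (a + 1)) \<le> W2_sq \<mu> \<nu>"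
  unfolding W2_sq_def
proof (rule INF_greatest)
  fix \<pi> assume "\<pi> \<in> couplings \<mu> \<nu>"
  then have \<pi>: "prob_space \<pi>" and s [measurable_cong]: "sets \<pi> = sets (borel \<Otimes>\<^sub>M borel)"
    and d: "distr \<pi> borel fst = \<mu>" "distr \<pi> borel snd = \<nu>"
    by (auto simp: couplings_def)
  interpret \<pi>: prob_space \<pi> by fact
  have sp: "space \<pi> = UNIV" using sets_eq_imp_space_eq[OF s] by (simp add: space_pair_measure)
  have [measurable]: "fst \<in> measurable \<pi> borel" "snd \<in> measurable \<pi> borel" by measurable
  have c1: "cdf \<mu> x = \<pi>.prob {p\<in>space \<pi>. fst p \<le> x}" for x
    unfolding cdf_def d(1)[symmetric] by (subst measure_distr) (auto intro!: arg_cong[where f=\<pi>.prob])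
  have c2: "cdf \<nu> x = \<pi>.prob {p\<in>space \<pi>. snd p \<le> x}" for x
    unfolding cdf_def d(2)[symmetric] by (subst measure_distr) (auto intro!: arg_cong[where f=\<pi>.prob])
  define A where "A = {p\<in>space \<pi>. a + 1 < fst p \<and> snd p \<le> a}"
  have [measurable]: "A \<in> sets \<pi>" unfolding A_def by measurable
  have "cdf \<nu> a \<le> \<pi>.prob ({p\<in>space \<pi>. fst p \<le> a + 1} \<union> A)"
    unfolding c2 by (rule \<pi>.finite_measure_mono) (auto simp: A_def)
  also have "\<dots> \<le> cdf \<mu> (a + 1) + \<pi>.prob A"
    unfolding c1 by (rule measure_Un_le) auto
  finally have "ennreal (cdf \<nu> a - cdf \<mu> (a + 1)) \<le> ennreal (\<pi>.prob A)" by (intro ennreal_leI) simp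
  also have "\<dots> = (\<integral>\<^sup>+p. indicator A p \<partial>\<pi>)" by (simp add: \<pi>.emeasure_eq_measure)
  also have "\<dots> \<le> (\<integral>\<^sup>+p. ennreal (\<bar>fst p - snd p\<bar>\<^sup>2) \<partial>\<pi>)"
  proof (rule nn_integral_mono)
    fix p show "indicator A p \<le> ennreal (\<bar>fst p - snd p\<bar>\<^sup>2)"
    proof (cases "p \<in> A")
      case True
      then have "1 \<le> \<bar>fst p - snd p\<bar>\<^sup>2" by (auto simp: A_def intro!: one_le_power)
      then have "ennreal 1 \<le> ennreal (\<bar>fst p - snd p\<bar>\<^sup>2)" by (rule ennreal_leI)
      then show ?thesis using True by simp
    qed simp
  qed
  finally show "ennreal (cdf \<nu> a - cdf \<mu> (a + 1)) \<le> (\<integral>\<^sup>+p. ennreal (\<bar>fst p - snd p\<bar>\<^sup>2) \<partial>\<pi>)" .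
qed

lemma sqrt_le_W2:
  assumes "ennreal t \<le> W2_sq \<mu> \<nu>" "0 \<le> t"
  shows "ennreal (sqrt t) \<le> W2 \<mu> \<nu>"
proof (cases "W2_sq \<mu> \<nu> = \<top>")
  case False
  then have "t \<le> enn2real (W2_sq \<mu> \<nu>)"
    using enn2real_mono[OF assms(1)] assms(2) by (simp add: less_top)
  then show ?thesis using False by (simp add: W2_def ennreal_leI)
qed (simp add: W2_def)

section \<open>Upward deviations of binomial counts\<close>

text \<open>The Paley-Zygmund inequality. Instead of Cauchy-Schwarz, the proof integrates the pointwise bound
  \<open>Z \<le> c Z\<^sup>2 / 2 + 1 / (2 c)\<close> on the event in question and then inserts the best \<open>c\<close>.\<close>

lemma (in prob_space) Paley_Zygmund_half:
  fixes Z :: "'a \<Rightarrow> real"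
  assumes [measurable]: "Z \<in> borel_measurable M" and i1: "integrable M Z" and i2: "integrable M (\<lambda>x. (Z x)\<^sup>2)"
    and pos: "0 < expectation Z"
  shows "(expectation Z)\<^sup>2 / (4 * expectation (\<lambda>x. (Z x)\<^sup>2)) \<le> prob {x\<in>space M. expectation Z / 2 \<le> Z x}"
proof -
  define A where "A = expectation Z"
  define B where "B = expectation (\<lambda>x. (Z x)\<^sup>2)"
  have A0: "0 < A" using pos by (simp add: A_def)
  have "A\<^sup>2 \<le> B" using variance_positive[of Z] i1 i2 unfolding A_def B_def by (simp add: variance_eq)
  then have B0: "0 < B" using A0 by (meson less_le_trans zero_less_power)
  define c where "c = A / (2 * B)"
  have c0: "0 < c" using A0 B0 by (simp add: c_def)
  let ?S = "{x\<in>space M. A / 2 \<le> Z x}"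
  have "A \<le> expectation (\<lambda>x. A / 2 + c / 2 * (Z x)\<^sup>2 + 1 / (2 * c) * indicator ?S x)"
    unfolding A_def[symmetric]
  proof -
    have "Z x \<le> A / 2 + c / 2 * (Z x)\<^sup>2 + 1 / (2 * c) * indicator ?S x" if "x \<in> space M" for x
    proof (cases "A / 2 \<le> Z x")
      case True
      have "0 \<le> (c * Z x - 1)\<^sup>2 / (2 * c)" using c0 by simp
      also have "\<dots> = c / 2 * (Z x)\<^sup>2 + 1 / (2 * c) - Z x"
        using c0 by (simp add: power2_eq_square field_simps)
      finally show ?thesis using True that A0 by simp
    next
      case False
      have "0 \<le> c / 2 * (Z x)\<^sup>2" using c0 by simp
      then show ?thesis using False by simp
    qed
    then have "expectation Z \<le> expectation (\<lambda>x. A / 2 + c / 2 * (Z x)\<^sup>2 + 1 / (2 * c) * indicator ?S x)"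
      using i1 i2 by (intro integral_mono) (auto intro!: Bochner_Integration.integrable_add integrable_real_mult_indicator simp: integrable_real_indicator emeasure_eq_measure)
    then show "A \<le> expectation (\<lambda>x. A / 2 + c / 2 * (Z x)\<^sup>2 + 1 / (2 * c) * indicator ?S x)"
      by (simp add: A_def)
  qed
  also have "\<dots> = A / 2 + c / 2 * B + 1 / (2 * c) * prob ?S"
  proof -
    have "integrable M (\<lambda>x. 1 / (2 * c) * indicator ?S x :: real)"
      by (intro integrable_mult_right) (simp add: integrable_real_indicator emeasure_eq_measure)
    moreover have "integrable M (\<lambda>x. c / 2 * (Z x)\<^sup>2)" using i2 by simp
    ultimately show ?thesis using prob_space by (simp add: B_def)
  qed
  also have "c / 2 * B = A / 4" using B0 by (simp add: c_def)
  also have "1 / (2 * c) * prob ?S = B / A * prob ?S" using A0 B0 by (simp add: c_def)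
  finally have "A / 4 \<le> B / A * prob ?S" by linarith
  then have "A\<^sup>2 / (4 * B) \<le> prob ?S" using A0 B0 by (simp add: field_simps power2_eq_square)
  then show ?thesis by (simp add: A_def B_def)
qed

lemma expectation_exp_count:
  assumes "real_distribution P" and [measurable]: "A \<in> sets borel"
  shows "integrable (PiM {1..n::nat} (\<lambda>_. P)) (\<lambda>X. exp (l * (\<Sum>i\<in>{1..n}. indicator A (X i))))"
    and "(\<integral>X. exp (l * (\<Sum>i\<in>{1..n}. indicator A (X i))) \<partial>PiM {1..n} (\<lambda>_. P)) = (1 + measure P A * (exp l - 1)) ^ n"
proof -
  let ?Q = "PiM {1..n} (\<lambda>_. P)"
  interpret P: real_distribution P by fact
  interpret PP: product_prob_space "\<lambda>_::nat. P" "{1..n}" ..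
  have [measurable_cong]: "sets P = sets borel" by simp
  have "A \<in> sets P" by simp
  have eq1: "exp (l * indicator A x) = 1 + indicator A x * (exp l - 1)" for x :: real
    by (simp split: split_indicator)
  have iA: "integrable P (\<lambda>x. indicator A x :: real)"
    by (rule P.integrable_const_bound[where B=1]) auto
  then have int: "integrable P (\<lambda>x. exp (l * indicator A x))" unfolding eq1 by simp
  have val: "(\<integral>x. exp (l * indicator A x) \<partial>P) = 1 + measure P A * (exp l - 1)"
    unfolding eq1 using iA P.prob_space \<open>A \<in> sets P\<close> by simp
  have prod: "exp (l * (\<Sum>i\<in>{1..n}. indicator A (X i))) = (\<Prod>i\<in>{1..n}. exp (l * indicator A (X i)))" for X
    by (simp only: sum_distrib_left exp_sum[OF finite_atLeastAtMost])
  show "integrable ?Q (\<lambda>X. exp (l * (\<Sum>i\<in>{1..n}. indicator A (X i))))"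
    unfolding prod by (rule PP.product_integrable_prod) (use int in auto)
  have "(\<integral>X. (\<Prod>i\<in>{1..n}. exp (l * indicator A (X i))) \<partial>?Q) = (\<Prod>i\<in>{1..n}. \<integral>x. exp (l * indicator A x) \<partial>P)"
    by (rule PP.product_integral_prod) (use int in auto)
  then show "(\<integral>X. exp (l * (\<Sum>i\<in>{1..n}. indicator A (X i))) \<partial>?Q) = (1 + measure P A * (exp l - 1)) ^ n"
    unfolding prod val by simp
qed

text \<open>The Paley-Zygmund inequality is applied to \<open>exp (l N)\<close>, because the exponential moments of the count \<open>N\<close> are
  explicit. With \<open>l = 3 / sqrt (n p)\<close>, the second-order term \<open>n p l\<^sup>2 / 2 = 9 / 2\<close> of the logarithm of the mean is
  large enough to absorb the loss \<open>ln 2\<close> and the error from \<open>p \<le> 1 / 16\<close>, so that the event forces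
  \<open>l N \<ge> l n p + 1\<close>.\<close>

lemma count_upward_deviation:
  assumes P: "real_distribution P" and A [measurable]: "A \<in> sets borel"
    and p: "p = measure P A" and np: "9 \<le> real n * p" and p16: "p \<le> 1 / 16"
  shows "exp (- 72) / 4 \<le> measure (PiM {1..n} (\<lambda>_. P))
     {X\<in>space (PiM {1..n} (\<lambda>_. P)). real n * p + sqrt (real n * p) / 3 \<le> (\<Sum>i\<in>{1..n}. indicator A (X i))}"
proof -
  let ?Q = "PiM {1..n} (\<lambda>_. P)"
  interpret P: real_distribution P by fact
  interpret S: prob_space "PiM {1..n} (\<lambda>_. P)"
    by (rule prob_space_PiM) (rule P.prob_space_axioms)
  have [measurable_cong]: "sets P = sets borel" by simp
  define N where "N X = (\<Sum>i\<in>{1..n}. indicator A (X i) :: real)" for X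
  have Nm [measurable]: "N \<in> borel_measurable ?Q" unfolding N_def by measurable
  have "p \<noteq> 0" using np by auto
  then have p0: "0 < p" unfolding p by (metis measure_nonneg order_le_less)
  have n0: "0 < real n" using np p0 by (cases n) auto
  define l where "l = 3 / sqrt (real n * p)"
  have "3 \<le> sqrt (real n * p)" using np real_le_rsqrt[of 3 "real n * p"] by simp
  moreover have "0 < 3 / s \<and> 3 / s \<le> 1" if "3 \<le> s" for s :: real using that by simp
  ultimately have l: "0 < l" "l \<le> 1" unfolding l_def by blast+
  have npl: "real n * p * l\<^sup>2 = 9" unfolding l_def using np p0 n0 by (simp add: power_divide)
  define d where "d = exp l - 1"
  have d_lo: "l + l\<^sup>2 / 2 \<le> d" using exp_lower_Taylor_quadratic[of l] l by (simp add: d_def)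
  have d_hi: "d \<le> 2 * l"
  proof -
    have "exp l \<le> 1 + l + l\<^sup>2" using l by (intro exp_bound) auto
    moreover have "l\<^sup>2 \<le> l" using l by (simp add: power2_eq_square mult_left_le)
    ultimately show ?thesis by (simp add: d_def)
  qed
  have d0: "0 < d" using l by (simp add: d_def)
  have d2: "d\<^sup>2 \<le> 4 * l\<^sup>2" using power_mono[OF d_hi, of 2] d0 by (simp add: power_mult_distrib)
  have e2: "exp (2 * l) - 1 = d\<^sup>2 + 2 * d"
  proof -
    have "exp (2 * l) = (exp l)\<^sup>2" by (simp add: power2_eq_square exp_add[symmetric])
    then show ?thesis by (simp add: d_def power2_eq_square algebra_simps)
  qed
  define Z where "Z X = exp (l * N X)" for X
  have Z2: "(Z X)\<^sup>2 = exp (2 * l * N X)" for X by (simp add: Z_def power2_eq_square exp_add[symmetric])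
  have mg: "integrable ?Q (\<lambda>X. exp (t * N X))"
    "S.expectation (\<lambda>X. exp (t * N X)) = (1 + p * (exp t - 1)) ^ n" for t
    unfolding N_def p by (rule expectation_exp_count[OF P A])+
  define E1 where "E1 = (1 + p * d) ^ n"
  define E2 where "E2 = (1 + p * (d\<^sup>2 + 2 * d)) ^ n"
  have EZ: "S.expectation Z = E1" unfolding Z_def E1_def d_def by (rule mg(2))
  have EZ2: "S.expectation (\<lambda>X. (Z X)\<^sup>2) = E2" unfolding Z2 E2_def e2[symmetric] by (rule mg(2))
  have E10: "0 < E1" "0 < E2" unfolding E1_def E2_def using p0 d0 by (auto intro!: zero_less_power add_pos_nonneg)
  have pd: "0 \<le> p * d" "p * d \<le> 1"
  proof -
    show "0 \<le> p * d" using p0 d0 by simp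
    have "p * d \<le> 1 / 16 * (2 * 1)" using p16 d_hi l p0 d0 by (intro mult_mono) auto
    then show "p * d \<le> 1" by simp
  qed
  have lnE1: "real n * (p * d - (p * d)\<^sup>2) \<le> ln E1"
  proof -
    have "p * d - (p * d)\<^sup>2 \<le> ln (1 + p * d)" using pd by (intro ln_one_plus_pos_lower_bound) auto
    then have "real n * (p * d - (p * d)\<^sup>2) \<le> real n * ln (1 + p * d)" using n0 by simp
    also have "\<dots> = ln E1" unfolding E1_def using pd by (simp add: ln_realpow)
    finally show ?thesis .
  qed
  have lnE2: "ln E2 \<le> real n * (p * (d\<^sup>2 + 2 * d))"
  proof -
    have pp: "0 \<le> p * (d\<^sup>2 + 2 * d)" using p0 d0 by simp
    have "ln E2 = real n * ln (1 + p * (d\<^sup>2 + 2 * d))" unfolding E2_def using pp by (simp add: ln_realpow)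
    also have "\<dots> \<le> real n * (p * (d\<^sup>2 + 2 * d))" using n0 pp by (intro mult_left_mono ln_add_one_self_le_self) auto
    finally show ?thesis .
  qed
  have npd2: "real n * (p * d\<^sup>2) \<le> 36"
  proof -
    have "real n * p * d\<^sup>2 \<le> real n * p * (4 * l\<^sup>2)" using d2 n0 p0 by (intro mult_left_mono) auto
    then show ?thesis using npl by simp
  qed
  have np2d2: "real n * (p * d)\<^sup>2 \<le> 9 / 4"
  proof -
    have "real n * (p * d)\<^sup>2 = p * (real n * (p * d\<^sup>2))" by (simp add: power2_eq_square)
    also have "\<dots> \<le> 1 / 16 * 36" using p16 p0 npd2 n0 by (intro mult_mono) auto
    finally show ?thesis by simp
  qed
  have ratio: "exp (- 72) \<le> E1\<^sup>2 / E2"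
  proof -
    have "2 * ln E1 - ln E2 \<ge> 2 * (real n * (p * d - (p * d)\<^sup>2)) - real n * (p * (d\<^sup>2 + 2 * d))"
      using lnE1 lnE2 by linarith
    also have "2 * (real n * (p * d - (p * d)\<^sup>2)) - real n * (p * (d\<^sup>2 + 2 * d))
       = - 2 * (real n * (p * d)\<^sup>2) - real n * (p * d\<^sup>2)" by (simp add: algebra_simps)
    finally have "- 72 \<le> 2 * ln E1 - ln E2" using npd2 np2d2 by linarith
    also have "\<dots> = ln (E1\<^sup>2 / E2)" using E10 by (simp add: ln_div ln_realpow)
    finally have "exp (- 72) \<le> exp (ln (E1\<^sup>2 / E2))" by simp
    then show ?thesis using E10 by simp
  qed
  have "exp (- 72) / 4 \<le> E1\<^sup>2 / (4 * E2)" using ratio by simp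
  also have "\<dots> \<le> S.prob {X\<in>space ?Q. E1 / 2 \<le> Z X}"
  proof -
    have "Z \<in> borel_measurable ?Q" unfolding Z_def by measurable
    moreover have "integrable ?Q Z" unfolding Z_def by (rule mg(1))
    moreover have "integrable ?Q (\<lambda>X. (Z X)\<^sup>2)" unfolding Z2 by (rule mg(1))
    moreover have "0 < S.expectation Z" unfolding EZ by (rule E10)
    ultimately have "(S.expectation Z)\<^sup>2 / (4 * S.expectation (\<lambda>X. (Z X)\<^sup>2))
       \<le> S.prob {X\<in>space ?Q. S.expectation Z / 2 \<le> Z X}"
      by (rule S.Paley_Zygmund_half)
    then show ?thesis unfolding EZ EZ2 .
  qed
  also have "\<dots> \<le> S.prob {X\<in>space ?Q. real n * p + sqrt (real n * p) / 3 \<le> N X}"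
  proof (rule S.finite_measure_mono)
    show "{X\<in>space ?Q. real n * p + sqrt (real n * p) / 3 \<le> N X} \<in> S.events"
      by measurable
    show "{X\<in>space ?Q. E1 / 2 \<le> Z X} \<subseteq> {X\<in>space ?Q. real n * p + sqrt (real n * p) / 3 \<le> N X}"
    proof safe
      fix X assume "E1 / 2 \<le> Z X"
      then have "ln (E1 / 2) \<le> ln (Z X)" using E10 by simp
      then have a: "ln E1 - ln 2 \<le> l * N X" using E10 by (simp add: ln_div Z_def)
      have b: "real n * p * l + 9 / 2 \<le> real n * (p * d)"
      proof -
        have "real n * p * (l + l\<^sup>2 / 2) \<le> real n * p * d" using d_lo n0 p0 by (intro mult_left_mono) auto
        then show ?thesis using npl by (simp add: algebra_simps)
      qed
      have "ln (2::real) \<le> 1" using ln_le_minus_one[of 2] by simp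
      then have "real n * p * l + 1 \<le> l * N X"
        using a b lnE1 np2d2 unfolding right_diff_distrib by linarith
      then have "(real n * p * l + 1) / l \<le> N X" using l by (simp add: divide_le_eq mult.commute)
      then have "real n * p + 1 / l \<le> N X" using l by (simp add: add_divide_distrib)
      then show "real n * p + sqrt (real n * p) / 3 \<le> N X" by (simp add: l_def)
    qed
  qed
  finally show ?thesis unfolding N_def .
qed

section \<open>A subgaussian law with sparse heavy atoms\<close>

definition spike_prob :: "real \<Rightarrow> real \<Rightarrow> real" where
  "spike_prob K h = exp (- h\<^sup>2 / (2 * K\<^sup>2)) / 12"

text \<open>An index \<open>j\<close> is drawn from a geometric law; the value is \<open>j!\<close> with probability
  \<open>spike_prob K (j!)\<close>, and \<open>0\<close> otherwise. The geometric weights cost a factor \<open>2 ^ (j + 1)\<close> in the masses,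
  negligible against \<open>exp ((j!)\<^sup>2 / (2 K\<^sup>2))\<close>, and turn estimates for a single atom into estimates for the law.\<close>

definition spike_pmf :: "real \<Rightarrow> real pmf" where
  "spike_pmf K = bind_pmf (geometric_pmf (1 / 2)) (\<lambda>j.
      map_pmf (\<lambda>b. if b then fact j else 0) (bernoulli_pmf (spike_prob K (fact j))))"

definition spike_law :: "real \<Rightarrow> real measure" where
  "spike_law K = distr (measure_pmf (spike_pmf K)) borel (\<lambda>x. x)"

lemma spike_prob_bounds: "0 < spike_prob K h" "spike_prob K h \<le> 1 / 12" "spike_prob K h \<le> 1"
proof -
  have "exp (- h\<^sup>2 / (2 * K\<^sup>2)) \<le> 1" by simp
  then show "spike_prob K h \<le> 1 / 12" "spike_prob K h \<le> 1" unfolding spike_prob_def by linarith+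
qed (simp add: spike_prob_def)

lemma real_distribution_spike_law: "real_distribution (spike_law K)"
  unfolding spike_law_def by (intro prob_space.real_distribution_distr measure_pmf.prob_space_axioms) simp

lemma nn_integral_spike_law:
  assumes [measurable]: "f \<in> borel_measurable borel"
  shows "(\<integral>\<^sup>+x. f x \<partial>spike_law K) = (\<integral>\<^sup>+j. ennreal (spike_prob K (fact j)) * f (fact j) +
     ennreal (1 - spike_prob K (fact j)) * f 0 \<partial>measure_pmf (geometric_pmf (1 / 2)))"
proof -
  have "(\<integral>\<^sup>+x. f x \<partial>spike_law K) = (\<integral>\<^sup>+j. \<integral>\<^sup>+b. f (if b then fact j else 0) \<partial>measure_pmf (bernoulli_pmf (spike_prob K (fact j)))
      \<partial>measure_pmf (geometric_pmf (1 / 2)))"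
    unfolding spike_law_def spike_pmf_def by (simp add: nn_integral_distr)
  also have "\<dots> = (\<integral>\<^sup>+j. ennreal (spike_prob K (fact j)) * f (fact j) +
     ennreal (1 - spike_prob K (fact j)) * f 0 \<partial>measure_pmf (geometric_pmf (1 / 2)))"
    using spike_prob_bounds[of K]
    by (intro nn_integral_cong) (simp add: less_imp_le mult.commute)
  finally show ?thesis .
qed

lemma mult_exp_minus_le_one: "(t::real) * exp (- t) \<le> 1"
proof -
  have "t \<le> exp t" using exp_ge_add_one_self[of t] by linarith
  then have "t * exp (- t) \<le> exp t * exp (- t)" by (rule mult_right_mono) simp
  then show ?thesis by (simp add: exp_add[symmetric])
qed

lemma exp_remainder_nonpos:
  assumes "(u::real) \<le> 0" shows "exp u - 1 - u \<le> u\<^sup>2 / 2"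
proof -
  define g where "g t = t\<^sup>2 / 2 - (exp (-t) - 1 + t)" for t :: real
  have "g 0 \<le> g (- u)"
  proof (rule DERIV_nonneg_imp_nondecreasing[of 0])
    fix x :: real assume "0 \<le> x" "x \<le> - u"
    have "(g has_real_derivative (x + exp (- x) - 1)) (at x)"
      unfolding g_def by (auto intro!: derivative_eq_intros)
    moreover have "0 \<le> x + exp (- x) - 1" using exp_ge_add_one_self[of "- x"] by linarith
    ultimately show "\<exists>y. (g has_real_derivative y) (at x) \<and> 0 \<le> y" by blast
  qed (use assms in simp)
  then show ?thesis by (simp add: g_def)
qed

lemma exp_remainder_nonneg:
  assumes "0 \<le> (u::real)" shows "exp u - 1 - u \<le> u\<^sup>2 / 2 * exp u"
proof -
  define g where "g t = t\<^sup>2 / 2 - (1 - exp (-t) - t * exp (-t))" for t :: real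
  have "g 0 \<le> g u"
  proof (rule DERIV_nonneg_imp_nondecreasing[of 0])
    fix x :: real assume "0 \<le> x" "x \<le> u"
    have "(g has_real_derivative (x - x * exp (- x))) (at x)"
      unfolding g_def by (auto intro!: derivative_eq_intros)
    moreover have "x * exp (- x) \<le> x" using \<open>0 \<le> x\<close> by (intro mult_left_le) auto
    ultimately show "\<exists>y. (g has_real_derivative y) (at x) \<and> 0 \<le> y"
      by (intro exI[of _ "x - x * exp (- x)"]) auto
  qed (use assms in simp)
  then have "1 - exp (-u) - u * exp (-u) \<le> u\<^sup>2 / 2" by (simp add: g_def)
  then have "(1 - exp (-u) - u * exp (-u)) * exp u \<le> u\<^sup>2 / 2 * exp u" by (rule mult_right_mono) simp
  moreover have "exp (- u) * exp u = 1" by (simp add: exp_add[symmetric])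
  then have "(1 - exp (-u) - u * exp (-u)) * exp u = exp u - 1 - u"
    by (simp add: left_diff_distrib mult.assoc)
  ultimately show ?thesis by simp
qed

lemma spike_remainder_nonpos:
  assumes "0 < K" "l * h \<le> 0"
  shows "spike_prob K h * (exp (l * h) - 1 - l * h) \<le> K\<^sup>2 * l\<^sup>2 / 2"
proof -
  have "spike_prob K h * (exp (l * h) - 1 - l * h) \<le> spike_prob K h * ((l * h)\<^sup>2 / 2)"
    using spike_prob_bounds(1)[of K h] exp_remainder_nonpos[OF assms(2)] by (intro mult_left_mono) auto
  also have "\<dots> = (h\<^sup>2 / (2 * K\<^sup>2) * exp (- (h\<^sup>2 / (2 * K\<^sup>2)))) * (K\<^sup>2 * l\<^sup>2 / 12)"
    using assms(1) by (simp add: spike_prob_def power_mult_distrib)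
  also have "\<dots> \<le> 1 * (K\<^sup>2 * l\<^sup>2 / 12)" by (intro mult_right_mono mult_exp_minus_le_one) auto
  also have "\<dots> \<le> K\<^sup>2 * l\<^sup>2 / 2" by simp
  finally show ?thesis .
qed

text \<open>With \<open>a = l K\<close> and \<open>b = h / K\<close>, completing the square gives \<open>a b - b\<^sup>2 / 2 \<le> a\<^sup>2 / 2\<close>, which is enough for \<open>a \<ge> 1\<close>.
  For \<open>a < 1\<close> the right-hand side is only of order \<open>a\<^sup>2\<close>, and the quadratic Taylor remainder provides the factor
  \<open>a\<^sup>2\<close>. The factor \<open>1 / 12\<close> in \<open>spike_prob\<close> is chosen for this case.\<close>

lemma spike_remainder_nonneg:
  assumes "0 < K" "0 \<le> l" "0 \<le> h"
  shows "spike_prob K h * (exp (l * h) - 1 - l * h) \<le> exp (K\<^sup>2 * l\<^sup>2 / 2) - 1"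
proof -
  define a where "a = l * K"
  define b where "b = h / K"
  have ab: "l * h = a * b" "K\<^sup>2 * l\<^sup>2 = a\<^sup>2" "spike_prob K h = exp (- b\<^sup>2 / 2) / 12" "0 \<le> a" "0 \<le> b"
    using assms by (auto simp: a_def b_def power_mult_distrib power_divide spike_prob_def)
  have "exp (- b\<^sup>2 / 2) / 12 * (exp (a * b) - 1 - a * b) \<le> exp (a\<^sup>2 / 2) - 1"
  proof (cases "1 \<le> a")
    case True
    have "exp (- b\<^sup>2 / 2) * (exp (a * b) - 1 - a * b) \<le> exp (- b\<^sup>2 / 2) * exp (a * b)"
      using mult_nonneg_nonneg[OF ab(4,5)] by (intro mult_left_mono) auto
    also have "\<dots> = exp (a * b - b\<^sup>2 / 2)" by (simp add: exp_add[symmetric])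
    also have "\<dots> \<le> exp (a\<^sup>2 / 2)"
      using zero_le_power2[of "a - b"] by (simp add: power2_eq_square algebra_simps)
    finally have A: "exp (- b\<^sup>2 / 2) * (exp (a * b) - 1 - a * b) \<le> exp (a\<^sup>2 / 2)" .
    have "1 \<le> a\<^sup>2" using True by (simp add: one_le_power)
    then have "3 / 2 \<le> exp (a\<^sup>2 / 2)" using exp_ge_add_one_self[of "a\<^sup>2 / 2"] by linarith
    then show ?thesis using A by simp
  next
    case False
    have "exp (a * b) - 1 - a * b \<le> (a * b)\<^sup>2 / 2 * exp (a * b)"
      using ab by (intro exp_remainder_nonneg) auto
    also have "\<dots> \<le> (a * b)\<^sup>2 / 2 * exp b" using False ab by (intro mult_left_mono) (auto simp: mult_left_le_one_le)
    finally have "exp (- b\<^sup>2 / 2) / 12 * (exp (a * b) - 1 - a * b) \<le> exp (- b\<^sup>2 / 2) / 12 * ((a * b)\<^sup>2 / 2 * exp b)"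
      by (intro mult_left_mono) auto
    also have "\<dots> = (a\<^sup>2 / 2) * (b\<^sup>2 * exp (b - b\<^sup>2 / 2) / 12)"
    proof -
      have "exp (- b\<^sup>2 / 2) * exp b = exp (b - b\<^sup>2 / 2)" by (simp add: exp_add[symmetric])
      then show ?thesis by (simp add: power_mult_distrib field_simps)
    qed
    also have "\<dots> \<le> (a\<^sup>2 / 2) * 1"
    proof (intro mult_left_mono)
      have "b - b\<^sup>2 / 2 \<le> 1 + (- (b\<^sup>2 / 4))" using zero_le_power2[of "b / 2 - 1"] by (simp add: power2_eq_square algebra_simps)
      then have "exp (b - b\<^sup>2 / 2) \<le> exp (1 + (- (b\<^sup>2 / 4)))" by simp
      also have "\<dots> = exp 1 * exp (- (b\<^sup>2 / 4))" by (rule exp_add)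
      also have "\<dots> \<le> 3 * exp (- (b\<^sup>2 / 4))" using exp_le by (intro mult_right_mono) auto
      finally have "b\<^sup>2 * exp (b - b\<^sup>2 / 2) \<le> b\<^sup>2 * (3 * exp (- (b\<^sup>2 / 4)))" by (intro mult_left_mono) auto
      also have "\<dots> = 12 * ((b\<^sup>2 / 4) * exp (- (b\<^sup>2 / 4)))" by simp
      also have "\<dots> \<le> 12 * 1" by (intro mult_left_mono mult_exp_minus_le_one) auto
      finally show "b\<^sup>2 * exp (b - b\<^sup>2 / 2) / 12 \<le> 1" by simp
    qed simp
    also have "\<dots> \<le> exp (a\<^sup>2 / 2) - 1" using exp_ge_add_one_self[of "a\<^sup>2 / 2"] by linarith
    finally show ?thesis .
  qed
  then show ?thesis unfolding ab(1-3) .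
qed

text \<open>With \<open>R\<close> denoting \<open>exp (l X) - 1 - l X\<close>, the claim is \<open>1 + l \<mu> + E R \<le> exp (l \<mu> + K\<^sup>2 l\<^sup>2 / 2)\<close>. For \<open>l \<le> 0\<close>
  it follows from \<open>E R \<le> K\<^sup>2 l\<^sup>2 / 2\<close> and \<open>1 + t \<le> exp t\<close>; for \<open>l \<ge> 0\<close> the weaker bound
  \<open>E R \<le> exp (K\<^sup>2 l\<^sup>2 / 2) - 1\<close> is enough since \<open>l \<mu> \<ge> 0\<close>.\<close>

lemma subgaussian_spike_law:
  assumes "0 < K"
  shows "subgaussian K (spike_law K)"
proof -
  interpret P: real_distribution "spike_law K" by (rule real_distribution_spike_law)
  define R where "R l x = exp (l * x) - 1 - l * x" for l x :: real
  have R0: "0 \<le> R l x" for l x using exp_ge_add_one_self[of "l * x"] unfolding R_def by linarith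
  have [measurable]: "R l \<in> borel_measurable borel" for l unfolding R_def by measurable
  have nnR: "(\<integral>\<^sup>+x. ennreal (R l x) \<partial>spike_law K) \<le> ennreal c"
    if "\<And>h. 0 \<le> h \<Longrightarrow> spike_prob K h * R l h \<le> c" for l c
  proof -
    have "(\<integral>\<^sup>+x. ennreal (R l x) \<partial>spike_law K)
       \<le> (\<integral>\<^sup>+j. ennreal c \<partial>measure_pmf (geometric_pmf (1 / 2)))"
      unfolding nn_integral_spike_law[of "\<lambda>x. ennreal (R l x)", simplified]
    proof (rule nn_integral_mono)
      fix j :: nat
      show "ennreal (spike_prob K (fact j)) * ennreal (R l (fact j)) + ennreal (1 - spike_prob K (fact j)) * ennreal (R l 0) \<le> ennreal c"
        using that[of "fact j"] R0 spike_prob_bounds(1)[of K "fact j"]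
        by (simp add: ennreal_mult[symmetric] R_def ennreal_leI)
    qed
    then show ?thesis by simp
  qed
  have nnR1: "(\<integral>\<^sup>+x. ennreal (R l x) \<partial>spike_law K) \<le> ennreal (K\<^sup>2 * l\<^sup>2 / 2)" if "l \<le> 0" for l
    using spike_remainder_nonpos[OF assms, of l] that by (intro nnR) (auto simp: R_def mult_nonpos_nonneg)
  have nnR2: "(\<integral>\<^sup>+x. ennreal (R l x) \<partial>spike_law K) \<le> ennreal (exp (K\<^sup>2 * l\<^sup>2 / 2) - 1)" if "0 \<le> l" for l
    using spike_remainder_nonneg[OF assms that] by (intro nnR) (auto simp: R_def)
  have iR: "integrable (spike_law K) (R l)" for l
  proof (rule integrableI_bounded)
    show "(\<integral>\<^sup>+x. ennreal (norm (R l x)) \<partial>spike_law K) < \<infinity>"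
      using nnR1[of l] nnR2[of l] R0 by (cases "l \<le> 0") (auto intro: le_less_trans)
  qed simp
  have ix: "integrable (spike_law K) (\<lambda>x. x)"
  proof (rule Bochner_Integration.integrable_bound)
    show "integrable (spike_law K) (\<lambda>x. 1 + (R 1 x + R (-1) x))"
      using iR by (intro Bochner_Integration.integrable_add) auto
    show "AE x in spike_law K. norm x \<le> norm (1 + (R 1 x + R (-1) x))"
    proof (intro AE_I2)
      fix x :: real
      have "\<bar>x\<bar> \<le> 1 + R 1 \<bar>x\<bar>"
      proof -
        have "0 \<le> (\<bar>x\<bar> - 1)\<^sup>2" by simp
        then have "\<bar>x\<bar> \<le> 1 + \<bar>x\<bar>\<^sup>2 / 2" by (simp add: power2_eq_square algebra_simps)
        also have "\<dots> \<le> 1 + R 1 \<bar>x\<bar>" using exp_lower_Taylor_quadratic[of "\<bar>x\<bar>"] by (simp add: R_def)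
        finally show ?thesis .
      qed
      also have "R 1 \<bar>x\<bar> \<le> R 1 x + R (-1) x" using R0[of 1 x] R0[of "-1" x] by (cases "0 \<le> x") (auto simp: R_def)
      finally show "norm x \<le> norm (1 + (R 1 x + R (-1) x))" using R0[of 1 x] R0[of "-1" x] by simp
    qed
  qed simp
  define \<mu> where "\<mu> = (\<integral>x. x \<partial>spike_law K)"
  have "(0::real) \<le> \<mu>"
  proof -
    have "AE x in spike_law K. 0 \<le> x"
      unfolding spike_law_def spike_pmf_def by (subst AE_distr_iff) (auto simp: AE_measure_pmf_iff)
    then show ?thesis unfolding \<mu>_def by (rule integral_nonneg_AE)
  qed
  have mgf: "(\<integral>\<^sup>+x. ennreal (exp (l * (x - \<mu>))) \<partial>spike_law K) \<le> ennreal (exp (1 / 2 * K\<^sup>2 * l\<^sup>2))" for l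
  proof -
    let ?E = "\<integral>x. R l x \<partial>spike_law K"
    let ?G = "exp (K\<^sup>2 * l\<^sup>2 / 2)"
    have nE: "(\<integral>\<^sup>+x. ennreal (R l x) \<partial>spike_law K) = ennreal ?E"
      by (rule nn_integral_eq_integral) (use iR R0 in auto)
    have eq: "exp (l * (x - \<mu>)) = exp (- (l * \<mu>)) * (R l x + 1 + l * x)" for x
      by (simp add: R_def exp_add[symmetric] algebra_simps)
    have ii: "integrable (spike_law K) (\<lambda>x. exp (- (l * \<mu>)) * (R l x + 1 + l * x))"
      using iR ix by (intro integrable_mult_right Bochner_Integration.integrable_add) auto
    have "(\<integral>\<^sup>+x. ennreal (exp (l * (x - \<mu>))) \<partial>spike_law K) = ennreal (\<integral>x. exp (l * (x - \<mu>)) \<partial>spike_law K)"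
    proof (rule nn_integral_eq_integral)
      show "integrable (spike_law K) (\<lambda>x. exp (l * (x - \<mu>)))" unfolding eq by (rule ii)
    qed simp
    also have "(\<integral>x. exp (l * (x - \<mu>)) \<partial>spike_law K) = exp (- (l * \<mu>)) * (?E + 1 + l * \<mu>)"
      unfolding eq using iR ix P.prob_space by (simp add: \<mu>_def)
    also have "exp (- (l * \<mu>)) * (?E + 1 + l * \<mu>) \<le> ?G"
    proof -
      have "?E + 1 + l * \<mu> \<le> exp (l * \<mu>) * ?G"
      proof (cases "l \<le> 0")
        case True
        have "?E \<le> K\<^sup>2 * l\<^sup>2 / 2" using nnR1[OF True] unfolding nE by (simp add: ennreal_le_iff)
        then have "?E + 1 + l * \<mu> \<le> 1 + (l * \<mu> + K\<^sup>2 * l\<^sup>2 / 2)" by simp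
        also have "\<dots> \<le> exp (l * \<mu> + K\<^sup>2 * l\<^sup>2 / 2)" by (rule exp_ge_add_one_self)
        finally show ?thesis by (simp add: exp_add)
      next
        case False
        then have l0: "0 \<le> l" by simp
        have G1: "1 \<le> ?G" by simp
        have "?E \<le> ?G - 1" using nnR2[OF l0] G1 unfolding nE by (subst (asm) ennreal_le_iff) auto
        then have "?E + 1 + l * \<mu> \<le> ?G + l * \<mu> * 1" by simp
        also have "\<dots> \<le> ?G + l * \<mu> * ?G" using l0 \<open>0 \<le> \<mu>\<close> G1 by (intro add_left_mono mult_left_mono) auto
        also have "\<dots> = (1 + l * \<mu>) * ?G" by (simp add: algebra_simps)
        also have "\<dots> \<le> exp (l * \<mu>) * ?G" by (intro mult_right_mono exp_ge_add_one_self) simp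
        finally show ?thesis .
      qed
      then have "exp (- (l * \<mu>)) * (?E + 1 + l * \<mu>) \<le> exp (- (l * \<mu>)) * (exp (l * \<mu>) * ?G)" by simp
      then show ?thesis by (simp add: mult.assoc[symmetric] exp_add[symmetric])
    qed
    finally show ?thesis by (simp add: ennreal_leI)
  qed
  show ?thesis
    unfolding subgaussian_def using P.real_distribution_axioms ix mgf by (simp add: \<mu>_def)
qed

lemma spike_law_tail:
  fixes K :: real and k :: nat
  defines "p \<equiv> measure (spike_law K) {fact k..}"
  shows "spike_prob K (fact k) / 2 ^ (k + 1) \<le> p" and "p \<le> spike_prob K (fact k)"
proof -
  interpret P: real_distribution "spike_law K" by (rule real_distribution_spike_law)
  let ?q = "\<lambda>j::nat. ennreal (spike_prob K (fact j)) * indicator {fact k..} (fact j :: real)"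
  have e: "ennreal p = (\<integral>\<^sup>+j. ?q j \<partial>measure_pmf (geometric_pmf (1 / 2)))"
  proof -
    have "ennreal p = (\<integral>\<^sup>+x. indicator {fact k..} x \<partial>spike_law K)"
      by (simp add: p_def P.emeasure_eq_measure)
    also have "\<dots> = (\<integral>\<^sup>+j. ?q j \<partial>measure_pmf (geometric_pmf (1 / 2)))"
      by (subst nn_integral_spike_law) (auto simp: not_le)
    finally show ?thesis .
  qed
  have "(\<integral>\<^sup>+j. ?q j \<partial>measure_pmf (geometric_pmf (1 / 2))) \<le> (\<integral>\<^sup>+j. ennreal (spike_prob K (fact k)) \<partial>measure_pmf (geometric_pmf (1 / 2)))"
  proof (rule nn_integral_mono)
    fix j :: nat
    have "spike_prob K (fact j) \<le> spike_prob K (fact k)" if "(fact k :: real) \<le> fact j"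
    proof -
      have "(fact k :: real)\<^sup>2 \<le> (fact j)\<^sup>2" using that by (intro power_mono) auto
      then show ?thesis unfolding spike_prob_def by (simp add: divide_right_mono)
    qed
    then show "?q j \<le> ennreal (spike_prob K (fact k))" by (auto split: split_indicator intro: ennreal_leI)
  qed
  then show "p \<le> spike_prob K (fact k)"
    unfolding e[symmetric] using spike_prob_bounds(1)[of K "fact k"] by (simp add: ennreal_le_iff)
  have "ennreal (spike_prob K (fact k) / 2 ^ (k + 1)) = (\<integral>\<^sup>+j. ennreal (spike_prob K (fact k)) * indicator {k} j \<partial>measure_pmf (geometric_pmf (1 / 2)))"
    using spike_prob_bounds(1)[of K "fact k"]
    by (simp add: nn_integral_cmult emeasure_pmf_single ennreal_mult[symmetric] power_one_over field_simps)
  also have "\<dots> \<le> ennreal p"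
    unfolding e by (intro nn_integral_mono) (auto split: split_indicator)
  finally show "spike_prob K (fact k) / 2 ^ (k + 1) \<le> p"
    by (simp add: p_def)
qed

lemma spike_law_gap: "AE x in spike_law K. x \<le> fact (k - 1) \<or> fact k \<le> x"
proof -
  have "AE x in measure_pmf (spike_pmf K). x \<le> fact (k - 1) \<or> fact k \<le> x"
    unfolding AE_measure_pmf_iff
  proof
    fix x assume "x \<in> set_pmf (spike_pmf K)"
    then obtain j where "x = fact j \<or> x = 0" by (auto simp: spike_pmf_def split: if_splits)
    moreover have "(fact j :: real) \<le> fact (k - 1) \<or> (fact k :: real) \<le> fact j"
      by (cases "k \<le> j") (auto intro!: fact_mono)
    moreover have "(0 :: real) \<le> fact (k - 1)" by (rule fact_ge_zero)
    ultimately show "x \<le> fact (k - 1) \<or> fact k \<le> x" by blast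
  qed
  then show ?thesis
    unfolding spike_law_def by (subst AE_distr_iff) (simp_all del: AE_measure_pmf_iff)
qed

section \<open>Lower bound for the spike law\<close>

text \<open>Here \<open>\<eta>\<close> bounds the fraction of the mass at or beyond \<open>k!\<close> that the noise moves below \<open>b\<close>, and \<open>\<zeta>\<close> the
  mass that it moves above \<open>b - 1\<close> from the atoms up to \<open>(k - 1)!\<close>. As long as these leaks are small
  against the typical surplus \<open>s = sqrt (p / n)\<close> of the empirical measure, this surplus has to cross the window
  from \<open>b - 1\<close> to \<open>b\<close>.\<close>

lemma spike_W2_lower:
  fixes K \<sigma> b :: real and k n :: nat
  defines "P \<equiv> spike_law K" and "p \<equiv> measure (spike_law K) {fact k..}"
  defines "s \<equiv> sqrt (p / real n)"
  assumes \<sigma>: "0 < \<sigma>" and b: "fact (k - 1) < b - 1" "b < fact k"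
    and np: "9 \<le> real n * p" and p16: "p \<le> 1 / 16"
    and \<eta>: "\<eta> = exp (- (fact k - b)\<^sup>2 / (2 * \<sigma>\<^sup>2))" "\<eta> \<le> 1 / 2" "\<eta> * p \<le> s / 24"
    and \<zeta>: "\<zeta> = exp (- (b - 1 - fact (k - 1))\<^sup>2 / (2 * \<sigma>\<^sup>2))" "\<zeta> \<le> s / 24"
  shows "ennreal (exp (- 72) / 4 * sqrt (s / 12))
    \<le> iid_expectation n P (\<lambda>X. W2 (empirical n X \<star> gaussian \<sigma>) (P \<star> gaussian \<sigma>))"
proof -
  let ?Q = "PiM {1..n} (\<lambda>_. P)"
  interpret P: real_distribution P unfolding P_def by (rule real_distribution_spike_law)
  interpret G: real_distribution "gaussian \<sigma>" by (rule real_distribution_gaussian[OF \<sigma>])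
  note [measurable] = cdf_gaussian_measurable[OF \<sigma>]
  interpret S: prob_space "PiM {1..n} (\<lambda>_. P)"
    by (rule prob_space_PiM) (rule P.prob_space_axioms)
  have [measurable_cong]: "sets P = sets borel" by simp
  have n1: "n \<ge> 1" using np by (cases n) auto
  have n0: "0 < real n" using n1 by simp
  have p0: "0 < p" using np n0 by (metis less_le_trans zero_less_numeral zero_less_mult_pos)
  have s0: "0 < s" using p0 n0 by (simp add: s_def)
  define A where "A = {fact k :: real..}"
  have [measurable]: "A \<in> sets borel" by (simp add: A_def)
  define N where "N X = (\<Sum>i\<in>{1..n}. indicator A (X i) :: real)" for X
  have \<eta>0: "0 < \<eta>" by (simp add: \<eta>(1))
  have pop: "1 - cdf (P \<star> gaussian \<sigma>) (b - 1) \<le> p + \<zeta>"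
  proof -
    have iG: "integrable P (\<lambda>x. cdf (gaussian \<sigma>) (b - 1 - x))"
      by (rule P.integrable_const_bound[where B=1]) (auto simp: G.cdf_nonneg G.cdf_bounded_prob)
    have "1 - cdf (P \<star> gaussian \<sigma>) (b - 1) = (\<integral>x. 1 - cdf (gaussian \<sigma>) (b - 1 - x) \<partial>P)"
      using iG P.prob_space by (simp add: cdf_convolution_gaussian[OF \<sigma> P.real_distribution_axioms])
    also have "\<dots> \<le> (\<integral>x. indicator A x + \<zeta> \<partial>P)"
    proof (rule integral_mono_AE)
      show "integrable P (\<lambda>x. 1 - cdf (gaussian \<sigma>) (b - 1 - x))" using iG by simp
      show "integrable P (\<lambda>x. indicator A x + \<zeta>)"
        by (rule P.integrable_const_bound[where B="1 + \<zeta>"]) (auto simp: \<zeta>(1) split: split_indicator)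
      show "AE x in P. 1 - cdf (gaussian \<sigma>) (b - 1 - x) \<le> indicator A x + \<zeta>"
        using spike_law_gap[where K=K and k=k] unfolding P_def[symmetric]
      proof eventually_elim
        case (elim x)
        show ?case
        proof (cases "fact k \<le> x")
          case True
          then show ?thesis using G.cdf_nonneg[of "b - 1 - x"] by (simp add: A_def \<zeta>(1) add_increasing2)
        next
          case False
          then have "x \<le> fact (k - 1)" using elim by simp
          then have "1 - cdf (gaussian \<sigma>) (b - 1 - x) \<le> 1 - cdf (gaussian \<sigma>) (b - 1 - fact (k - 1))"
            by (intro diff_left_mono G.cdf_nondecreasing) auto
          also have "\<dots> \<le> \<zeta>" unfolding \<zeta>(1) using b by (intro gaussian_tail[OF \<sigma>]) auto
          finally show ?thesis using False by (simp add: A_def)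
        qed
      qed
    qed
    also have "\<dots> = p + \<zeta>"
    proof -
      have "integrable P (\<lambda>x. indicator A x :: real)"
        by (rule P.integrable_const_bound[where B=1]) auto
      moreover have "(\<integral>x. indicator A x \<partial>P) = p" by (simp add: p_def A_def flip: P_def)
      ultimately show ?thesis using P.prob_space by simp
    qed
    finally show ?thesis .
  qed
  have samp: "N X / real n * (1 - \<eta>) \<le> 1 - cdf (empirical n X \<star> gaussian \<sigma>) b" for X
  proof -
    have "cdf (empirical n X \<star> gaussian \<sigma>) b = (\<Sum>i\<in>{1..n}. cdf (gaussian \<sigma>) (b - X i)) / real n"
      using \<sigma> n1 by (simp only: cdf_convolution_gaussian real_distribution_empirical)
        (rule integral_empirical, simp_all)
    then have "1 - cdf (empirical n X \<star> gaussian \<sigma>) b = (\<Sum>i\<in>{1..n}. 1 - cdf (gaussian \<sigma>) (b - X i)) / real n"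
      using n0 by (simp add: sum_subtractf diff_divide_distrib)
    moreover have "(\<Sum>i\<in>{1..n}. indicator A (X i) * (1 - \<eta>)) \<le> (\<Sum>i\<in>{1..n}. 1 - cdf (gaussian \<sigma>) (b - X i))"
    proof (rule sum_mono)
      fix i
      have "cdf (gaussian \<sigma>) (b - X i) \<le> \<eta>" if "fact k \<le> X i"
      proof -
        have "cdf (gaussian \<sigma>) (b - X i) \<le> cdf (gaussian \<sigma>) (- (fact k - b))"
          using that by (intro G.cdf_nondecreasing) auto
        also have "\<dots> = 1 - cdf (gaussian \<sigma>) (fact k - b)" by (rule gaussian_cdf_minus[OF \<sigma>])
        also have "\<dots> \<le> \<eta>" unfolding \<eta>(1) using b by (intro gaussian_tail[OF \<sigma>]) auto
        finally show ?thesis .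
      qed
      then show "indicator A (X i) * (1 - \<eta>) \<le> 1 - cdf (gaussian \<sigma>) (b - X i)"
        using G.cdf_bounded_prob[of "b - X i"] by (simp add: A_def split: split_indicator)
    qed
    ultimately show ?thesis
      using n0 by (simp add: N_def sum_distrib_right[symmetric] divide_right_mono)
  qed
  define Ev where "Ev = {X\<in>space ?Q. real n * p + sqrt (real n * p) / 3 \<le> N X}"
  have Ev_m: "Ev \<in> S.events" unfolding Ev_def N_def by measurable
  have Ev_p: "exp (- 72) / 4 \<le> S.prob Ev"
    unfolding Ev_def N_def
    by (rule count_upward_deviation[OF P.real_distribution_axioms _ _ np p16]) (auto simp: p_def P_def A_def)
  have W: "ennreal (sqrt (s / 12)) \<le> W2 (empirical n X \<star> gaussian \<sigma>) (P \<star> gaussian \<sigma>)" if "X \<in> Ev" for X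
  proof (rule sqrt_le_W2)
    have "p + s / 3 \<le> N X / real n"
    proof -
      have "sqrt (real n * p) / real n = s"
      proof -
        have "real n * p = (real n)\<^sup>2 * (p / real n)" using n0 by (simp add: power2_eq_square)
        then have "sqrt (real n * p) = sqrt ((real n)\<^sup>2) * s" unfolding s_def by (simp only: real_sqrt_mult)
        then show ?thesis using n0 by simp
      qed
      moreover have "(real n * p + sqrt (real n * p) / 3) / real n \<le> N X / real n"
        using that n0 by (intro divide_right_mono) (auto simp: Ev_def)
      ultimately show ?thesis using n0 by (simp add: add_divide_distrib)
    qed
    then have "(p + s / 3) * (1 - \<eta>) \<le> N X / real n * (1 - \<eta>)"
      using \<eta>(2) by (intro mult_right_mono) auto
    also have "\<dots> \<le> 1 - cdf (empirical n X \<star> gaussian \<sigma>) b" by (rule samp)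
    finally have 1: "(p + s / 3) * (1 - \<eta>) \<le> 1 - cdf (empirical n X \<star> gaussian \<sigma>) b" .
    have "s / 3 * (1 / 2) \<le> s / 3 * (1 - \<eta>)" using \<eta>(2) s0 by (intro mult_left_mono) auto
    then have "p - s / 24 + s / 6 \<le> (p + s / 3) * (1 - \<eta>)"
      using \<eta>(3) by (simp add: algebra_simps)
    then have "s / 12 \<le> cdf (P \<star> gaussian \<sigma>) (b - 1) - cdf (empirical n X \<star> gaussian \<sigma>) (b - 1 + 1)"
      using 1 pop \<zeta>(2) by simp
    then have "ennreal (s / 12) \<le> ennreal (cdf (P \<star> gaussian \<sigma>) (b - 1) - cdf (empirical n X \<star> gaussian \<sigma>) (b - 1 + 1))"
      by (rule ennreal_leI)
    also have "\<dots> \<le> W2_sq (empirical n X \<star> gaussian \<sigma>) (P \<star> gaussian \<sigma>)"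
      by (intro W2_sq_ge_cdf_gap real_distribution_convolution real_distribution_empirical n1
          P.real_distribution_axioms G.real_distribution_axioms)
    finally show "ennreal (s / 12) \<le> W2_sq (empirical n X \<star> gaussian \<sigma>) (P \<star> gaussian \<sigma>)" .
  qed (use s0 in simp)
  have "ennreal (exp (- 72) / 4 * sqrt (s / 12)) \<le> ennreal (sqrt (s / 12)) * ennreal (S.prob Ev)"
    using s0 Ev_p by (simp add: ennreal_mult[symmetric] ennreal_leI mult.commute mult_right_mono)
  also have "\<dots> = (\<integral>\<^sup>+X. ennreal (sqrt (s / 12)) * indicator Ev X \<partial>?Q)"
    by (simp only: nn_integral_cmult_indicator[OF Ev_m] S.emeasure_eq_measure)
  also have "\<dots> \<le> (\<integral>\<^sup>+X. W2 (empirical n X \<star> gaussian \<sigma>) (P \<star> gaussian \<sigma>) \<partial>?Q)"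
    by (intro nn_integral_mono) (auto split: split_indicator intro: W)
  finally show ?thesis unfolding iid_expectation_def .
qed

text \<open>All conditions on the scale \<open>k\<close> will be of this form, with \<open>L k = (k!)\<^sup>2\<close> and \<open>x k\<close> an exponent per unit
  of \<open>L\<close>.\<close>

lemma eventually_scaled_le:
  fixes L x :: "nat \<Rightarrow> real"
  assumes "filterlim L at_top sequentially" "x \<longlonglongrightarrow> y" "y < 0"
  shows "\<forall>\<^sub>F k in sequentially. L k * x k \<le> c"
proof -
  have "filterlim (\<lambda>k. x k * L k) at_bot sequentially"
    by (rule filterlim_tendsto_neg_mult_at_bot[OF assms(2,3,1)])
  then show ?thesis by (simp add: filterlim_at_bot mult.commute)
qed

text \<open>Here \<open>x = K\<^sup>2\<close>, \<open>y = \<sigma>\<^sup>2\<close>, the window is at \<open>\<rho> h\<close>, and \<open>n\<close> is about \<open>exp (\<beta> h\<^sup>2)\<close>. The two identities with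
  squares say that both leaks \<open>\<eta> p\<close> and \<open>\<zeta>\<close> then have the exponent of \<open>sqrt (p / n)\<close>, and the last one that
  \<open>sqrt (p / n)\<close> has the exponent of \<open>n powr (- 2 \<alpha>)\<close>.\<close>

lemma critical_exponents:
  fixes x y :: real
  assumes "0 < y" "y < x"
  defines "\<beta> \<equiv> (x\<^sup>2 + y\<^sup>2) / (4 * y * x\<^sup>2)" and "\<rho> \<equiv> (x + y) / (2 * x)" and "\<alpha> \<equiv> (y + x)\<^sup>2 / (4 * (y\<^sup>2 + x\<^sup>2))"
  shows "0 < \<beta>" "0 < \<rho>" "\<rho> < 1" "1 / 4 < \<alpha>" "(1 - \<rho>)\<^sup>2 / y = \<beta> - 1 / (2 * x)" "\<rho>\<^sup>2 / y = \<beta> + 1 / (2 * x)"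
    "(\<alpha> - 1 / 4) * \<beta> = 1 / (8 * x)"
proof -
  have x0: "0 < x" using assms by simp
  have pos: "0 < x\<^sup>2 + y\<^sup>2" using x0 by (simp add: add_pos_nonneg)
  show "0 < \<beta>" unfolding \<beta>_def using x0 assms(1) pos by simp
  show "0 < \<rho>" "\<rho> < 1" unfolding \<rho>_def using x0 assms by auto
  have a: "\<alpha> - 1 / 4 = 2 * x * y / (4 * (x\<^sup>2 + y\<^sup>2))"
  proof -
    have "(y + x)\<^sup>2 = (x\<^sup>2 + y\<^sup>2) + 2 * x * y" by (simp add: power2_eq_square algebra_simps)
    moreover have "(S + t) / (4 * S) - 1 / 4 = t / (4 * S)" if "S \<noteq> 0" for S t :: real
      using that by (simp add: field_simps)
    moreover have "x\<^sup>2 + y\<^sup>2 \<noteq> 0" using pos by linarith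
    ultimately show ?thesis unfolding \<alpha>_def by (simp only: add.commute[of "y\<^sup>2"])
  qed
  have "0 < \<alpha> - 1 / 4" unfolding a using x0 assms pos by simp
  then show "1 / 4 < \<alpha>" by simp
  show "(1 - \<rho>)\<^sup>2 / y = \<beta> - 1 / (2 * x)" unfolding \<rho>_def \<beta>_def using x0 assms(1)
    by (simp add: field_simps power2_eq_square)
  show "\<rho>\<^sup>2 / y = \<beta> + 1 / (2 * x)" unfolding \<rho>_def \<beta>_def using x0 assms(1)
    by (simp add: field_simps power2_eq_square)
  have S: "2 * x * y / (4 * S) * (S / (4 * y * x\<^sup>2)) = 1 / (8 * x)" if "S \<noteq> 0" for S
    using that x0 assms(1) by (simp add: power2_eq_square)
  show "(\<alpha> - 1 / 4) * \<beta> = 1 / (8 * x)" unfolding a \<beta>_def by (rule S) (use pos in linarith)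
qed

text \<open>At the critical \<open>n\<close> the conditions of \<open>spike_W2_lower\<close> on the leaks hold with equality in the exponent. Lowering
  the exponent of \<open>n\<close> from \<open>\<beta>\<close> to \<open>\<beta> - \<tau>\<close> makes them strict, so that they absorb constants, the factor \<open>2 ^ (k + 1)\<close>,
  and the offsets \<open>1\<close> and \<open>(k - 1)!\<close> in the window; the gap \<open>\<epsilon>\<close> in the rate determines how small \<open>\<tau>\<close> must be.\<close>

lemma spike_rate:
  fixes K \<sigma> \<alpha> \<epsilon> :: real and n0 :: nat
  assumes \<sigma>: "0 < \<sigma>" "\<sigma> < K" and \<alpha>: "\<alpha> = (\<sigma>\<^sup>2 + K\<^sup>2)\<^sup>2 / (4 * (\<sigma> ^ 4 + K ^ 4))" and \<epsilon>: "0 < \<epsilon>"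
  shows "\<exists>n\<ge>n0. ennreal (real n powr (- \<alpha> - \<epsilon>)) \<le>
     iid_expectation n (spike_law K) (\<lambda>X. W2 (empirical n X \<star> gaussian \<sigma>) (spike_law K \<star> gaussian \<sigma>))"
proof -
  define x where "x = K\<^sup>2"
  define y where "y = \<sigma>\<^sup>2"
  have xy: "0 < y" "y < x" unfolding x_def y_def using \<sigma> by (auto intro!: power_strict_mono)
  have x0: "0 < x" using xy by simp
  define \<beta> where "\<beta> = (x\<^sup>2 + y\<^sup>2) / (4 * y * x\<^sup>2)"
  define \<rho> where "\<rho> = (x + y) / (2 * x)"
  have \<alpha>': "\<alpha> = (y + x)\<^sup>2 / (4 * (y\<^sup>2 + x\<^sup>2))" by (simp add: \<alpha> x_def y_def)
  note ce = critical_exponents[OF xy, folded \<beta>_def \<rho>_def \<alpha>']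
  define d where "d = (1 - \<rho>)\<^sup>2 / y"
  have d0: "0 < d" unfolding d_def using ce(3) xy by simp
  define e where "e = \<alpha> - 1 / 4 + \<epsilon>"
  have e0: "0 < e" using ce(4) \<epsilon> by (simp add: e_def)
  define \<tau> where "\<tau> = min (d / 2) (\<epsilon> * \<beta> / (2 * e))"
  have \<tau>0: "0 < \<tau>" unfolding \<tau>_def using d0 e0 \<epsilon> ce(1) by simp
  have \<tau>d: "\<tau> < d" unfolding \<tau>_def using d0 by linarith
  have "d < \<beta>" unfolding d_def ce(5) using x0 by simp
  then have \<tau>\<beta>: "0 < \<beta> - \<tau>" using \<tau>d by simp
  have gain: "1 / (8 * x) < e * (\<beta> - \<tau>)"
  proof -
    have "e * \<tau> \<le> e * (\<epsilon> * \<beta> / (2 * e))" using e0 by (intro mult_left_mono) (auto simp: \<tau>_def)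
    also have "\<dots> = \<epsilon> * \<beta> / 2" using e0 by simp
    finally have "e * \<tau> \<le> \<epsilon> * \<beta> / 2" .
    moreover have "e * \<beta> = 1 / (8 * x) + \<epsilon> * \<beta>" unfolding ce(7)[symmetric] e_def by (simp add: algebra_simps)
    moreover have "0 < \<epsilon> * \<beta>" using \<epsilon> ce(1) by simp
    ultimately show ?thesis by (simp add: right_diff_distrib)
  qed
  define h :: "nat \<Rightarrow> real" where "h k = fact k" for k
  define L where "L k = (h k)\<^sup>2" for k
  define c where "c k = (real k + 1) * ln 2 / L k" for k
  \<comment> \<open>\<open>h k * r k\<close> is the distance from \<open>(k - 1)!\<close> to the left end \<open>b - 1\<close> of the window\<close>
  define r where "r k = \<rho> - 1 / h k - 1 / real k" for k
  have hk: "real k \<le> h k" for k unfolding h_def using fact_ge_self[of k] by (metis of_nat_fact of_nat_le_iff)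
  have h1: "1 \<le> h k" for k unfolding h_def by (rule fact_ge_1)
  have L1: "1 \<le> L k" for k unfolding L_def using h1 by (simp add: one_le_power)
  have Lk: "(real k)\<^sup>2 \<le> L k" for k unfolding L_def using hk by (intro power_mono) auto
  have hlim: "filterlim h at_top sequentially"
    by (rule filterlim_at_top_mono[OF filterlim_real_sequentially]) (use hk in auto)
  have Llim: "filterlim L at_top sequentially"
  proof (rule filterlim_at_top_mono[OF hlim])
    have "h k \<le> L k" for k using mult_mono[OF order.refl h1, of "h k" k] h1[of k] by (simp add: L_def power2_eq_square)
    then show "\<forall>\<^sub>F k in sequentially. h k \<le> L k" by simp
  qed
  have rlim: "r \<longlonglongrightarrow> \<rho>"
  proof -
    have "(\<lambda>k. \<rho> - 1 / h k - 1 / real k) \<longlonglongrightarrow> \<rho> - 0 - 0"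
      by (intro tendsto_diff tendsto_const tendsto_divide_0[OF tendsto_const] filterlim_at_top_imp_at_infinity hlim filterlim_real_sequentially)
    then show ?thesis unfolding r_def by simp
  qed
  have clim: "c \<longlonglongrightarrow> 0"
  proof (rule tendsto_sandwich)
    show "\<forall>\<^sub>F k in sequentially. 0 \<le> c k"
    proof (intro always_eventually allI)
      fix k show "0 \<le> c k" unfolding c_def using L1[of k] by (intro divide_nonneg_nonneg mult_nonneg_nonneg) auto
    qed
    show "\<forall>\<^sub>F k in sequentially. c k \<le> 2 * ln 2 / real k"
      using eventually_gt_at_top[of 0]
    proof eventually_elim
      case (elim k)
      then have k: "1 \<le> real k" by simp
      have "c k \<le> (real k + 1) * ln 2 / (real k)\<^sup>2"
        unfolding c_def using Lk[of k] k by (intro divide_left_mono) (auto intro!: mult_pos_pos less_le_trans[OF zero_less_one L1])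
      also have "\<dots> \<le> (2 * real k) * ln 2 / (real k)\<^sup>2"
        using k by (intro divide_right_mono mult_right_mono) auto
      also have "\<dots> = 2 * ln 2 / real k" using k by (simp add: power2_eq_square)
      finally show ?case .
    qed
    show "(\<lambda>k. 2 * ln 2 / real k) \<longlonglongrightarrow> 0"
      by (intro tendsto_divide_0[OF tendsto_const] filterlim_at_top_imp_at_infinity filterlim_real_sequentially)
  qed simp
  note ev = eventually_scaled_le[OF Llim]
  have E1: "\<forall>\<^sub>F k in sequentially. L k * (- (d - \<tau>) + c k) \<le> - (ln 9 + ln 12)"
    by (rule ev[of _ "- (d - \<tau>) + 0"]) (intro tendsto_intros clim, use \<tau>d in simp)
  have E2: "\<forall>\<^sub>F k in sequentially. L k * (- (1 / (2 * x))) \<le> - ln 2"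
    by (rule ev[of _ "- (1 / (2 * x))"]) (auto simp: x0)
  have E3: "\<forall>\<^sub>F k in sequentially. L k * (- (d / 2)) \<le> - ln 2"
    by (rule ev[of _ "- (d / 2)"]) (auto simp: d0)
  have E4: "\<forall>\<^sub>F k in sequentially. L k * (- \<tau>) \<le> - (2 * ln 24)"
    by (rule ev[of _ "- \<tau>"]) (auto simp: \<tau>0)
  have E5: "\<forall>\<^sub>F k in sequentially. L k * (- ((r k)\<^sup>2 / y) + 1 / (2 * x) + \<beta> - \<tau> + c k) \<le> - (ln 12 + ln 2 + 2 * ln 24)"
    by (rule ev[of _ "- (\<rho>\<^sup>2 / y) + 1 / (2 * x) + \<beta> - \<tau> + 0"])
       (intro tendsto_intros clim rlim, use xy in simp, use \<tau>0 ce(6) in simp)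
  have E6: "\<forall>\<^sub>F k in sequentially. 0 < r k"
    using order_tendstoD(1)[OF rlim ce(2)] .
  have E7: "\<forall>\<^sub>F k in sequentially. L k * (- (e * (\<beta> - \<tau>) - 1 / (8 * x)) + c k / 4) \<le> - (72 + ln 4 + ln 12 / 2 + ln 12 / 4)"
    by (rule ev[of _ "- (e * (\<beta> - \<tau>) - 1 / (8 * x)) + 0 / 4"]) (intro tendsto_intros clim, simp, use gain in simp)
  have E8: "\<forall>\<^sub>F k in sequentially. L k * (- (\<beta> - \<tau>)) \<le> - real n0"
    by (rule ev[of _ "- (\<beta> - \<tau>)"]) (use \<tau>\<beta> in auto)
  note conditions = eventually_conj[OF eventually_gt_at_top[of "0 :: nat"] eventually_conj[OF E1 eventually_conj[OF E2
    eventually_conj[OF E3 eventually_conj[OF E4 eventually_conj[OF E5 eventually_conj[OF E6 eventually_conj[OF E7 E8]]]]]]]]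
  obtain k where k0: "0 < k" and
    F1: "L k * (- (d - \<tau>) + c k) \<le> - (ln 9 + ln 12)" and F2: "L k * (- (1 / (2 * x))) \<le> - ln 2"
    and F3: "L k * (- (d / 2)) \<le> - ln 2" and F4: "L k * (- \<tau>) \<le> - (2 * ln 24)"
    and F5: "L k * (- ((r k)\<^sup>2 / y) + 1 / (2 * x) + \<beta> - \<tau> + c k) \<le> - (ln 12 + ln 2 + 2 * ln 24)" and F6: "0 < r k"
    and F7: "L k * (- (e * (\<beta> - \<tau>) - 1 / (8 * x)) + c k / 4) \<le> - (72 + ln 4 + ln 12 / 2 + ln 12 / 4)"
    and F8: "L k * (- (\<beta> - \<tau>)) \<le> - real n0"
    using eventually_happens'[OF sequentially_bot conditions] by blast
  define \<Lambda> where "\<Lambda> = L k"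
  define C where "C = (real k + 1) * ln 2"
  have C: "\<Lambda> * c k = C" unfolding c_def \<Lambda>_def C_def using L1[of k] by simp
  define n where "n = nat \<lceil>exp (\<Lambda> * (\<beta> - \<tau>))\<rceil>"
  have n_lo: "exp (\<Lambda> * (\<beta> - \<tau>)) \<le> real n" unfolding n_def unfolding n_def by (rule real_nat_ceiling_ge)
  have n_pos: "0 < real n" using less_le_trans[OF exp_gt_zero n_lo] .
  have n_hi: "real n \<le> 2 * exp (\<Lambda> * (\<beta> - \<tau>))"
  proof -
    have "0 \<le> \<Lambda> * (\<beta> - \<tau>)" using \<tau>\<beta> L1[of k] by (simp add: \<Lambda>_def)
    then have "1 \<le> exp (\<Lambda> * (\<beta> - \<tau>))" by simp
    moreover have "real n \<le> exp (\<Lambda> * (\<beta> - \<tau>)) + 1"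
      unfolding n_def using of_int_ceiling_le_add_one[of "exp (\<Lambda> * (\<beta> - \<tau>))"] by simp
    ultimately show ?thesis by linarith
  qed
  have ln_lo: "\<Lambda> * (\<beta> - \<tau>) \<le> ln (real n)"
    using n_lo n_pos by (simp add: ln_ge_iff)
  have ln_hi: "ln (real n) \<le> ln 2 + \<Lambda> * (\<beta> - \<tau>)"
  proof -
    have "ln (real n) \<le> ln (2 * exp (\<Lambda> * (\<beta> - \<tau>)))" using n_hi n_pos by simp
    then show ?thesis by (simp add: ln_mult)
  qed
  have nn0: "n0 \<le> n"
  proof -
    have "real n0 \<le> \<Lambda> * (\<beta> - \<tau>)" using F8 unfolding \<Lambda>_def mult_minus_right by linarith
    also have "\<dots> \<le> exp (\<Lambda> * (\<beta> - \<tau>))" using exp_ge_add_one_self[of "\<Lambda> * (\<beta> - \<tau>)"] by linarith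
    also have "\<dots> \<le> real n" by (rule n_lo)
    finally show ?thesis by simp
  qed
  define p where "p = measure (spike_law K) {fact k..}"
  have sp: "spike_prob K (fact k) = exp (- (\<Lambda> / (2 * x))) / 12"
    by (simp add: spike_prob_def \<Lambda>_def L_def h_def x_def)
  have p_lo: "exp (- (\<Lambda> / (2 * x))) / 12 / 2 ^ (k + 1) \<le> p" and p_hi: "p \<le> exp (- (\<Lambda> / (2 * x))) / 12"
    using spike_law_tail[of K k] unfolding sp p_def by auto
  have p0: "0 < p" using p_lo by (rule less_le_trans[rotated]) simp
  have lnp_lo: "- (\<Lambda> / (2 * x)) - ln 12 - C \<le> ln p"
  proof -
    have "ln (exp (- (\<Lambda> / (2 * x))) / 12 / 2 ^ (k + 1)) \<le> ln p" using p_lo p0 by (subst ln_le_cancel_iff) auto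
    moreover have "ln (exp t / 12 / w) = t - ln 12 - ln w" if "0 < w" for t w :: real
      using that by (simp add: ln_div ln_mult)
    then have "ln (exp (- (\<Lambda> / (2 * x))) / 12 / 2 ^ (k + 1)) = - (\<Lambda> / (2 * x)) - ln 12 - ln (2 ^ (k + 1))"
      by this simp
    moreover have "ln (2 ^ (k + 1)) = C" unfolding C_def by (subst ln_realpow) auto
    ultimately show ?thesis by simp
  qed
  have lnp_hi: "ln p \<le> - (\<Lambda> / (2 * x)) - ln 12"
  proof -
    have "ln p \<le> ln (exp (- (\<Lambda> / (2 * x))) / 12)" using p_hi p0 by (subst ln_le_cancel_iff) auto
    then show ?thesis by (simp add: ln_div)
  qed
  define s where "s = sqrt (p / real n)"
  have s0: "0 < s" using p0 n_pos by (simp add: s_def)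
  have lns: "ln s = (ln p - ln (real n)) / 2" unfolding s_def using p0 n_pos by (simp add: ln_sqrt ln_div)
  define b where "b = \<rho> * h k"
  define \<eta> where "\<eta> = exp (- (fact k - b)\<^sup>2 / (2 * \<sigma>\<^sup>2))"
  define \<zeta> where "\<zeta> = exp (- (b - 1 - fact (k - 1))\<^sup>2 / (2 * \<sigma>\<^sup>2))"
  have \<eta>_eq: "\<eta> = exp (- (\<Lambda> * d / 2))"
  proof -
    have "(fact k - b)\<^sup>2 = \<Lambda> * (1 - \<rho>)\<^sup>2" by (simp add: b_def h_def \<Lambda>_def L_def power2_eq_square algebra_simps)
    then show ?thesis by (simp add: \<eta>_def d_def y_def)
  qed
  have gap: "b - 1 - fact (k - 1) = h k * r k"
  proof -
    have "(fact k :: real) = real k * fact (k - 1)" using k0 by (simp add: fact_reduce)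
    then have "h k / real k = fact (k - 1)" using k0 by (simp add: h_def)
    then show ?thesis using h1[of k] by (simp add: b_def r_def algebra_simps)
  qed
  have \<zeta>_eq: "\<zeta> = exp (- (\<Lambda> * ((r k)\<^sup>2 / y) / 2))"
    unfolding \<zeta>_def gap by (simp add: \<Lambda>_def L_def power_mult_distrib y_def)
  have d_eq: "d = \<beta> - 1 / (2 * x)" unfolding d_def by (rule ce(5))
  have lin: "\<Lambda> * (\<beta> - \<tau>) = \<Lambda> * \<beta> - \<Lambda> * \<tau>" "\<Lambda> * d = \<Lambda> * \<beta> - \<Lambda> / (2 * x)"
    unfolding d_eq by (simp_all add: right_diff_distrib)
  have "ennreal (exp (- 72) / 4 * sqrt (s / 12))
    \<le> iid_expectation n (spike_law K) (\<lambda>X. W2 (empirical n X \<star> gaussian \<sigma>) (spike_law K \<star> gaussian \<sigma>))"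
    unfolding s_def p_def
  proof (rule spike_W2_lower[of \<sigma> k b n K \<eta> \<zeta>])
    show "0 < \<sigma>" by (rule \<sigma>)
    show "fact (k - 1) < b - 1" using gap F6 h1[of k] mult_pos_pos[of "h k" "r k"] by linarith
    show "b < fact k" unfolding b_def using ce(3) h1[of k] by (simp add: h_def)
    show "\<eta> = exp (- (fact k - b)\<^sup>2 / (2 * \<sigma>\<^sup>2))" by (rule \<eta>_def)
    show "\<zeta> = exp (- (b - 1 - fact (k - 1))\<^sup>2 / (2 * \<sigma>\<^sup>2))" by (rule \<zeta>_def)
    show "9 \<le> real n * measure (spike_law K) {fact k..}"
    proof -
      have "ln 9 \<le> ln (real n) + ln p"
        using F1 ln_lo lnp_lo C lin unfolding \<Lambda>_def[symmetric] by (simp add: algebra_simps)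
      then have "ln 9 \<le> ln (real n * p)" using n_pos p0 by (simp add: ln_mult)
      then have "9 \<le> real n * p" using n_pos p0 by (subst (asm) ln_le_cancel_iff) auto
      then show ?thesis by (simp add: p_def)
    qed
    show "measure (spike_law K) {fact k..} \<le> 1 / 16"
    proof -
      have "- (\<Lambda> / (2 * x)) \<le> - ln 2" using F2 by (simp add: \<Lambda>_def)
      then have "exp (- (\<Lambda> / (2 * x))) \<le> exp (- ln 2)" by (subst exp_le_cancel_iff)
      also have "exp (- ln 2) = (1 / 2 :: real)" by (simp add: exp_minus)
      finally show ?thesis using p_hi by (simp add: p_def)
    qed
    show "\<eta> \<le> 1 / 2"
    proof -
      have "\<eta> \<le> exp (- ln 2)" unfolding \<eta>_eq using F3 by (simp add: \<Lambda>_def)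
      also have "exp (- ln 2) = (1 / 2 :: real)" by (simp add: exp_minus)
      finally show ?thesis .
    qed
    show "\<eta> * measure (spike_law K) {fact k..} \<le> sqrt (measure (spike_law K) {fact k..} / real n) / 24"
    proof -
      have "ln p + ln (real n) \<le> \<Lambda> * d - 2 * ln 24"
      proof -
        have "ln 2 \<le> ln (12 :: real)" by simp
        moreover have "2 * ln 24 \<le> \<Lambda> * \<tau>" using F4 by (simp add: \<Lambda>_def)
        ultimately show ?thesis using ln_hi lnp_hi unfolding lin by linarith
      qed
      then have "ln (\<eta> * p) \<le> ln (s / 24)" using p0 s0 lns by (simp add: ln_mult ln_div \<eta>_eq)
      then have "\<eta> * p \<le> s / 24" using p0 s0 by (subst (asm) ln_le_cancel_iff) (auto simp: \<eta>_eq)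
      then show ?thesis by (simp add: s_def p_def)
    qed
    show "\<zeta> \<le> sqrt (measure (spike_law K) {fact k..} / real n) / 24"
    proof -
      define Z where "Z = \<Lambda> * ((r k)\<^sup>2 / y)"
      have "- Z + \<Lambda> / (2 * x) + \<Lambda> * \<beta> - \<Lambda> * \<tau> + C \<le> - (ln 12 + ln 2 + 2 * ln 24)"
        using F5 C unfolding Z_def \<Lambda>_def[symmetric] by (simp add: distrib_left right_diff_distrib)
      moreover have "- (Z / 2) \<le> (lp - lN) / 2 - w"
        if "- Z + Q + B - T + C \<le> - (u + v + 2 * w)" "lN \<le> v + (B - T)" "- Q - u - C \<le> lp"
        for Q B T u v w lN lp :: real
      proof -
        have "- Z \<le> (lp - lN) - 2 * w" using that by simp
        then have "- Z / 2 \<le> ((lp - lN) - 2 * w) / 2" by (rule divide_right_mono) simp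
        then show ?thesis by (simp add: diff_divide_distrib)
      qed
      ultimately have "- (Z / 2) \<le> ln s - ln 24"
        using ln_hi lnp_lo unfolding lns lin by blast
      then have "ln \<zeta> \<le> ln (s / 24)" using s0 by (simp add: ln_div \<zeta>_eq Z_def)
      then have "\<zeta> \<le> s / 24" using s0 by (subst (asm) ln_le_cancel_iff) (auto simp: \<zeta>_eq)
      then show ?thesis by (simp add: s_def p_def)
    qed
  qed
  moreover have "real n powr (- \<alpha> - \<epsilon>) \<le> exp (- 72) / 4 * sqrt (s / 12)"
  proof -
    have F7': "- (\<Lambda> * (e * (\<beta> - \<tau>))) + \<Lambda> / (8 * x) + C / 4 \<le> - (72 + ln 4 + ln 12 / 2 + ln 12 / 4)"
      using F7 C unfolding \<Lambda>_def[symmetric] by (simp add: distrib_left right_diff_distrib)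
    have e_ln: "\<Lambda> * (e * (\<beta> - \<tau>)) \<le> e * ln (real n)"
      using mult_left_mono[OF ln_lo, of e] e0 by (simp add: mult.left_commute)
    have "0 \<le> - 72 - ln 4 + (ln s - ln 12) / 2 + (\<alpha> + \<epsilon>) * ln (real n)"
    proof -
      define Q where "Q = \<Lambda> / (8 * x)"
      have Q: "\<Lambda> / (2 * x) = 4 * Q" by (simp add: Q_def)
      have eN: "(\<alpha> + \<epsilon>) * ln (real n) = e * ln (real n) + ln (real n) / 4"
        by (simp add: e_def algebra_simps)
      have lower: "- (4 * Q) - ln 12 - C \<le> ln p" using lnp_lo unfolding Q .
      have "0 \<le> - 72 - a + ((lp - lN) / 2 - b) / 2 + (u + lN / 4)"
        if "- w + Q + C / 4 \<le> - (72 + a + b / 2 + b / 4)" "w \<le> u" "- (4 * Q) - b - C \<le> lp"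
        for a b u w lN lp :: real
      proof -
        have "((lp - lN) / 2 - b) / 2 = lp / 4 - lN / 4 - b / 2" by (simp add: diff_divide_distrib)
        then show ?thesis using that by linarith
      qed
      from this[OF F7'[folded Q_def] e_ln lower] show ?thesis unfolding lns eN .
    qed
    moreover have "(- \<alpha> - \<epsilon>) * ln (real n) = - ((\<alpha> + \<epsilon>) * ln (real n))" by (simp add: algebra_simps)
    ultimately have "(- \<alpha> - \<epsilon>) * ln (real n) \<le> - 72 - ln 4 + (ln s - ln 12) / 2" by linarith
    also have "\<dots> = ln (exp (- 72) / 4 * sqrt (s / 12))"
      using s0 by (simp add: ln_mult ln_div ln_sqrt)
    finally have "ln (real n powr (- \<alpha> - \<epsilon>)) \<le> ln (exp (- 72) / 4 * sqrt (s / 12))"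
      using n_pos by (simp add: ln_powr)
    then show ?thesis using s0 n_pos by (subst (asm) ln_le_cancel_iff) auto
  qed
  ultimately have "ennreal (real n powr (- \<alpha> - \<epsilon>)) \<le>
     iid_expectation n (spike_law K) (\<lambda>X. W2 (empirical n X \<star> gaussian \<sigma>) (spike_law K \<star> gaussian \<sigma>))"
    by (meson ennreal_leI order_trans)
  then show ?thesis using nn0 by blast
qed

section \<open>From all positive losses to a vanishing loss\<close>

text \<open>Up to a positive null sequence, \<open>\<delta>\<close> is the excess exponent \<open>ln (A n) / ln n + \<beta>\<close>, cut off below at \<open>0\<close>. The
  constants \<open>C\<close> contribute \<open>ln C / ln n\<close> to it, which tends to \<open>0\<close>.\<close>

lemma ex_vanishing_exponent_upper:
  fixes A :: "nat \<Rightarrow> real" and \<beta> :: real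
  assumes A0: "\<And>n. 0 \<le> A n"
    and bound: "\<And>\<epsilon>. 0 < \<epsilon> \<Longrightarrow> \<exists>C. \<forall>n\<ge>2. A n \<le> C * real n powr (- \<beta> + \<epsilon>)"
  shows "\<exists>\<delta>. (\<forall>n. 0 < \<delta> n) \<and> \<delta> \<longlonglongrightarrow> 0 \<and> (\<forall>n\<ge>2. A n \<le> real n powr (- \<beta> + \<delta> n))"
proof -
  define B where "B n = max (A n) (real n powr (- \<beta>))" for n
  define g where "g n = (if n < 2 then 0 else \<beta> + ln (B n) / ln (real n))" for n
  have B0: "0 < B n" if "2 \<le> n" for n using that by (simp add: B_def less_max_iff_disj)
  have lnn: "0 < ln (real n)" if "2 \<le> n" for n using that by simp
  have Bg: "B n = real n powr (- \<beta> + g n)" if "2 \<le> n" for n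
  proof -
    have "ln (B n) = (- \<beta> + g n) * ln (real n)" using that lnn[OF that] by (simp add: g_def)
    then have "exp (ln (B n)) = real n powr (- \<beta> + g n)" using that by (simp add: powr_def)
    then show ?thesis using B0[OF that] by simp
  qed
  have g0: "0 \<le> g n" for n
  proof (cases "n < 2")
    case False
    then have n: "2 \<le> n" by simp
    have "real n powr (- \<beta>) \<le> real n powr (- \<beta> + g n)" using Bg[OF n] by (simp add: B_def)
    then show ?thesis using n by (subst (asm) powr_le_cancel_iff) auto
  qed (simp add: g_def)
  have glim: "g \<longlonglongrightarrow> 0"
  proof (rule order_tendstoI)
    fix a :: real assume "a < 0"
    then show "\<forall>\<^sub>F n in sequentially. a < g n" by (intro always_eventually allI) (use g0 in \<open>auto intro: less_le_trans\<close>)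
  next
    fix a :: real assume a: "0 < a"
    then obtain C where C: "\<And>n. 2 \<le> n \<Longrightarrow> A n \<le> C * real n powr (- \<beta> + a / 2)"
      using bound[of "a / 2"] by auto
    define C' where "C' = max C 1"
    have C1: "1 \<le> C'" by (simp add: C'_def)
    have "filterlim (\<lambda>n. ln (real n)) at_top sequentially"
      by (rule filterlim_compose[OF ln_at_top filterlim_real_sequentially])
    then have "\<forall>\<^sub>F n in sequentially. 2 * ln C' / a < ln (real n)" by (simp add: filterlim_at_top_dense)
    then show "\<forall>\<^sub>F n in sequentially. g n < a"
      using eventually_ge_at_top[of 2]
    proof eventually_elim
      case (elim n)
      have "real n powr (- \<beta>) \<le> real n powr (- \<beta> + a / 2)" using elim a by (intro powr_mono) auto
      then have "real n powr (- \<beta>) \<le> C' * real n powr (- \<beta> + a / 2)"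
        using mult_right_mono[OF C1, of "real n powr (- \<beta> + a / 2)"] by simp
      moreover have "A n \<le> C' * real n powr (- \<beta> + a / 2)"
        using C[OF elim(2)] mult_right_mono[of C C' "real n powr (- \<beta> + a / 2)"] by (simp add: C'_def)
      ultimately have "B n \<le> C' * real n powr (- \<beta> + a / 2)" by (simp add: B_def)
      then have "ln (B n) \<le> ln (C' * real n powr (- \<beta> + a / 2))"
        using B0[OF elim(2)] C1 elim(2) by (subst ln_le_cancel_iff) auto
      also have "\<dots> = ln C' + (- \<beta> + a / 2) * ln (real n)" using C1 elim(2) by (simp add: ln_mult ln_powr)
      also have "\<dots> < (- \<beta> + a) * ln (real n)" using elim(1) a by (simp add: field_simps)
      finally have "ln (B n) / ln (real n) < - \<beta> + a" using lnn[OF elim(2)] by (simp add: divide_less_eq)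
      then show ?case using elim(2) by (simp add: g_def)
    qed
  qed
  define \<delta> where "\<delta> n = g n + inverse (real (Suc n))" for n
  have "\<forall>n. 0 < \<delta> n" using g0 by (auto simp: \<delta>_def add_nonneg_pos)
  moreover have "\<delta> \<longlonglongrightarrow> 0" unfolding \<delta>_def using tendsto_add[OF glim LIMSEQ_inverse_real_of_nat] by simp
  moreover have "A n \<le> real n powr (- \<beta> + \<delta> n)" if n: "2 \<le> n" for n
  proof -
    have "A n \<le> real n powr (- \<beta> + g n)" using Bg[OF n] by (simp add: B_def)
    also have "\<dots> \<le> real n powr (- \<beta> + \<delta> n)" using n by (intro powr_mono) (auto simp: \<delta>_def)
    finally show ?thesis .
  qed
  ultimately show ?thesis by blast
qed

text \<open>Along a sequence \<open>\<nu>\<close> of indices at which the bound holds with loss \<open>1 / (j + 1)\<close>, put \<open>\<delta> (\<nu> j) = 1 / (j + 1)\<close>; in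
  between, \<open>\<delta>\<close> is a step function, defined by counting the \<open>\<nu> j\<close> below \<open>n\<close>.\<close>

lemma ex_vanishing_exponent_lower:
  fixes a :: "nat \<Rightarrow> ennreal" and \<alpha> :: real
  assumes freq: "\<And>\<epsilon> n0. 0 < \<epsilon> \<Longrightarrow> \<exists>n\<ge>n0. ennreal (real n powr (- \<alpha> - \<epsilon>)) \<le> a n"
  shows "\<exists>\<delta>. (\<forall>n. 0 < \<delta> n) \<and> \<delta> \<longlonglongrightarrow> 0 \<and> 0 < limsup (\<lambda>n. ennreal (real n powr (\<alpha> + \<delta> n)) * a n)"
proof -
  define good where "good j n \<longleftrightarrow> ennreal (real n powr (- \<alpha> - 1 / real (Suc j))) \<le> a n" for j n
  have ex: "\<exists>n>m. good j n" for j m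
    using freq[of "1 / real (Suc j)" "Suc m"] unfolding good_def by (auto simp: Suc_le_eq)
  have "\<exists>\<nu>. \<forall>j. (good j (\<nu> j) \<and> 0 < \<nu> j) \<and> \<nu> j < \<nu> (Suc j)"
  proof (rule dependent_nat_choice)
    show "\<exists>n. good 0 n \<and> 0 < n" using ex[of 0 0] by blast
    show "\<exists>n'. (good (Suc j) n' \<and> 0 < n') \<and> n < n'" if "good j n \<and> 0 < n" for n j
    proof -
      obtain n' where "n < n'" "good (Suc j) n'" using ex[of n "Suc j"] by blast
      then show ?thesis by (intro exI[of _ n']) auto
    qed
  qed
  then obtain \<nu> where \<nu>: "\<And>j. good j (\<nu> j)" "\<And>j. 0 < \<nu> j" "\<And>j. \<nu> j < \<nu> (Suc j)" by blast
  have mono: "strict_mono \<nu>" using \<nu>(3) by (simp add: strict_mono_Suc_iff)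
  define N where "N n = card {j. \<nu> j < n}" for n
  have fin: "finite {j. \<nu> j < n}" for n
    by (rule finite_subset[of _ "{..n}"]) (auto dest: le_less_trans[OF strict_mono_imp_increasing[OF mono]])
  have N\<nu>: "N (\<nu> j) = j" for j
  proof -
    have "{i. \<nu> i < \<nu> j} = {..<j}" using mono by (auto simp: strict_mono_less)
    then show ?thesis by (simp add: N_def)
  qed
  have Nmono: "N m \<le> N n" if "m \<le> n" for m n
    unfolding N_def using that by (intro card_mono fin) auto
  have "filterlim N at_top sequentially"
    unfolding filterlim_at_top
  proof
    fix Z show "\<forall>\<^sub>F n in sequentially. Z \<le> N n"
      using eventually_ge_at_top[of "\<nu> Z"] by eventually_elim (use Nmono N\<nu> in metis)
  qed
  define \<delta> where "\<delta> n = inverse (real (Suc (N n)))" for n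
  have "\<forall>n. 0 < \<delta> n" by (simp add: \<delta>_def)
  moreover have "\<delta> \<longlonglongrightarrow> 0"
    unfolding \<delta>_def by (rule filterlim_compose[OF LIMSEQ_inverse_real_of_nat \<open>filterlim N at_top sequentially\<close>])
  moreover have "0 < limsup (\<lambda>n. ennreal (real n powr (\<alpha> + \<delta> n)) * a n)"
  proof -
    let ?f = "\<lambda>n. ennreal (real n powr (\<alpha> + \<delta> n)) * a n"
    have "1 \<le> ?f (\<nu> j)" for j
    proof -
      have e: "\<delta> (\<nu> j) = 1 / real (Suc j)" by (simp add: \<delta>_def N\<nu> inverse_eq_divide)
      have "(1::ennreal) = ennreal (real (\<nu> j) powr (\<alpha> + \<delta> (\<nu> j)) * real (\<nu> j) powr (- \<alpha> - 1 / real (Suc j)))"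
        using \<nu>(2)[of j] unfolding e by (simp add: powr_add[symmetric])
      also have "\<dots> = ennreal (real (\<nu> j) powr (\<alpha> + \<delta> (\<nu> j))) * ennreal (real (\<nu> j) powr (- \<alpha> - 1 / real (Suc j)))"
        by (simp add: ennreal_mult)
      also have "\<dots> \<le> ?f (\<nu> j)" using \<nu>(1)[of j] unfolding good_def by (intro mult_left_mono) auto
      finally show ?thesis .
    qed
    then have "1 \<le> limsup (?f \<circ> \<nu>)" by (intro le_Limsup) (auto simp: o_def)
    also have "\<dots> \<le> limsup ?f" by (rule limsup_subseq_mono[OF mono])
    finally show ?thesis by (rule less_le_trans[rotated]) simp
  qed
  ultimately show ?thesis by blast
qed

section \<open>The rate of convergence\<close>

theorem theorem2:
  fixes K \<sigma> \<alpha> :: real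
  assumes "0 < \<sigma>" and "\<sigma> < K"
    and "\<alpha> = (\<sigma>\<^sup>2 + K\<^sup>2)\<^sup>2 / (4 * (\<sigma>^4 + K^4))"
  shows "(\<exists>(P :: real measure) (\<delta> :: nat \<Rightarrow> real).
            subgaussian K P \<and> (\<forall>n. \<delta> n > 0) \<and> \<delta> \<longlonglongrightarrow> 0 \<and>
            limsup (\<lambda>n. ennreal (real n powr (\<alpha> + \<delta> n)) *
                iid_expectation n P (\<lambda>X. W2 (empirical n X \<star> gaussian \<sigma>) (P \<star> gaussian \<sigma>))) > 0)
       \<and> (\<exists>\<delta> :: nat \<Rightarrow> real.
            (\<forall>n. \<delta> n > 0) \<and> \<delta> \<longlonglongrightarrow> 0 \<and>
            (\<forall>P :: real measure. subgaussian K P \<longrightarrow> (\<forall>n\<ge>2.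
              iid_expectation n P (\<lambda>X. (W2 (P \<star> gaussian \<sigma>) (empirical n X \<star> gaussian \<sigma>))\<^sup>2)
                \<le> ennreal (real n powr (- 2 * \<alpha> + \<delta> n)))))"
proof (rule conjI)
  have "subgaussian K (spike_law K)" using assms by (intro subgaussian_spike_law) simp
  with ex_vanishing_exponent_lower[OF spike_rate[OF assms]]
  show "\<exists>(P :: real measure) (\<delta> :: nat \<Rightarrow> real).
            subgaussian K P \<and> (\<forall>n. \<delta> n > 0) \<and> \<delta> \<longlonglongrightarrow> 0 \<and>
            limsup (\<lambda>n. ennreal (real n powr (\<alpha> + \<delta> n)) *
                iid_expectation n P (\<lambda>X. W2 (empirical n X \<star> gaussian \<sigma>) (P \<star> gaussian \<sigma>))) > 0"
    by blast
next
  interpret noise_below_subgaussian K \<sigma> by unfold_locales (use assms in auto)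
  have rate: "(1 + \<kappa>) / 2 = 2 * \<alpha>"
  proof -
    have "a / E / 2 = 2 * (a / (4 * E))" for a E :: real by simp
    then show ?thesis unfolding \<kappa>_plus_1 assms(3) by (simp only: add.commute)
  qed
  define risk where "risk n P =
    iid_expectation n P (\<lambda>X. W2_sq (P \<star> gaussian \<sigma>) (empirical n X \<star> gaussian \<sigma>))" for n P
  \<comment> \<open>the worst case over all laws, since \<open>\<delta>\<close> must not depend on \<open>P\<close>\<close>
  define A where "A n = enn2real (SUP P\<in>Collect (subgaussian K). risk n P)" for n
  have sup_le: "(SUP P\<in>Collect (subgaussian K). risk n P) \<le> ennreal (upper_const \<theta> * real n powr (- (2 * \<alpha>) * (1 - \<theta>)))"
    if "1 \<le> n" "0 < \<theta>" "\<theta> < 1" for n \<theta>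
  proof (rule SUP_least)
    fix P assume "P \<in> Collect (subgaussian K)"
    then interpret subgaussian_sample K \<sigma> P by unfold_locales simp
    show "risk n P \<le> ennreal (upper_const \<theta> * real n powr (- (2 * \<alpha>) * (1 - \<theta>)))"
    proof -
      have "- (1 + \<kappa>) / 2 * (1 - \<theta>) = - (2 * \<alpha>) * (1 - \<theta>)" unfolding rate[symmetric] by (simp only: minus_divide_left)
      then show ?thesis using expected_W2_sq_le[OF that] by (simp only: risk_def)
    qed
  qed
  have risk_le: "risk n P \<le> ennreal (A n)" if "1 \<le> n" "subgaussian K P" for n P
  proof -
    have "risk n P \<le> (SUP P\<in>Collect (subgaussian K). risk n P)" using that by (intro SUP_upper) simp
    also have "\<dots> = ennreal (A n)"
      unfolding A_def using sup_le[OF that(1), of "1 / 2"]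
      by (intro ennreal_enn2real[symmetric]) (auto intro: le_less_trans)
    finally show ?thesis .
  qed
  have "\<exists>C. \<forall>n\<ge>2. A n \<le> C * real n powr (- (2 * \<alpha>) + \<epsilon>)" if \<epsilon>: "0 < \<epsilon>" for \<epsilon>
  proof -
    \<comment> \<open>as \<open>2 \<alpha> \<le> 1\<close>, the loss \<open>2 \<alpha> \<theta>\<close> from the interpolation is at most \<open>\<epsilon>\<close>\<close>
    define \<theta> where "\<theta> = min (1 / 2) \<epsilon>"
    have \<theta>: "0 < \<theta>" "\<theta> < 1" "\<theta> \<le> \<epsilon>" using \<epsilon> by (auto simp: \<theta>_def)
    have "2 * \<alpha> \<le> 1" using \<kappa>_bounds rate by simp
    then have "2 * \<alpha> * \<theta> \<le> 1 * \<epsilon>" using \<theta> by (intro mult_mono) auto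
    then have ex: "- (2 * \<alpha>) * (1 - \<theta>) \<le> - (2 * \<alpha>) + \<epsilon>" by (simp add: algebra_simps)
    have c0: "0 \<le> upper_const \<theta>"
      using \<theta> \<kappa>_bounds by (simp add: upper_const_def Let_def)
    have "A n \<le> upper_const \<theta> * real n powr (- (2 * \<alpha>) + \<epsilon>)" if n: "2 \<le> n" for n
    proof -
      have "A n \<le> upper_const \<theta> * real n powr (- (2 * \<alpha>) * (1 - \<theta>))"
        using enn2real_mono[OF sup_le[of n \<theta>]] n \<theta> c0 by (simp add: A_def)
      also have "\<dots> \<le> upper_const \<theta> * real n powr (- (2 * \<alpha>) + \<epsilon>)"
        using n ex c0 by (intro mult_left_mono powr_mono) auto
      finally show ?thesis .
    qed
    then show ?thesis by blast
  qed
  moreover have "0 \<le> A n" for n by (simp add: A_def)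
  ultimately obtain \<delta> where \<delta>: "\<forall>n. 0 < \<delta> n" "\<delta> \<longlonglongrightarrow> 0"
    and le: "\<And>n. n \<ge> 2 \<Longrightarrow> A n \<le> real n powr (- (2 * \<alpha>) + \<delta> n)"
    using ex_vanishing_exponent_upper[of A "2 * \<alpha>"] by blast
  have "iid_expectation n P (\<lambda>X. (W2 (P \<star> gaussian \<sigma>) (empirical n X \<star> gaussian \<sigma>))\<^sup>2)
      \<le> ennreal (real n powr (- 2 * \<alpha> + \<delta> n))" if "subgaussian K P" "n \<ge> 2" for P n
  proof -
    have "risk n P \<le> ennreal (A n)" using that by (intro risk_le) auto
    also have "\<dots> \<le> ennreal (real n powr (- 2 * \<alpha> + \<delta> n))" using le[OF that(2)] by (intro ennreal_leI) simp
    finally show ?thesis by (simp add: risk_def W2_power2)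
  qed
  with \<delta> show "\<exists>\<delta> :: nat \<Rightarrow> real.
            (\<forall>n. \<delta> n > 0) \<and> \<delta> \<longlonglongrightarrow> 0 \<and>
            (\<forall>P :: real measure. subgaussian K P \<longrightarrow> (\<forall>n\<ge>2.
              iid_expectation n P (\<lambda>X. (W2 (P \<star> gaussian \<sigma>) (empirical n X \<star> gaussian \<sigma>))\<^sup>2)
                \<le> ennreal (real n powr (- 2 * \<alpha> + \<delta> n))))"
    by blast
qed

end
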